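(* Let $G$ be a finite group, $H\subset G$ a subgroup, and $\mathcal O$ an $N_\infty$-operad for $G$. For any subgroup $K\subset G$, a finite $K$-set $T$ is admissible for $\mathrm{Map}_G(E\mathcal F_H,\mathcal O)$ if and only if for all $g\in G$, the $(H\cap gKg^{-1})$-set $i^{gKg^{-1}}_{H\cap gKg^{-1}}\,{}^gT$ is admissible for $\mathcal O$. In particular, if $i^G_H\mathcal O$ is genuine $H$-$E_\infty$, then $\mathrm{Map}_G(E\mathcal F_H,\mathcal O)$ is genuine $G$-$E_\infty$.
   Context: An $N_\infty$-operad for $G$ (Blumberg–Hill) is an operad $\mathcal O$ in $G$-spaces with each $\mathcal O_n$ a universal $G\times\Sigma_n$-space for a family $\mathcal F_{\mathcal O_n}$ of graph subgroups (subgroups meeting $1\times\Sigma_n$ trivially) containing all $K\times 1$. For $K\subset G$, a finite $K$-set $T$ with $|T|=n$ is admissible for $\mathcal O$ if the graph in $G\times\Sigma_n$ of the homomorphism $K\to\Sigma_n$ defining $T$ lies in $\mathcal F_{\mathcal O_n}$. $\mathcal O$ is genuine $G$-$E_\infty$ if all finite $K$-sets for all $K\subset G$ are admissible. $i^G_H\mathcal O$ is the restriction of $\mathcal O$ to an $N_\infty$-operad for $H$. ${}^gT$ is the $gKg^{-1}$-set obtained from $T$ by conjugation, and $i^{K}_{K'}$ is restriction of group actions. $\mathcal F_H$ is the family of subgroups of $G$ subconjugate to $H$, with universal $G$-space $E\mathcal F_H$. $\mathrm{Map}_G(E\mathcal F_H,\mathcal O)$ is the $N_\infty$-operad for $G$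 whose $n$-th space is the $G$-space of maps from $E\mathcal F_H$ to $\mathcal O_n$ (all maps, $G$ acting by conjugation), with $\Sigma_n$ acting via $\mathcal O_n$. *)

theory Defs
  imports "HOL-Analysis.Analysis" "HOL-Algebra.Group_Action" "HOL-Algebra.Sym_Groups"
begin

section \<open>Families of subgroups\<close>

definition subgroup_family :: "('g, 'b) monoid_scheme \<Rightarrow> 'g set set \<Rightarrow> bool" where
  "subgroup_family G F \<longleftrightarrow>
     (\<forall>L\<in>F. subgroup L G) \<and>
     (\<forall>L\<in>F. \<forall>L'. subgroup L' G \<and> L' \<subseteq> L \<longrightarrow> L' \<in> F) \<and>
     (\<forall>L\<in>F. \<forall>g\<in>carrier G. g <#\<^bsub>G\<^esub> L #>\<^bsub>G\<^esub> inv\<^bsub>G\<^esub> g \<in> F)"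

definition subconj_family :: "('g, 'b) monoid_scheme \<Rightarrow> 'g set \<Rightarrow> 'g set set" where
  "subconj_family G H =
     {L. subgroup L G \<and> (\<exists>g\<in>carrier G. g <#\<^bsub>G\<^esub> L #>\<^bsub>G\<^esub> inv\<^bsub>G\<^esub> g \<subseteq> H)}"


section \<open>G-spaces\<close>

text \<open>All groups acting here are finite and discrete, so an action is continuous as soon as every
  group element acts continuously.  No point-set restriction is imposed on the spaces.\<close>

definition G_space ::
  "('g, 'b) monoid_scheme \<Rightarrow> 'x topology \<Rightarrow> ('g \<Rightarrow> 'x \<Rightarrow> 'x) \<Rightarrow> bool" where
  "G_space G X \<phi> \<longleftrightarrow>
     group_action G (topspace X) \<phi> \<and> (\<forall>g\<in>carrier G. continuous_map X X (\<phi> g))"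

definition equivariant ::
  "('g, 'b) monoid_scheme \<Rightarrow> 'x topology \<Rightarrow> ('g \<Rightarrow> 'x \<Rightarrow> 'x) \<Rightarrow> ('g \<Rightarrow> 'y \<Rightarrow> 'y) \<Rightarrow> ('x \<Rightarrow> 'y) \<Rightarrow> bool" where
  "equivariant G X \<phi> \<psi> f \<longleftrightarrow>
     (\<forall>g\<in>carrier G. \<forall>x\<in>topspace X. f (\<phi> g x) = \<psi> g (f x))"

definition G_homotopy_equivalent ::
  "('g, 'b) monoid_scheme \<Rightarrow> 'x topology \<Rightarrow> ('g \<Rightarrow> 'x \<Rightarrow> 'x) \<Rightarrow> 'y topology \<Rightarrow> ('g \<Rightarrow> 'y \<Rightarrow> 'y) \<Rightarrow> bool" where
  "G_homotopy_equivalent G X \<phi> Y \<psi> \<longleftrightarrow>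
     (\<exists>f f'. continuous_map X Y f \<and> equivariant G X \<phi> \<psi> f \<and>
             continuous_map Y X f' \<and> equivariant G Y \<psi> \<phi> f' \<and>
             homotopic_with (equivariant G X \<phi> \<phi>) X X (f' \<circ> f) id \<and>
             homotopic_with (equivariant G Y \<psi> \<psi>) Y Y (f \<circ> f') id)"

definition fixed_space ::
  "'x topology \<Rightarrow> ('g \<Rightarrow> 'x \<Rightarrow> 'x) \<Rightarrow> 'g set \<Rightarrow> 'x topology" where
  "fixed_space X \<phi> L = subtopology X {x. \<forall>g\<in>L. \<phi> g x = x}"

text \<open>The empty space satisfies \<^const>\<open>contractible_space\<close>, so nonemptiness is required
  separately.\<close>

definition universal_space ::
  "('g, 'b) monoid_scheme \<Rightarrow> 'x topology \<Rightarrow> ('g \<Rightarrow> 'x \<Rightarrow> 'x) \<Rightarrow> 'g set set \<Rightarrow> bool" where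
  "universal_space G X \<phi> F \<longleftrightarrow>
     G_space G X \<phi> \<and> subgroup_family G F \<and>
     (\<forall>L. subgroup L G \<longrightarrow>
        (if L \<in> F
         then topspace (fixed_space X \<phi> L) \<noteq> {} \<and> contractible_space (fixed_space X \<phi> L)
         else topspace (fixed_space X \<phi> L) = {}))"


section \<open>G-CW complexes\<close>

definition disk :: "nat \<Rightarrow> (nat \<Rightarrow> real) topology" where
  "disk n = subtopology (Euclidean_space n) {x. (\<Sum>i<n. (x i)\<^sup>2) \<le> 1}"

definition left_cosets :: "('g, 'b) monoid_scheme \<Rightarrow> 'g set \<Rightarrow> 'g set set" where
  "left_cosets G K = (\<lambda>g. g <#\<^bsub>G\<^esub> K) ` carrier G"

text \<open>\<open>Sk n\<close> is the \<open>(n-1)\<close>-skeleton, so that \<open>Sk 0\<close> is empty.  For \<open>a \<in> I n\<close>, \<open>q n a\<close> is the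
  characteristic map of an equivariant \<open>n\<close>-cell \<open>G/K n a \<times> D\<^sup>n\<close>.  The conditions on \<open>q\<close> say that
  \<open>Sk (Suc n)\<close> is the pushout of \<open>Sk n\<close> and the disjoint union of the \<open>n\<close>-cells along their
  boundaries, both as a set and with the pushout topology; \<open>X\<close> is the colimit of its skeleta.
  Indexing cells by points of \<open>X\<close> is no restriction: index a cell by the image of its centre
  \<open>(K n a, 0)\<close>.\<close>

definition G_CW_complex ::
  "('g, 'b) monoid_scheme \<Rightarrow> 'x topology \<Rightarrow> ('g \<Rightarrow> 'x \<Rightarrow> 'x) \<Rightarrow> bool" where
  "G_CW_complex G X \<phi> \<longleftrightarrow>
     G_space G X \<phi> \<and> Hausdorff_space X \<and>
     (\<exists>(Sk :: nat \<Rightarrow> 'x set) (I :: nat \<Rightarrow> 'x set) (K :: nat \<Rightarrow> 'x \<Rightarrow> 'g set)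
       (q :: nat \<Rightarrow> 'x \<Rightarrow> 'g set \<times> (nat \<Rightarrow> real) \<Rightarrow> 'x).
        Sk 0 = {} \<and> (\<forall>n. Sk n \<subseteq> Sk (Suc n)) \<and> (\<Union>n. Sk n) = topspace X \<and>
        (\<forall>U\<subseteq>topspace X. openin X U \<longleftrightarrow> (\<forall>n. openin (subtopology X (Sk n)) (U \<inter> Sk n))) \<and>
        (\<forall>n. \<forall>a\<in>I n. subgroup (K n a) G) \<and>
        (\<forall>n. \<forall>a\<in>I n. \<forall>g\<in>carrier G. \<forall>c\<in>left_cosets G (K n a). \<forall>x\<in>topspace (disk n).
           q n a (g <#\<^bsub>G\<^esub> c, x) = \<phi> g (q n a (c, x))) \<and>
        (\<forall>n. \<forall>a\<in>I n. \<forall>c\<in>left_cosets G (K n a). \<forall>x\<in>topspace (disk n).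
           (\<Sum>i<n. (x i)\<^sup>2) = 1 \<longrightarrow> q n a (c, x) \<in> Sk n) \<and>
        (\<forall>n. bij_betw (\<lambda>(a, p). q n a p)
               (SIGMA a:I n. left_cosets G (K n a) \<times> {x \<in> topspace (disk n). (\<Sum>i<n. (x i)\<^sup>2) < 1})
               (Sk (Suc n) - Sk n)) \<and>
        (\<forall>n. \<forall>U\<subseteq>Sk (Suc n).
           openin (subtopology X (Sk (Suc n))) U \<longleftrightarrow>
           openin (subtopology X (Sk n)) (U \<inter> Sk n) \<and>
           (\<forall>a\<in>I n. openin (prod_topology (discrete_topology (left_cosets G (K n a))) (disk n))
                      {p \<in> left_cosets G (K n a) \<times> topspace (disk n). q n a p \<in> U})))"


section \<open>Operads in G-spaces\<close>

text \<open>An operad is recorded with its levels (all on one carrier type), on each level a joint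
  \<^emph>\<open>left\<close> action of \<open>G \<times> \<Sigma>\<^sub>n\<close>, the unit, and the composition maps
  \<open>\<O>\<^sub>k \<times> \<O>\<^bsub>j 1\<^esub> \<times> \<dots> \<times> \<O>\<^bsub>j k\<^esub> \<rightarrow> \<O>\<^bsub>j 1 + \<dots> + j k\<^esub>\<close>, where \<open>opcomp P k j\<close> is relevant only for
  \<open>j \<in> extensional {1..k}\<close>.  The usual right action of \<open>\<Sigma>\<^sub>n\<close> is \<open>x \<cdot> \<sigma> = opact P n (\<one>, \<sigma>\<inverse>) x\<close>; in
  terms of operations, input slot \<open>i\<close> of \<open>x\<close> becomes input slot \<open>\<sigma> i\<close> of \<open>opact P n (\<one>, \<sigma>) x\<close>.\<close>

record ('g, 'x) operad =
  level :: "nat \<Rightarrow> 'x topology"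
  opact :: "nat \<Rightarrow> 'g \<times> (nat \<Rightarrow> nat) \<Rightarrow> 'x \<Rightarrow> 'x"
  opunit :: 'x
  opcomp :: "nat \<Rightarrow> (nat \<Rightarrow> nat) \<Rightarrow> 'x \<Rightarrow> (nat \<Rightarrow> 'x) \<Rightarrow> 'x"

text \<open>If \<open>{1..j 1 + \<dots> + j k}\<close> is cut into consecutive blocks of sizes \<open>j 1, \<dots>, j k\<close>, then
  \<open>slot j i l\<close> is the \<open>l\<close>-th element of the \<open>i\<close>-th block.\<close>

definition slot :: "(nat \<Rightarrow> nat) \<Rightarrow> nat \<Rightarrow> nat \<Rightarrow> nat" where
  "slot j i l = (\<Sum>a\<in>{1..<i}. j a) + l"

abbreviation inputs :: "('g, 'x) operad \<Rightarrow> nat \<Rightarrow> (nat \<Rightarrow> nat) \<Rightarrow> (nat \<Rightarrow> 'x) topology" where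
  "inputs P k j \<equiv> product_topology (\<lambda>i. level P (j i)) {1..k}"

text \<open>In the two equivariance axioms for symmetric groups, \<open>\<rho>\<close> is uniquely determined: it is the
  block permutation induced by \<open>\<sigma>\<close>, respectively the block sum of the \<open>\<tau> i\<close>.\<close>

locale G_operad = group G
  for G :: "('g, 'b) monoid_scheme" (structure) and P :: "('g, 'x) operad" +
  assumes action: "G_space (G \<times>\<times> sym_group n) (level P n) (opact P n)"
    and comp_continuous: "j \<in> extensional {1..k} \<Longrightarrow>
      continuous_map (prod_topology (level P k) (inputs P k j)) (level P (\<Sum>i\<in>{1..k}. j i))
        (\<lambda>(c, d). opcomp P k j c d)"
    and comp_G_equivariant:
      "\<lbrakk>j \<in> extensional {1..k}; g \<in> carrier G; c \<in> topspace (level P k); d \<in> topspace (inputs P k j)\<rbrakk> \<Longrightarrow>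
      opcomp P k j (opact P k (g, id) c) (\<lambda>i\<in>{1..k}. opact P (j i) (g, id) (d i)) =
      opact P (\<Sum>i\<in>{1..k}. j i) (g, id) (opcomp P k j c d)"
    and comp_block_perm:
      "\<lbrakk>j \<in> extensional {1..k}; c \<in> topspace (level P k); d \<in> topspace (inputs P k j);
        \<sigma> permutes {1..k}; \<rho> permutes {1..\<Sum>i\<in>{1..k}. j i};
        \<And>i l. \<lbrakk>i \<in> {1..k}; l \<in> {1..j (\<sigma> i)}\<rbrakk> \<Longrightarrow> \<rho> (slot (j \<circ> \<sigma>) i l) = slot j (\<sigma> i) l\<rbrakk> \<Longrightarrow>
      opcomp P k j (opact P k (\<one>, \<sigma>) c) d =
      opact P (\<Sum>i\<in>{1..k}. j i) (\<one>, \<rho>)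
        (opcomp P k (\<lambda>i\<in>{1..k}. j (\<sigma> i)) c (\<lambda>i\<in>{1..k}. d (\<sigma> i)))"
    and comp_block_sum:
      "\<lbrakk>j \<in> extensional {1..k}; c \<in> topspace (level P k); d \<in> topspace (inputs P k j);
        \<And>i. i \<in> {1..k} \<Longrightarrow> \<tau> i permutes {1..j i}; \<rho> permutes {1..\<Sum>i\<in>{1..k}. j i};
        \<And>i l. \<lbrakk>i \<in> {1..k}; l \<in> {1..j i}\<rbrakk> \<Longrightarrow> \<rho> (slot j i l) = slot j i (\<tau> i l)\<rbrakk> \<Longrightarrow>
      opcomp P k j c (\<lambda>i\<in>{1..k}. opact P (j i) (\<one>, \<tau> i) (d i)) =
      opact P (\<Sum>i\<in>{1..k}. j i) (\<one>, \<rho>) (opcomp P k j c d)"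
    and unit_in: "opunit P \<in> topspace (level P 1)"
    and unit_fixed: "g \<in> carrier G \<Longrightarrow> opact P 1 (g, id) (opunit P) = opunit P"
    and unit_left: "x \<in> topspace (level P n) \<Longrightarrow>
      opcomp P 1 (\<lambda>i\<in>{1..1}. n) (opunit P) (\<lambda>i\<in>{1..1}. x) = x"
    and unit_right: "x \<in> topspace (level P n) \<Longrightarrow>
      opcomp P n (\<lambda>i\<in>{1..n}. 1) x (\<lambda>i\<in>{1..n}. opunit P) = x"
    and comp_assoc:
      "\<lbrakk>j \<in> extensional {1..k}; c \<in> topspace (level P k); d \<in> topspace (inputs P k j);
        m \<in> extensional {1..\<Sum>i\<in>{1..k}. j i}; e \<in> topspace (inputs P (\<Sum>i\<in>{1..k}. j i) m)\<rbrakk> \<Longrightarrow>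
      opcomp P (\<Sum>i\<in>{1..k}. j i) m (opcomp P k j c d) e =
      opcomp P k (\<lambda>i\<in>{1..k}. \<Sum>l\<in>{1..j i}. m (slot j i l)) c
        (\<lambda>i\<in>{1..k}. opcomp P (j i) (\<lambda>l\<in>{1..j i}. m (slot j i l)) (d i) (\<lambda>l\<in>{1..j i}. e (slot j i l)))"


section \<open>N-infinity operads and admissible sets\<close>

definition graph_subgroup_family :: "('g, 'b) monoid_scheme \<Rightarrow> nat \<Rightarrow> ('g \<times> (nat \<Rightarrow> nat)) set set \<Rightarrow> bool" where
  "graph_subgroup_family G n F \<longleftrightarrow>
     subgroup_family (G \<times>\<times> sym_group n) F \<and>
     (\<forall>\<Gamma>\<in>F. \<Gamma> \<inter> ({\<one>\<^bsub>G\<^esub>} \<times> carrier (sym_group n)) = {(\<one>\<^bsub>G\<^esub>, id)}) \<and>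
     (\<forall>K. subgroup K G \<longrightarrow> K \<times> {id} \<in> F)"

text \<open>The family \<open>F\<close> of a level is uniquely determined by the level, because
  \<^const>\<open>universal_space\<close> forces it to consist of the subgroups with a fixed point.

  The operad \<open>P\<close> may be regarded as an operad for any subgroup \<open>H\<close> of \<open>G\<close>: the restriction of
  \<open>P\<close> to \<open>H\<close> is \<open>P\<close> itself, with \<open>G\<lparr>carrier := H\<rparr>\<close> in place of \<open>G\<close>.\<close>

definition N_infty_operad :: "('g, 'b) monoid_scheme \<Rightarrow> ('g, 'x) operad \<Rightarrow> bool" where
  "N_infty_operad G P \<longleftrightarrow>
     G_operad G P \<and>
     (\<forall>n. \<exists>F. graph_subgroup_family G n F \<and>
              universal_space (G \<times>\<times> sym_group n) (level P n) (opact P n) F)"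

text \<open>An ordering \<open>b : T \<cong> {1..card T}\<close> turns an action \<open>\<psi>\<close> of \<open>K\<close> on \<open>T\<close> into a homomorphism from
  \<open>K\<close> to a symmetric group; another ordering yields a conjugate homomorphism.\<close>

definition set_hom :: "'t set \<Rightarrow> ('g \<Rightarrow> 't \<Rightarrow> 't) \<Rightarrow> ('t \<Rightarrow> nat) \<Rightarrow> 'g \<Rightarrow> nat \<Rightarrow> nat" where
  "set_hom T \<psi> b k = (\<lambda>i. if i \<in> {1..card T} then b (\<psi> k (inv_into T b i)) else i)"

text \<open>In \<open>admissible G P K T \<psi>\<close>, \<open>T\<close> is a finite \<open>K\<close>-set via \<open>\<psi>\<close>.  Only the values of \<open>\<psi>\<close> on \<open>K\<close>
  matter, so passing to a smaller \<open>K\<close> with the same \<open>T\<close> and \<open>\<psi>\<close> is restriction of the action.\<close>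

definition admissible ::
  "('g, 'b) monoid_scheme \<Rightarrow> ('g, 'x) operad \<Rightarrow> 'g set \<Rightarrow> 't set \<Rightarrow> ('g \<Rightarrow> 't \<Rightarrow> 't) \<Rightarrow> bool" where
  "admissible G P K T \<psi> \<longleftrightarrow>
     (\<exists>F b. graph_subgroup_family G (card T) F \<and>
            universal_space (G \<times>\<times> sym_group (card T)) (level P (card T)) (opact P (card T)) F \<and>
            bij_betw b T {1..card T} \<and>
            {(k, set_hom T \<psi> b k) | k. k \<in> K} \<in> F)"

text \<open>The underlying sets are taken in \<^typ>\<open>nat\<close>, which up to isomorphism covers all finite sets.\<close>

definition genuine_E_infty :: "('g, 'b) monoid_scheme \<Rightarrow> ('g, 'x) operad \<Rightarrow> bool" where
  "genuine_E_infty G P \<longleftrightarrow>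
     N_infty_operad G P \<and>
     (\<forall>K (T :: nat set) \<psi>. subgroup K G \<and> finite T \<and> group_action (G\<lparr>carrier := K\<rparr>) T \<psi> \<longrightarrow>
        admissible G P K T \<psi>)"

definition conj_action ::
  "('g, 'b) monoid_scheme \<Rightarrow> 'g \<Rightarrow> ('g \<Rightarrow> 't \<Rightarrow> 't) \<Rightarrow> 'g \<Rightarrow> 't \<Rightarrow> 't" where
  "conj_action G g \<psi> = (\<lambda>x. \<psi> (inv\<^bsub>G\<^esub> g \<otimes>\<^bsub>G\<^esub> x \<otimes>\<^bsub>G\<^esub> g))"


section \<open>Mapping operads\<close>

text \<open>Continuous maps are represented by their extensional representatives, with the compact-open
  topology.\<close>

definition map_space :: "'e topology \<Rightarrow> 'x topology \<Rightarrow> ('e \<Rightarrow> 'x) topology" where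
  "map_space E X = topology_generated_by
     {{f \<in> extensional (topspace E). continuous_map E X f \<and> f ` C \<subseteq> U} | C U. compactin E C \<and> openin X U}"

definition map_operad ::
  "('g, 'b) monoid_scheme \<Rightarrow> 'e topology \<Rightarrow> ('g \<Rightarrow> 'e \<Rightarrow> 'e) \<Rightarrow> ('g, 'x) operad \<Rightarrow> ('g, 'e \<Rightarrow> 'x) operad" where
  "map_operad G E \<phi> P =
     \<lparr>level = (\<lambda>n. map_space E (level P n)),
      opact = (\<lambda>n (g, \<sigma>). \<lambda>f\<in>topspace (map_space E (level P n)).
                 \<lambda>e\<in>topspace E. opact P n (g, \<sigma>) (f (\<phi> (inv\<^bsub>G\<^esub> g) e))),
      opunit = (\<lambda>e\<in>topspace E. opunit P),
      opcomp = (\<lambda>k j c d. \<lambda>e\<in>topspace E. opcomp P k j (c e) (\<lambda>i\<in>{1..k}. d i e))\<rparr>"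

end

theory Submission
  imports Defs
begin

text \<open>
Write \<open>X = \<O>\<^sub>n\<close>, with its action of \<open>G \<times> \<Sigma>\<^sub>n\<close>, and \<open>F\<close> for the family of this level.  A point of
\<open>Map(E, X)\<close> is fixed by a subgroup \<open>\<Gamma> \<le> G \<times> \<Sigma>\<^sub>n\<close> iff it is a \<open>\<Gamma>\<close>-equivariant map, where \<open>\<Gamma>\<close> acts on \<open>E\<close>
through the projection to \<open>G\<close>.  An equivariant map sends a point fixed by \<open>\<Lambda> \<le> \<Gamma>\<close> to a point fixed by
\<open>\<Lambda>\<close>.  So if such a map exists, then every \<open>\<Lambda> \<le> \<Gamma>\<close> whose projection to \<open>G\<close> is subconjugate to \<open>H\<close> belongs
to \<open>F\<close>.  Conversely, if this condition holds, then \<open>X\<close> has contractible fixed spaces for all isotropy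
groups of \<open>E\<close>, and obstruction theory shows that the space of equivariant maps is nonempty and
contractible.  Consequently the levels of \<open>Map(E, \<O>)\<close> are universal spaces for the families of all \<open>\<Gamma>\<close>
that satisfy the condition (\<open>coinduced_family\<close>, \<open>map_space_universal\<close>).

The contractibility (\<open>equivariant_maps_contractible\<close>) is meant for the compact-open topology and for
contractions in the strong sense, so the obstruction argument has to be carried out for families of
maps.  \<open>E\<close> is replaced by the equivalent \<open>G\<close>-CW complex \<open>Y\<close>.  Over a single cell, a map on the boundary
into a contractible space is extended by the radial formula \<open>cone_ext\<close>, which depends continuously on
the boundary values.  Induction over the skeleta (locale \<open>equivariant_extension\<close>) then extends arbitrary
parametrised families of equivariant maps.  With the space of all equivariant maps as parameter space,
this gives a contraction of that space.  The transition between continuity on cells and continuity in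
the compact-open topology rests on the fact that compact sets meet only finitely many open cells.

The rest is group theory.  Let \<open>\<Gamma>\<close> be the graph of an action of \<open>K\<close> on \<open>T\<close>.  The subgroups of \<open>\<Gamma>\<close> whose
projections are conjugated into \<open>H\<close> by a given \<open>g\<close> are the graphs over subgroups of \<open>K \<inter> g\<inverse>Hg\<close>.
Conjugation by \<open>(g, id)\<close> turns the largest of them into the graph of the restriction to \<open>H \<inter> gKg\<inverse>\<close> of
the conjugated action (\<open>graph_in_coinduced_family_iff\<close>).  As families are closed under subgroups and
conjugation, the criterion for admissibility follows.  If all finite sets over subgroups of \<open>H\<close> are
admissible, then the criterion is always satisfied.
\<close>

section \<open>Mapping spaces with the compact-open topology\<close>

lemma continuous_map_prod_closed:
  assumes "continuous_map (prod_topology A B) Z (\<lambda>(x, y). h x y)" "x \<in> topspace A" "y \<in> topspace B"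
  shows "h x y \<in> topspace Z"
  using continuous_map_image_subset_topspace[OF assms(1)] assms(2,3) by auto

lemma continuous_map_binop:
  assumes "continuous_map (prod_topology A B) Z (\<lambda>(x, y). h x y)"
    and "continuous_map P A f" "continuous_map P B g"
  shows "continuous_map P Z (\<lambda>p. h (f p) (g p))"
proof -
  have "continuous_map P Z ((\<lambda>(x, y). h x y) \<circ> (\<lambda>p. (f p, g p)))"
    using assms(2,3) by (intro continuous_map_compose[OF _ assms(1)] continuous_map_pairedI)
  then show ?thesis by (simp add: comp_def)
qed

text \<open>The projection along a compact factor is closed, so the tubes over \<open>C\<close> inside an open set form an
open set of base points.\<close>

lemma tube_open:
  assumes "openin (prod_topology W (subtopology Y C)) U" "compactin Y C"
  shows "openin W {w \<in> topspace W. \<forall>y\<in>C. (w, y) \<in> U}"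
proof -
  let ?Y = "subtopology Y C"
  have C: "topspace ?Y = C" using compactin_subset_topspace[OF assms(2)] by auto
  have "closed_map (prod_topology W ?Y) W fst"
    using assms(2) by (intro closed_map_fst) (simp add: compactin_subspace)
  moreover have "closedin (prod_topology W ?Y) (topspace W \<times> C - U)"
    using assms(1) C by (metis closedin_diff closedin_topspace topspace_prod_topology)
  ultimately have "closedin W (fst ` (topspace W \<times> C - U))" by (simp add: closed_map_def)
  moreover have "{w \<in> topspace W. \<forall>y\<in>C. (w, y) \<in> U} = topspace W - fst ` (topspace W \<times> C - U)"
    by force
  ultimately show ?thesis by auto
qed

lemma topspace_map_space:
  "topspace (map_space E X) = {f \<in> extensional (topspace E). continuous_map E X f}"
proof -
  have "\<exists>C U. compactin E C \<and> openin X U \<and> f ` C \<subseteq> U" for f :: "'a \<Rightarrow> 'b"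
    by (intro exI[of _ "{}"]) auto
  then show ?thesis unfolding map_space_def by auto
qed

text \<open>Half of the exponential law for the compact-open topology: it suffices that the adjoint is jointly
continuous on each compact part of the source.  In the applications the parameter space \<open>W\<close> is
itself built from mapping spaces.\<close>

lemma map_spaceI:
  assumes "\<And>w. w \<in> topspace W \<Longrightarrow> F w \<in> topspace (map_space E X)"
    and "\<And>C. compactin E C \<Longrightarrow> continuous_map (prod_topology W (subtopology E C)) X (\<lambda>(w, e). F w e)"
  shows "continuous_map W (map_space E X) F"
  unfolding map_space_def
proof (rule continuous_on_generated_topo)
  show "F ` topspace W \<subseteq> \<Union> {{f \<in> extensional (topspace E). continuous_map E X f \<and> f ` C \<subseteq> U} | C U.
      compactin E C \<and> openin X U}"
    using assms(1) unfolding map_space_def by auto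
next
  fix V assume "V \<in> {{f \<in> extensional (topspace E). continuous_map E X f \<and> f ` C \<subseteq> U} | C U.
      compactin E C \<and> openin X U}"
  then obtain C U where CU: "compactin E C" "openin X U"
    and V: "V = {f \<in> extensional (topspace E). continuous_map E X f \<and> f ` C \<subseteq> U}" by auto
  have sub: "C \<subseteq> topspace E" using CU(1) by (rule compactin_subset_topspace)
  let ?P = "{p \<in> topspace (prod_topology W (subtopology E C)). (case p of (w, e) \<Rightarrow> F w e) \<in> U}"
  have "openin (prod_topology W (subtopology E C)) ?P"
    using assms(2)[OF CU(1)] CU(2) by (rule openin_continuous_map_preimage)
  from tube_open[OF this CU(1)]
  have "openin W {w \<in> topspace W. \<forall>e\<in>C. (w, e) \<in> ?P}" .
  moreover have "{w \<in> topspace W. \<forall>e\<in>C. (w, e) \<in> ?P} = F -` V \<inter> topspace W"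
    using assms(1) sub by (auto simp: V topspace_map_space)
  ultimately show "openin W (F -` V \<inter> topspace W)" by simp
qed

lemma continuous_map_restrict:
  assumes "continuous_map E X f"
  shows "(\<lambda>e\<in>topspace E. f e) \<in> topspace (map_space E X)"
  unfolding topspace_map_space
  using continuous_map_eq[OF assms, of "\<lambda>e\<in>topspace E. f e"] by simp

text \<open>The form in which \<open>map_spaceI\<close> is applied: points of a mapping space are extensional, so formulas
have to be cut off outside the source.\<close>

lemma map_space_restrictI:
  assumes "\<And>w. w \<in> topspace W \<Longrightarrow> continuous_map E X (F w)"
    and "\<And>C. compactin E C \<Longrightarrow> continuous_map (prod_topology W (subtopology E C)) X (\<lambda>(w, e). F w e)"
  shows "continuous_map W (map_space E X) (\<lambda>w. \<lambda>e\<in>topspace E. F w e)"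
proof (rule map_spaceI)
  show "(\<lambda>e\<in>topspace E. F w e) \<in> topspace (map_space E X)" if "w \<in> topspace W" for w
    using assms(1)[OF that] by (rule continuous_map_restrict)
  fix C assume "compactin E C"
  from assms(2)[OF this]
  show "continuous_map (prod_topology W (subtopology E C)) X (\<lambda>(w, e). (\<lambda>e\<in>topspace E. F w e) e)"
    by (rule continuous_map_eq) auto
qed

text \<open>The other half of the exponential law.  Evaluation \<open>map_space E X \<times> E \<rightarrow> X\<close> need not
be continuous unless \<open>E\<close> is locally compact; it is therefore precomposed with a map from a compact Hausdorff
space, where each point has arbitrarily small compact neighbourhoods.\<close>

lemma map_space_eval:
  assumes S: "compact_space S" "Hausdorff_space S" and g: "continuous_map S E g"
  shows "continuous_map (prod_topology (map_space E X) S) X (\<lambda>(f, s). f (g s))"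
  unfolding continuous_map_def
proof (intro conjI allI impI)
  let ?P = "prod_topology (map_space E X) S"
  show "(\<lambda>(f, s). f (g s)) \<in> topspace ?P \<rightarrow> topspace X"
    using g by (auto simp: topspace_map_space continuous_map_def)
  fix U assume U: "openin X U"
  have nb: "neighbourhood_base_of (\<lambda>C. compactin S C \<and> closedin S C) S"
    using S compact_imp_locally_compact_space locally_compact_Hausdorff_imp_regular_space
      locally_compact_regular_space_neighbourhood_base by blast
  show "openin ?P {p \<in> topspace ?P. (case p of (f, s) \<Rightarrow> f (g s)) \<in> U}"
  proof (subst openin_subopen, clarsimp)
    fix f s assume f: "f \<in> topspace (map_space E X)" and s: "s \<in> topspace S" and fU: "f (g s) \<in> U"
    have "continuous_map S X (f \<circ> g)"
      using f g by (auto simp: topspace_map_space intro: continuous_map_compose)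
    then have "openin S {x \<in> topspace S. (f \<circ> g) x \<in> U}" using U by (rule openin_continuous_map_preimage)
    then obtain O1 C where O1: "openin S O1" "s \<in> O1" "O1 \<subseteq> C" "compactin S C"
      "C \<subseteq> {x \<in> topspace S. (f \<circ> g) x \<in> U}"
      using nb s fU unfolding neighbourhood_base_of by (metis (mono_tags, lifting) comp_apply mem_Collect_eq)
    let ?V = "{f \<in> extensional (topspace E). continuous_map E X f \<and> f ` (g ` C) \<subseteq> U}"
    have "openin (map_space E X) ?V"
      unfolding map_space_def using U image_compactin[OF O1(4) g]
      by (intro topology_generated_by_Basis) blast
    then have "openin ?P (?V \<times> O1)" using O1(1) by (simp add: openin_prod_Times_iff)
    moreover have "(f, s) \<in> ?V \<times> O1" using f O1 by (auto simp: topspace_map_space)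
    moreover have "?V \<times> O1 \<subseteq> {p \<in> topspace ?P. (case p of (f, s) \<Rightarrow> f (g s)) \<in> U}"
      using O1(3) openin_subset[OF O1(1)] by (force simp: topspace_map_space)
    ultimately show "\<exists>T. openin ?P T \<and> (f, s) \<in> T \<and>
       T \<subseteq> {p \<in> topspace (map_space E X) \<times> topspace S. (case p of (f, s) \<Rightarrow> f (g s)) \<in> U}"
      unfolding topspace_prod_topology by (intro exI[of _ "?V \<times> O1"] conjI)
  qed
qed

section \<open>Radial extension over a cylinder\<close>

definition radius :: "nat \<Rightarrow> (nat \<Rightarrow> real) \<Rightarrow> real" where
  "radius n x = sqrt (\<Sum>i<n. (x i)\<^sup>2)"

text \<open>The cylinder \<open>[-\<delta>, \<delta>] \<times> D\<^sup>n\<close> is the unit ball of the norm \<open>max(|t|, |x|)\<close> when \<open>\<delta> = 1\<close>.  For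
\<open>\<delta> = 0\<close> it is a copy of the disk.  Its rim consists of the points of norm \<open>1\<close>: the side of the cylinder
and, when \<open>\<delta> = 1\<close>, both lids.  Treating the two cases together makes one extension argument yield
both the existence of maps (\<open>\<delta> = 0\<close>) and the existence of homotopies (\<open>\<delta> = 1\<close>).\<close>

definition cyl_norm :: "nat \<Rightarrow> real \<times> (nat \<Rightarrow> real) \<Rightarrow> real" where
  "cyl_norm n b = max \<bar>fst b\<bar> (radius n (snd b))"

definition cyl_scale :: "real \<Rightarrow> real \<times> (nat \<Rightarrow> real) \<Rightarrow> real \<times> (nat \<Rightarrow> real)" where
  "cyl_scale r b = (r * fst b, \<lambda>i. r * snd b i)"

definition cylinder :: "real \<Rightarrow> nat \<Rightarrow> (real \<times> (nat \<Rightarrow> real)) topology" where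
  "cylinder \<delta> n = prod_topology (top_of_set {-\<delta>..\<delta>}) (disk n)"

definition rim :: "real \<Rightarrow> nat \<Rightarrow> (real \<times> (nat \<Rightarrow> real)) set" where
  "rim \<delta> n = {b \<in> topspace (cylinder \<delta> n). cyl_norm n b = 1}"

lemma disk_euclidean: "disk n = top_of_set {x. (\<forall>i\<ge>n. x i = 0) \<and> (\<Sum>i<n. (x i)\<^sup>2) \<le> 1}"
  unfolding disk_def Euclidean_space_def euclidean_product_topology subtopology_subtopology
  by (auto intro: arg_cong2[where f = subtopology])

lemma topspace_disk: "topspace (disk n) = {x. (\<forall>i\<ge>n. x i = 0) \<and> (\<Sum>i<n. (x i)\<^sup>2) \<le> 1}"
  by (simp add: disk_euclidean)

lemma topspace_disk_radius: "topspace (disk n) = {x. (\<forall>i\<ge>n. x i = 0) \<and> radius n x \<le> 1}"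
  by (auto simp: topspace_disk radius_def)

lemma Hausdorff_disk: "Hausdorff_space (disk n)"
  by (simp add: disk_euclidean Hausdorff_space_subtopology)

lemma closed_disk: "closed {x :: nat \<Rightarrow> real. (\<forall>i\<ge>n. x i = 0) \<and> (\<Sum>i<n. (x i)\<^sup>2) \<le> 1}"
proof -
  have "closed {x :: nat \<Rightarrow> real. x i = 0}" for i
    by (intro closed_Collect_eq continuous_intros) (auto intro: continuous_on_product_coordinates)
  then have "closed (\<Inter>i\<in>{n..}. {x :: nat \<Rightarrow> real. x i = 0})" by blast
  moreover have "closed {x :: nat \<Rightarrow> real. (\<Sum>i<n. (x i)\<^sup>2) \<le> 1}"
    by (intro closed_Collect_le continuous_intros continuous_on_product_coordinates)
  ultimately have "closed ((\<Inter>i\<in>{n..}. {x :: nat \<Rightarrow> real. x i = 0}) \<inter> {x. (\<Sum>i<n. (x i)\<^sup>2) \<le> 1})"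
    by (rule closed_Int)
  moreover have "(\<Inter>i\<in>{n..}. {x :: nat \<Rightarrow> real. x i = 0}) \<inter> {x. (\<Sum>i<n. (x i)\<^sup>2) \<le> 1}
     = {x. (\<forall>i\<ge>n. x i = 0) \<and> (\<Sum>i<n. (x i)\<^sup>2) \<le> 1}" by auto
  ultimately show ?thesis by simp
qed

lemma compact_disk: "compact_space (disk n)"
proof -
  let ?D = "{x :: nat \<Rightarrow> real. (\<forall>i\<ge>n. x i = 0) \<and> (\<Sum>i<n. (x i)\<^sup>2) \<le> 1}"
  have "compactin (powertop_real UNIV) (PiE UNIV (\<lambda>_. {-1..1}))"
    by (simp add: compactin_PiE)
  then have cp: "compactin euclidean (PiE UNIV (\<lambda>_. {-1..1}) :: (nat \<Rightarrow> real) set)"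
    by (simp add: euclidean_product_topology)
  have "?D \<subseteq> PiE UNIV (\<lambda>_. {-1..1})"
  proof
    fix x assume x: "x \<in> ?D"
    have "x i \<in> {-1..1}" for i
    proof (cases "i < n")
      case True
      then have "(x i)\<^sup>2 \<le> (\<Sum>i<n. (x i)\<^sup>2)" by (intro member_le_sum) auto
      then have "(x i)\<^sup>2 \<le> 1" using x by auto
      then have "\<bar>x i\<bar> \<le> 1" by (simp add: abs_square_le_1)
      then show ?thesis by auto
    next
      case False
      then show ?thesis using x by auto
    qed
    then show "x \<in> PiE UNIV (\<lambda>_. {-1..1})" by auto
  qed
  then have "compactin euclidean ?D"
    by (rule closed_compactin[OF cp]) (rule closed_disk[unfolded closed_closedin])
  then show ?thesis by (simp add: disk_euclidean compact_space_subtopology)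
qed

lemma continuous_radius: "continuous_map (disk n) euclideanreal (radius n)"
  unfolding disk_euclidean radius_def
  by (auto intro!: continuous_intros continuous_on_subset[OF continuous_on_product_coordinates])

lemma closedin_sphere: "closedin (disk n) {x \<in> topspace (disk n). (\<Sum>i<n. (x i)\<^sup>2) = 1}"
proof -
  have "closedin (disk n) {x \<in> topspace (disk n). radius n x \<in> {1}}"
    by (rule closedin_continuous_map_preimage[OF continuous_radius]) simp
  moreover have "radius n x \<in> {1} \<longleftrightarrow> (\<Sum>i<n. (x i)\<^sup>2) = 1" for x by (simp add: radius_def)
  ultimately show ?thesis by simp
qed

lemma sphere_compact: "compactin (disk n) {x \<in> topspace (disk n). (\<Sum>i<n. (x i)\<^sup>2) = 1}"
  by (rule closedin_compact_space[OF compact_disk closedin_sphere])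

lemma zero_in_disk: "(\<lambda>i. 0) \<in> topspace (disk n)"
  by (simp add: topspace_disk)

lemma topspace_cylinder:
  "topspace (cylinder \<delta> n) = {b. \<bar>fst b\<bar> \<le> \<delta> \<and> snd b \<in> topspace (disk n)}"
  by (auto simp: cylinder_def)

lemma continuous_cyl_norm: "continuous_map (cylinder \<delta> n) euclideanreal (cyl_norm n)"
proof -
  have "continuous_map (cylinder \<delta> n) euclideanreal fst"
    unfolding cylinder_def by (rule continuous_map_into_fulltopology[OF continuous_map_fst])
  moreover have "continuous_map (cylinder \<delta> n) euclideanreal (radius n \<circ> snd)"
    unfolding cylinder_def by (rule continuous_map_compose[OF continuous_map_snd continuous_radius])
  ultimately show ?thesis unfolding cyl_norm_def comp_def
    by (intro continuous_map_real_max continuous_map_real_abs)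
qed

lemma compact_cylinder: "compact_space (cylinder \<delta> n)"
  unfolding cylinder_def compact_space_prod_topology using compact_disk
  by (simp add: compact_space_subtopology)

lemma Hausdorff_cylinder: "Hausdorff_space (cylinder \<delta> n)"
  unfolding cylinder_def Hausdorff_space_prod_topology using Hausdorff_disk
  by (simp add: Hausdorff_space_subtopology)

lemma compact_rim: "compactin (cylinder \<delta> n) (rim \<delta> n)"
proof -
  have "closedin (cylinder \<delta> n) {b \<in> topspace (cylinder \<delta> n). cyl_norm n b \<in> {1}}"
    by (rule closedin_continuous_map_preimage[OF continuous_cyl_norm]) simp
  then show ?thesis unfolding rim_def by (simp add: closedin_compact_space compact_cylinder)
qed

lemma radius_scale: "radius n (\<lambda>i. r * x i) = \<bar>r\<bar> * radius n x"
proof -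
  have "(\<Sum>i<n. (r * x i)\<^sup>2) = r\<^sup>2 * (\<Sum>i<n. (x i)\<^sup>2)"
    unfolding power_mult_distrib sum_distrib_left ..
  then show ?thesis unfolding radius_def by (simp only: real_sqrt_mult real_sqrt_abs)
qed

lemma radius_nonneg: "0 \<le> radius n x"
  by (simp add: radius_def sum_nonneg)

lemma cyl_norm_scale: "cyl_norm n (cyl_scale r b) = \<bar>r\<bar> * cyl_norm n b"
  unfolding cyl_norm_def cyl_scale_def fst_conv snd_conv radius_scale abs_mult
  by (simp only: max_mult_distrib_left abs_ge_zero if_True)

lemma cyl_norm_nonneg: "0 \<le> cyl_norm n b"
  by (simp add: cyl_norm_def)

lemma cyl_norm_eq_0:
  assumes "b \<in> topspace (cylinder \<delta> n)" "cyl_norm n b = 0"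
  shows "b = (0, \<lambda>i. 0)"
proof -
  have "\<bar>fst b\<bar> \<le> 0" "radius n (snd b) \<le> 0" using assms(2) by (auto simp: cyl_norm_def max_def split: if_splits)
  then have *: "fst b = 0" "radius n (snd b) = 0" using radius_nonneg[of n "snd b"] by auto
  then have "(\<Sum>i<n. (snd b i)\<^sup>2) = 0" by (simp add: radius_def)
  then have "\<forall>i<n. snd b i = 0" by (subst (asm) sum_nonneg_eq_0_iff) auto
  then have "snd b = (\<lambda>i. 0)" using assms(1) by (auto simp: topspace_cylinder topspace_disk) (metis leI)
  with * show ?thesis by (simp add: prod_eq_iff)
qed

lemma cyl_norm_le_1:
  assumes "\<delta> \<in> {0, 1}" "b \<in> topspace (cylinder \<delta> n)"
  shows "cyl_norm n b \<le> 1"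
  using assms by (auto simp: cyl_norm_def topspace_cylinder topspace_disk_radius)

lemma scale_in_cylinder:
  assumes "b \<in> topspace (cylinder \<delta> n)" "0 \<le> r" "r \<le> 1"
  shows "cyl_scale r b \<in> topspace (cylinder \<delta> n)"
proof -
  have "r * radius n (snd b) \<le> 1" "r * \<bar>fst b\<bar> \<le> \<delta>"
    using assms mult_mono[of r 1 "radius n (snd b)" 1] mult_mono[of r 1 "\<bar>fst b\<bar>" \<delta>] radius_nonneg[of n "snd b"]
    by (auto simp: topspace_cylinder topspace_disk_radius)
  then show ?thesis using assms
    by (auto simp: topspace_cylinder topspace_disk_radius cyl_scale_def radius_scale abs_mult)
qed

lemma normalise_in_rim:
  assumes "\<delta> \<in> {0, 1}" "b \<in> topspace (cylinder \<delta> n)" "cyl_norm n b \<noteq> 0"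
  shows "cyl_scale (1 / cyl_norm n b) b \<in> rim \<delta> n"
proof -
  let ?r = "cyl_norm n b"
  have r: "?r > 0" using assms(3) cyl_norm_nonneg[of n b] by auto
  have "\<bar>fst b\<bar> \<le> ?r" "radius n (snd b) \<le> ?r" by (auto simp: cyl_norm_def)
  moreover have "fst b = 0" if "\<delta> = 0" using that assms by (auto simp: topspace_cylinder)
  ultimately have "cyl_scale (1 / ?r) b \<in> topspace (cylinder \<delta> n)"
    using r assms by (auto simp: topspace_cylinder topspace_disk_radius cyl_scale_def radius_scale[of n "1 / ?r", simplified] abs_mult)
  then show ?thesis using r by (simp add: rim_def cyl_norm_scale)
qed

text \<open>A function \<open>\<beta>\<close> on the rim, with values in a space contracted by \<open>\<kappa>\<close>, is extended radially: the point
\<open>r\<theta>\<close> with \<open>\<theta>\<close> on the rim is sent to the image of \<open>\<beta> \<theta>\<close> at time \<open>1 - r\<close> of the contraction.  The formula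
is natural in \<open>\<beta>\<close>; hence whole families of functions are extended simultaneously.\<close>

definition cone_ext ::
  "nat \<Rightarrow> (real \<times> 'z \<Rightarrow> 'z) \<Rightarrow> 'z \<Rightarrow> (real \<times> (nat \<Rightarrow> real) \<Rightarrow> 'z) \<Rightarrow> real \<times> (nat \<Rightarrow> real) \<Rightarrow> 'z" where
  "cone_ext n \<kappa> z0 \<beta> b =
     (if cyl_norm n b = 0 then z0 else \<kappa> (1 - cyl_norm n b, \<beta> (cyl_scale (1 / cyl_norm n b) b)))"

lemma continuous_scale:
  "continuous_map (prod_topology (top_of_set {0..1}) (cylinder \<delta> n)) (cylinder \<delta> n) (\<lambda>(r, b). cyl_scale r b)"
proof -
  let ?P = "prod_topology (top_of_set {0..1 :: real}) (cylinder \<delta> n)"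
  have 1: "continuous_map ?P euclideanreal fst"
    by (rule continuous_map_into_fulltopology[OF continuous_map_fst])
  have 2: "continuous_map ?P (cylinder \<delta> n) snd" by (rule continuous_map_snd)
  have 3: "continuous_map ?P euclideanreal (\<lambda>p. fst (snd p))"
    using continuous_map_compose[OF 2[unfolded cylinder_def]
        continuous_map_into_fulltopology[OF continuous_map_fst]]
    by (simp add: cylinder_def comp_def)
  have 4: "continuous_map ?P (disk n) (\<lambda>p. snd (snd p))"
    using continuous_map_compose[OF 2[unfolded cylinder_def] continuous_map_snd]
    by (simp add: cylinder_def comp_def)
  have 5: "continuous_map ?P euclideanreal (\<lambda>p. snd (snd p) i)" for i
    using 4 unfolding disk_euclidean continuous_map_in_subtopology
    by (simp add: continuous_map_componentwise_UNIV flip: euclidean_product_topology)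
  have "continuous_map ?P (prod_topology euclideanreal (powertop_real UNIV)) (\<lambda>p. cyl_scale (fst p) (snd p))"
    unfolding cyl_scale_def continuous_map_paired continuous_map_componentwise_UNIV
    using 1 3 5 by (intro conjI allI continuous_map_real_mult)
  then have "continuous_map ?P (subtopology (prod_topology euclideanreal (powertop_real UNIV)) ({-\<delta>..\<delta>} \<times> topspace (disk n)))
      (\<lambda>p. cyl_scale (fst p) (snd p))"
  proof (rule continuous_map_into_subtopology, intro Pi_I)
    fix p assume "p \<in> topspace ?P"
    then have "cyl_scale (fst p) (snd p) \<in> topspace (cylinder \<delta> n)"
      by (intro scale_in_cylinder) auto
    then show "cyl_scale (fst p) (snd p) \<in> {-\<delta>..\<delta>} \<times> topspace (disk n)"
      by (simp add: topspace_cylinder mem_Times_iff) linarith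
  qed
  moreover have "subtopology (prod_topology euclideanreal (powertop_real UNIV)) ({-\<delta>..\<delta>} \<times> topspace (disk n)) = cylinder \<delta> n"
    unfolding cylinder_def disk_euclidean euclidean_product_topology subtopology_Times by simp
  ultimately show ?thesis by (simp add: split_def)
qed

text \<open>Unless the rim is empty and the cylinder is a single point, the cylinder is the quotient of
\<open>[0, 1] \<times> rim\<close> under \<open>(r, \<theta>) \<mapsto> r\<theta>\<close>.  This quotient map is proper,
since its source is compact and its target is Hausdorff, and proper maps are stable under products;
hence it remains a quotient map after multiplication with the arbitrary parameter space \<open>W\<close>.  In polar
coordinates the extension is given by a single formula, whose continuity is evident.\<close>

lemma continuous_cone_ext:
  assumes \<delta>: "\<delta> \<in> {0, 1}"
    and \<kappa>: "continuous_map (prod_topology (top_of_set {0..1}) Z) Z \<kappa>"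
    and z0: "z0 \<in> topspace Z" "\<And>z. z \<in> topspace Z \<Longrightarrow> \<kappa> (1, z) = z0"
    and \<beta>: "continuous_map (prod_topology W (subtopology (cylinder \<delta> n) (rim \<delta> n))) Z (\<lambda>(w, b). \<beta> w b)"
  shows "continuous_map (prod_topology W (cylinder \<delta> n)) Z (\<lambda>(w, b). cone_ext n \<kappa> z0 (\<beta> w) b)"
proof (cases "rim \<delta> n = {}")
  case True
  then have "cyl_norm n b = 0" if "b \<in> topspace (cylinder \<delta> n)" for b
    using normalise_in_rim[OF \<delta> that] by auto
  note norm0 = this
  show ?thesis
    by (rule continuous_map_eq[where f = "\<lambda>_. z0"]) (auto simp: cone_ext_def z0 norm0)
next
  case False
  let ?R = "subtopology (cylinder \<delta> n) (rim \<delta> n)"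
  let ?I = "top_of_set {0..1 :: real}"
  let ?pol = "\<lambda>(r, b). cyl_scale r b"
  have tR: "topspace ?R = rim \<delta> n" by (auto simp: rim_def)
  have cpol: "continuous_map (prod_topology ?I ?R) (cylinder \<delta> n) ?pol"
    unfolding prod_topology_subtopology(2)[of ?I "cylinder \<delta> n"]
    by (rule continuous_map_from_subtopology[OF continuous_scale])
  have "compact_space ?R" using compact_rim by (rule compact_space_subtopology)
  then have cI: "compact_space (prod_topology ?I ?R)"
    unfolding compact_space_prod_topology by (simp add: compact_space_subtopology)
  have ppol: "proper_map (prod_topology ?I ?R) (cylinder \<delta> n) ?pol"
    by (rule continuous_imp_proper_map[OF cI Hausdorff_imp_kc_space[OF Hausdorff_cylinder] cpol])
  have surj: "?pol ` topspace (prod_topology ?I ?R) = topspace (cylinder \<delta> n)"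
  proof
    show "?pol ` topspace (prod_topology ?I ?R) \<subseteq> topspace (cylinder \<delta> n)"
      using cpol by (rule continuous_map_image_subset_topspace)
    show "topspace (cylinder \<delta> n) \<subseteq> ?pol ` topspace (prod_topology ?I ?R)"
    proof
      fix b assume b: "b \<in> topspace (cylinder \<delta> n)"
      show "b \<in> ?pol ` topspace (prod_topology ?I ?R)"
      proof (cases "cyl_norm n b = 0")
        case True
        obtain c where c: "c \<in> rim \<delta> n" using False by auto
        have "b = cyl_scale 0 c" using cyl_norm_eq_0[OF b True] by (simp add: cyl_scale_def)
        then show ?thesis using c tR by (auto intro!: image_eqI[of _ _ "(0, c)"])
      next
        case F: False
        have "b = cyl_scale (cyl_norm n b) (cyl_scale (1 / cyl_norm n b) b)" using F by (simp add: cyl_scale_def)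
        then show ?thesis using normalise_in_rim[OF \<delta> b F] cyl_norm_le_1[OF \<delta> b] cyl_norm_nonneg[of n b] tR
          by (auto intro!: image_eqI[of _ _ "(cyl_norm n b, cyl_scale (1 / cyl_norm n b) b)"])
      qed
    qed
  qed
  let ?Q = "\<lambda>(w, p). (id w, ?pol p)"
  have "proper_map (prod_topology W (prod_topology ?I ?R)) (prod_topology W (cylinder \<delta> n)) ?Q"
    using ppol by (subst proper_map_prod) auto
  moreover have "continuous_map (prod_topology W (prod_topology ?I ?R)) (prod_topology W (cylinder \<delta> n)) ?Q"
    using cpol by (subst continuous_map_prod_top) auto
  moreover have "?Q ` topspace (prod_topology W (prod_topology ?I ?R)) = topspace (prod_topology W (cylinder \<delta> n))"
  proof -
    have "?Q ` (A \<times> B) = A \<times> (?pol ` B)" for A :: "'b set" and B by force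
    then show ?thesis using surj by simp
  qed
  ultimately have q: "quotient_map (prod_topology W (prod_topology ?I ?R)) (prod_topology W (cylinder \<delta> n)) ?Q"
    by (intro continuous_closed_imp_quotient_map proper_imp_closed_map)
  \<comment> \<open>At \<open>r = 0\<close> the contraction has reached \<open>z0\<close>, whatever the direction \<open>b\<close>.\<close>
  show ?thesis
  proof (rule continuous_compose_quotient_map[OF q])
    let ?P = "prod_topology W (prod_topology ?I ?R)"
    have f2: "continuous_map ?P ?I (\<lambda>p. fst (snd p))"
      by (rule continuous_map_compose[OF continuous_map_snd continuous_map_fst, unfolded comp_def])
    have s2: "continuous_map ?P ?R (\<lambda>p. snd (snd p))"
      by (rule continuous_map_compose[OF continuous_map_snd continuous_map_snd, unfolded comp_def])
    have "continuous_map ?P ?I (\<lambda>p. 1 - fst (snd p))"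
      using f2 unfolding continuous_map_in_subtopology by (auto intro!: continuous_map_diff)
    moreover have "continuous_map ?P Z (\<lambda>p. \<beta> (fst p) (snd (snd p)))"
      by (rule continuous_map_binop[OF \<beta> continuous_map_fst s2])
    ultimately have "continuous_map ?P Z (\<lambda>p. \<kappa> (1 - fst (snd p), \<beta> (fst p) (snd (snd p))))"
      by (intro continuous_map_binop[where h = "\<lambda>x y. \<kappa> (x, y)" and A = ?I and B = Z]) (use \<kappa> in simp_all)
    moreover have "\<kappa> (1 - fst (snd p), \<beta> (fst p) (snd (snd p)))
       = ((\<lambda>(w, b). cone_ext n \<kappa> z0 (\<beta> w) b) \<circ> ?Q) p" if p: "p \<in> topspace ?P" for p
    proof -
      obtain w r b where [simp]: "p = (w, r, b)" by (cases p) auto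
      have w: "w \<in> topspace W" and r: "0 \<le> r" "r \<le> 1" and b: "b \<in> rim \<delta> n" using p tR by auto
      have g: "cyl_norm n (cyl_scale r b) = r" using b r by (simp add: cyl_norm_scale rim_def)
      have "\<beta> w b \<in> topspace Z" by (rule continuous_map_prod_closed[OF \<beta> w]) (use b tR in simp)
      moreover have "cyl_scale (1 / r) (cyl_scale r b) = b" if "r \<noteq> 0" using that by (simp add: cyl_scale_def)
      ultimately show ?thesis using z0 by (simp add: cone_ext_def g)
    qed
    ultimately show "continuous_map ?P Z ((\<lambda>(w, b). cone_ext n \<kappa> z0 (\<beta> w) b) \<circ> ?Q)"
      by (rule continuous_map_eq) 
  qed
qed

lemma cone_ext_rim:
  assumes "cyl_norm n b = 1" "\<kappa> (0, \<beta> b) = \<beta> b"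
  shows "cone_ext n \<kappa> z0 \<beta> b = \<beta> b"
  using assms by (simp add: cone_ext_def cyl_scale_def)

section \<open>Compact subsets and continuity in \<open>G\<close>-CW complexes\<close>

text \<open>Fixes a cell structure, which \<open>G_CW_complex\<close> only asserts to exist.  The assumptions are kept in the
form of its conjuncts, so that an instance is obtained by mere assumption.\<close>

locale G_CW = group G
  for G :: "('g, 'b) monoid_scheme" (structure) +
  fixes Y :: "'y topology" and \<theta> :: "'g \<Rightarrow> 'y \<Rightarrow> 'y"
    and Sk :: "nat \<Rightarrow> 'y set" and I :: "nat \<Rightarrow> 'y set" and K :: "nat \<Rightarrow> 'y \<Rightarrow> 'g set"
    and q :: "nat \<Rightarrow> 'y \<Rightarrow> 'g set \<times> (nat \<Rightarrow> real) \<Rightarrow> 'y"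
  assumes G_space: "G_space G Y \<theta>"
    and Hausdorff: "Hausdorff_space Y"
    and Sk_0: "Sk 0 = {}"
    and Sk_Suc_all: "\<forall>n. Sk n \<subseteq> Sk (Suc n)"
    and Sk_UN: "(\<Union>n. Sk n) = topspace Y"
    and open_iff_all: "\<forall>U\<subseteq>topspace Y. openin Y U \<longleftrightarrow> (\<forall>n. openin (subtopology Y (Sk n)) (U \<inter> Sk n))"
    and K_subgroup_all: "\<forall>n. \<forall>a\<in>I n. subgroup (K n a) G"
    and q_equivariant_all: "\<forall>n. \<forall>a\<in>I n. \<forall>g\<in>carrier G. \<forall>c\<in>left_cosets G (K n a). \<forall>x\<in>topspace (disk n).
      q n a (g <#\<^bsub>G\<^esub> c, x) = \<theta> g (q n a (c, x))"
    and q_boundary_all: "\<forall>n. \<forall>a\<in>I n. \<forall>c\<in>left_cosets G (K n a). \<forall>x\<in>topspace (disk n).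
      (\<Sum>i<n. (x i)\<^sup>2) = 1 \<longrightarrow> q n a (c, x) \<in> Sk n"
    and q_bij_all: "\<forall>n. bij_betw (\<lambda>(a, p). q n a p)
      (SIGMA a:I n. left_cosets G (K n a) \<times> {x \<in> topspace (disk n). (\<Sum>i<n. (x i)\<^sup>2) < 1})
      (Sk (Suc n) - Sk n)"
    and Suc_open_iff_all: "\<forall>n. \<forall>U\<subseteq>Sk (Suc n).
      openin (subtopology Y (Sk (Suc n))) U \<longleftrightarrow>
      openin (subtopology Y (Sk n)) (U \<inter> Sk n) \<and>
      (\<forall>a\<in>I n. openin (prod_topology (discrete_topology (left_cosets G (K n a))) (disk n))
        {p \<in> left_cosets G (K n a) \<times> topspace (disk n). q n a p \<in> U})"

lemma G_CW_complex_imp_G_CW: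
  assumes "group G" "G_CW_complex G Y \<theta>"
  obtains Sk I K q where "G_CW G Y \<theta> Sk I K q"
proof -
  have "\<exists>Sk I K q. G_CW G Y \<theta> Sk I K q"
    using assms unfolding G_CW_complex_def
    by (elim conjE ex_forward) (intro G_CW.intro G_CW_axioms.intro; assumption)
  then show thesis using that by blast
qed

context G_CW
begin

lemma Sk_Suc: "Sk n \<subseteq> Sk (Suc n)"
  by (rule Sk_Suc_all[rule_format])

lemma open_iff: "U \<subseteq> topspace Y \<Longrightarrow> openin Y U \<longleftrightarrow> (\<forall>n. openin (subtopology Y (Sk n)) (U \<inter> Sk n))"
  by (rule open_iff_all[THEN spec, THEN mp])

lemma K_subgroup: "a \<in> I n \<Longrightarrow> subgroup (K n a) G"
  by (rule K_subgroup_all[rule_format])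

lemma q_equivariant:
  "\<lbrakk>a \<in> I n; g \<in> carrier G; c \<in> left_cosets G (K n a); x \<in> topspace (disk n)\<rbrakk> \<Longrightarrow>
   q n a (g <#\<^bsub>G\<^esub> c, x) = \<theta> g (q n a (c, x))"
  by (rule q_equivariant_all[rule_format])

lemma q_boundary:
  "\<lbrakk>a \<in> I n; c \<in> left_cosets G (K n a); x \<in> topspace (disk n); (\<Sum>i<n. (x i)\<^sup>2) = 1\<rbrakk> \<Longrightarrow>
   q n a (c, x) \<in> Sk n"
  by (rule q_boundary_all[rule_format])

lemmas q_bij = q_bij_all[THEN spec]

lemma Suc_open_iff:
  "U \<subseteq> Sk (Suc n) \<Longrightarrow> openin (subtopology Y (Sk (Suc n))) U \<longleftrightarrow>
     openin (subtopology Y (Sk n)) (U \<inter> Sk n) \<and>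
     (\<forall>a\<in>I n. openin (prod_topology (discrete_topology (left_cosets G (K n a))) (disk n))
       {p \<in> left_cosets G (K n a) \<times> topspace (disk n). q n a p \<in> U})"
  by (rule Suc_open_iff_all[THEN spec, THEN spec, THEN mp])

abbreviation C where "C n a \<equiv> left_cosets G (K n a)"

definition open_disk :: "nat \<Rightarrow> (nat \<Rightarrow> real) set" where
  "open_disk n = {x \<in> topspace (disk n). (\<Sum>i<n. (x i)\<^sup>2) < 1}"

lemma q_interior:
  assumes "a \<in> I n" "c \<in> C n a" "x \<in> open_disk n"
  shows "q n a (c, x) \<in> Sk (Suc n) - Sk n"
  using bij_betwE[OF q_bij[of n]] assms by (force simp: open_disk_def)

lemma q_interior_inj:
  assumes "a \<in> I n" "c \<in> C n a" "x \<in> open_disk n" "a' \<in> I n" "c' \<in> C n a'" "x' \<in> open_disk n"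
    and "q n a (c, x) = q n a' (c', x')"
  shows "a = a'" "c = c'" "x = x'"
proof -
  have "(a, (c, x)) = (a', (c', x'))"
    using assms by (intro inj_onD[OF bij_betw_imp_inj_on[OF q_bij[of n]]]) (auto simp: open_disk_def)
  then show "a = a'" "c = c'" "x = x'" by auto
qed

lemma q_interior_surj:
  assumes "y \<in> Sk (Suc n)" "y \<notin> Sk n"
  obtains a c x where "a \<in> I n" "c \<in> C n a" "x \<in> open_disk n" "y = q n a (c, x)"
proof -
  have "y \<in> (\<lambda>(a, p). q n a p) `
      (SIGMA a:I n. C n a \<times> {x \<in> topspace (disk n). (\<Sum>i<n. (x i)\<^sup>2) < 1})"
    using assms bij_betw_imp_surj_on[OF q_bij[of n]] by auto
  then show thesis using that unfolding open_disk_def by auto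
qed

lemma disk_cases:
  assumes "x \<in> topspace (disk n)"
  shows "x \<in> open_disk n \<or> (\<Sum>i<n. (x i)\<^sup>2) = 1"
  using assms by (auto simp: open_disk_def topspace_disk)

lemma q_in_Sk:
  assumes "a \<in> I n" "c \<in> C n a" "x \<in> topspace (disk n)"
  shows "q n a (c, x) \<in> Sk (Suc n)"
  using disk_cases[OF assms(3)] q_interior[OF assms(1,2)] q_boundary[OF assms] Sk_Suc by auto

lemma q_in_Sk_iff:
  assumes "a \<in> I n" "c \<in> C n a" "x \<in> topspace (disk n)"
  shows "q n a (c, x) \<in> Sk n \<longleftrightarrow> (\<Sum>i<n. (x i)\<^sup>2) = 1"
  using disk_cases[OF assms(3)] q_interior[OF assms(1,2)] q_boundary[OF assms] by auto

lemma Sk_mono: "m \<le> n \<Longrightarrow> Sk m \<subseteq> Sk n"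
  by (rule lift_Suc_mono_le[of Sk]) (rule Sk_Suc)

lemma Sk_subset: "Sk n \<subseteq> topspace Y"
  using Sk_UN by auto

lemma topspace_Sk [simp]: "topspace (subtopology Y (Sk n)) = Sk n"
  using Sk_subset by auto

lemma q_continuous:
  assumes "a \<in> I n" "c \<in> C n a"
  shows "continuous_map (disk n) (subtopology Y (Sk (Suc n))) (\<lambda>x. q n a (c, x))"
  unfolding continuous_map_def
proof (intro conjI allI impI)
  show "(\<lambda>x. q n a (c, x)) \<in> topspace (disk n) \<rightarrow> topspace (subtopology Y (Sk (Suc n)))"
    unfolding topspace_Sk using q_in_Sk[OF assms] by auto
  fix U assume U: "openin (subtopology Y (Sk (Suc n))) U"
  let ?P = "prod_topology (discrete_topology (C n a)) (disk n)"
  have "U \<subseteq> Sk (Suc n)" using openin_subset[OF U] by simp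
  then have "openin ?P {p \<in> C n a \<times> topspace (disk n). q n a p \<in> U}"
    using U Suc_open_iff assms(1) by blast
  moreover have "continuous_map (disk n) ?P (\<lambda>x. (c, x))"
    using assms(2) by (intro continuous_map_pairedI) auto
  ultimately have "openin (disk n)
     {x \<in> topspace (disk n). (c, x) \<in> {p \<in> C n a \<times> topspace (disk n). q n a p \<in> U}}"
    by (rule openin_continuous_map_preimage[rotated])
  moreover have "{x \<in> topspace (disk n). (c, x) \<in> {p \<in> C n a \<times> topspace (disk n). q n a p \<in> U}}
     = {x \<in> topspace (disk n). q n a (c, x) \<in> U}"
    using assms(2) by auto
  ultimately show "openin (disk n) {x \<in> topspace (disk n). q n a (c, x) \<in> U}" by simp
qed

lemma q_continuous_Y:
  assumes "a \<in> I n" "c \<in> C n a"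
  shows "continuous_map (disk n) Y (\<lambda>x. q n a (c, x))"
  using q_continuous[OF assms] by (rule continuous_map_into_fulltopology)

lemma openin_Sk_SucI:
  assumes "U \<subseteq> Sk (Suc n)" "openin (subtopology Y (Sk n)) (U \<inter> Sk n)"
    and "\<And>a c. \<lbrakk>a \<in> I n; c \<in> C n a\<rbrakk> \<Longrightarrow> openin (disk n) {x \<in> topspace (disk n). q n a (c, x) \<in> U}"
  shows "openin (subtopology Y (Sk (Suc n))) U"
proof -
  have "openin (prod_topology (discrete_topology (C n a)) (disk n)) {p \<in> C n a \<times> topspace (disk n). q n a p \<in> U}"
    if a: "a \<in> I n" for a
  proof -
    have eq: "{p \<in> C n a \<times> topspace (disk n). q n a p \<in> U} =
        (\<Union>c\<in>C n a. {c} \<times> {x \<in> topspace (disk n). q n a (c, x) \<in> U})"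
      by auto
    show ?thesis unfolding eq
    proof (rule openin_Union, clarify)
      fix c assume "c \<in> C n a"
      then show "openin (prod_topology (discrete_topology (C n a)) (disk n))
         ({c} \<times> {x \<in> topspace (disk n). q n a (c, x) \<in> U})"
        using assms(3)[OF a] by (simp add: openin_prod_Times_iff)
    qed
  qed
  then show ?thesis using Suc_open_iff[OF assms(1)] assms(2) by blast
qed

text \<open>The pushout topology, expressed by closed sets and one nonequivariant cell at a time.\<close>

lemma closedin_Sk_SucI:
  assumes "Z \<subseteq> Sk (Suc n)" "closedin (subtopology Y (Sk n)) (Z \<inter> Sk n)"
    and "\<And>a c. \<lbrakk>a \<in> I n; c \<in> C n a\<rbrakk> \<Longrightarrow> closedin (disk n) {x \<in> topspace (disk n). q n a (c, x) \<in> Z}"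
  shows "closedin (subtopology Y (Sk (Suc n))) Z"
proof -
  have "openin (subtopology Y (Sk (Suc n))) (Sk (Suc n) - Z)"
  proof (rule openin_Sk_SucI)
    have "openin (subtopology Y (Sk n)) (Sk n - Z \<inter> Sk n)"
      using assms(2) unfolding closedin_def topspace_Sk by blast
    moreover have "(Sk (Suc n) - Z) \<inter> Sk n = Sk n - Z \<inter> Sk n" using Sk_Suc by auto
    ultimately show "openin (subtopology Y (Sk n)) ((Sk (Suc n) - Z) \<inter> Sk n)" by simp
  next
    fix a c assume ac: "a \<in> I n" "c \<in> C n a"
    have "{x \<in> topspace (disk n). q n a (c, x) \<in> Sk (Suc n) - Z}
       = topspace (disk n) - {x \<in> topspace (disk n). q n a (c, x) \<in> Z}"
      using q_in_Sk[OF ac] by auto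
    then show "openin (disk n) {x \<in> topspace (disk n). q n a (c, x) \<in> Sk (Suc n) - Z}"
      using assms(3)[OF ac] by (simp add: openin_diff)
  qed auto
  then show ?thesis using assms(1) unfolding closedin_def topspace_Sk by blast
qed

lemma Sk_closedin_Suc: "closedin (subtopology Y (Sk (Suc n))) (Sk n)"
proof (rule closedin_Sk_SucI)
  show "closedin (subtopology Y (Sk n)) (Sk n \<inter> Sk n)"
    by (metis closedin_topspace inf_idem topspace_Sk)
  fix a c assume ac: "a \<in> I n" "c \<in> C n a"
  have "{x \<in> topspace (disk n). q n a (c, x) \<in> Sk n} = {x \<in> topspace (disk n). (\<Sum>i<n. (x i)\<^sup>2) = 1}"
    using q_in_Sk_iff[OF ac] by auto
  then show "closedin (disk n) {x \<in> topspace (disk n). q n a (c, x) \<in> Sk n}"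
    using closedin_sphere by simp
qed (rule Sk_Suc)

text \<open>Induction over the skeleta: the preimage in an \<open>n\<close>-cell consists of the preimage of a closed subset of
the lower skeleton and finitely many points in the interior.\<close>

lemma closedin_if_finite_in_cells:
  assumes A: "A \<subseteq> topspace Y"
    and fin: "\<And>n a c. \<lbrakk>a \<in> I n; c \<in> C n a\<rbrakk> \<Longrightarrow> finite {x \<in> open_disk n. q n a (c, x) \<in> A}"
  shows "closedin Y A"
proof -
  have *: "closedin (subtopology Y (Sk n)) (A \<inter> Sk n)" for n
  proof (induction n)
    case 0
    then show ?case by (simp add: Sk_0)
  next
    case (Suc n)
    show ?case
    proof (rule closedin_Sk_SucI)
      have "(A \<inter> Sk (Suc n)) \<inter> Sk n = A \<inter> Sk n" using Sk_Suc by auto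
      then show "closedin (subtopology Y (Sk n)) ((A \<inter> Sk (Suc n)) \<inter> Sk n)" using Suc by simp
    next
      fix a c assume ac: "a \<in> I n" "c \<in> C n a"
      have "closedin (subtopology (subtopology Y (Sk (Suc n))) (Sk n)) (A \<inter> Sk n)"
        using Suc Sk_Suc by (simp add: subtopology_subtopology inf_absorb2)
      then have "closedin (subtopology Y (Sk (Suc n))) (A \<inter> Sk n)"
        using Sk_closedin_Suc by (rule closedin_trans_full)
      then have "closedin (disk n) {x \<in> topspace (disk n). q n a (c, x) \<in> A \<inter> Sk n}"
        by (rule closedin_continuous_map_preimage[OF q_continuous[OF ac]])
      moreover have "closedin (disk n) {x \<in> open_disk n. q n a (c, x) \<in> A}"
        using fin[OF ac] by (intro closedin_Hausdorff_finite[OF Hausdorff_disk]) (auto simp: open_disk_def)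
      moreover have "{x \<in> topspace (disk n). q n a (c, x) \<in> A \<inter> Sk (Suc n)}
         = {x \<in> topspace (disk n). q n a (c, x) \<in> A \<inter> Sk n} \<union> {x \<in> open_disk n. q n a (c, x) \<in> A}"
        using q_in_Sk[OF ac] q_interior[OF ac] q_boundary[OF ac] disk_cases[of _ n] Sk_Suc
        by (auto simp: open_disk_def)
      ultimately show "closedin (disk n) {x \<in> topspace (disk n). q n a (c, x) \<in> A \<inter> Sk (Suc n)}"
        by (simp only: closedin_Un)
    qed simp
  qed
  have "openin (subtopology Y (Sk n)) ((topspace Y - A) \<inter> Sk n)" for n
  proof -
    have "(topspace Y - A) \<inter> Sk n = Sk n - A \<inter> Sk n" using Sk_subset by auto
    then show ?thesis using *[of n] unfolding closedin_def topspace_Sk by simp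
  qed
  then have "openin Y (topspace Y - A)" by (subst open_iff) auto
  then show ?thesis using A unfolding closedin_def by simp
qed

lemma in_open_cell:
  assumes "y \<in> Sk N"
  obtains n a c x where "n < N" "a \<in> I n" "c \<in> C n a" "x \<in> open_disk n" "y = q n a (c, x)"
proof -
  define n where "n = (LEAST n. y \<in> Sk n)"
  have n: "y \<in> Sk n" "n \<le> N" unfolding n_def using assms by (auto intro: LeastI Least_le)
  obtain m where m: "n = Suc m" using n(1) Sk_0 by (cases n) auto
  have "y \<notin> Sk m" using m not_less_Least[of m "\<lambda>n. y \<in> Sk n"] unfolding n_def by auto
  with n m show thesis using q_interior_surj[of y m] that[of m] by (metis Suc_le_lessD)
qed

lemma open_cells_disjoint:
  assumes "a \<in> I n" "c \<in> C n a" "x \<in> open_disk n" "a' \<in> I n'" "c' \<in> C n' a'" "x' \<in> open_disk n'"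
    and eq: "q n a (c, x) = q n' a' (c', x')"
  shows "n = n' \<and> a = a' \<and> c = c' \<and> x = x'"
proof -
  have "\<not> n < n'" 
    using q_interior[OF assms(1-3)] q_interior[OF assms(4-6)] eq Sk_mono[of "Suc n" n'] by auto
  moreover have "\<not> n' < n"
    using q_interior[OF assms(1-3)] q_interior[OF assms(4-6)] eq Sk_mono[of "Suc n'" n] by auto
  ultimately have "n = n'" by simp
  with q_interior_inj assms show ?thesis by metis
qed

text \<open>Choose a point of \<open>D\<close> in each open cell that meets \<open>D\<close>.  By \<open>closedin_if_finite_in_cells\<close> every set of
such points is closed, so the set of all of them has no accumulation point.  An infinite subset of the
compact set \<open>D\<close> would have one.\<close>

lemma compact_in_finitely_many_cells:
  assumes D: "compactin Y D"
  obtains S where "finite S"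
    "S \<subseteq> {(n, a, c). a \<in> I n \<and> c \<in> C n a \<and> (\<exists>x\<in>open_disk n. q n a (c, x) \<in> D)}"
    "D \<subseteq> (\<Union>(n, a, c)\<in>S. (\<lambda>x. q n a (c, x)) ` topspace (disk n))"
proof -
  define S where "S = {(n, a, c). a \<in> I n \<and> c \<in> C n a \<and> (\<exists>x\<in>open_disk n. q n a (c, x) \<in> D)}"
  define s where "s = (\<lambda>(n, a, c). q n a (c, SOME x. x \<in> open_disk n \<and> q n a (c, x) \<in> D))"
  have s: "\<exists>x. x \<in> open_disk n \<and> s (n, a, c) = q n a (c, x) \<and> s (n, a, c) \<in> D" if "(n, a, c) \<in> S" for n a c
  proof -
    have "\<exists>x. x \<in> open_disk n \<and> q n a (c, x) \<in> D" using that by (auto simp: S_def)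
    from someI_ex[OF this] show ?thesis by (auto simp: s_def)
  qed
  have inj: "inj_on s S"
  proof (rule inj_onI)
    fix \<alpha> \<alpha>' assume \<alpha>: "\<alpha> \<in> S" "\<alpha>' \<in> S" "s \<alpha> = s \<alpha>'"
    obtain n a c n' a' c' where [simp]: "\<alpha> = (n, a, c)" "\<alpha>' = (n', a', c')"
      by (cases \<alpha>, cases \<alpha>') auto
    from \<alpha> have 1: "(n, a, c) \<in> S" and 2: "(n', a', c') \<in> S" and eq: "s (n, a, c) = s (n', a', c')"
      by auto
    from 1 2 have "a \<in> I n" "c \<in> C n a" "a' \<in> I n'" "c' \<in> C n' a'" by (auto simp: S_def)
    moreover obtain x x' where "x \<in> open_disk n" "x' \<in> open_disk n'" "q n a (c, x) = q n' a' (c', x')"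
      using s[OF 1] s[OF 2] eq by auto
    ultimately have "n = n' \<and> a = a' \<and> c = c'" using open_cells_disjoint by blast
    then show "\<alpha> = \<alpha>'" by simp
  qed
  have sD: "s ` S \<subseteq> D" using s by force
  have closed: "closedin Y A" if A: "A \<subseteq> s ` S" for A
  proof (rule closedin_if_finite_in_cells)
    show "A \<subseteq> topspace Y" using A sD compactin_subset_topspace[OF D] by blast
    fix n a c assume ac: "a \<in> I n" "c \<in> C n a"
    have uniq: "x = x'" if x: "x \<in> open_disk n" "q n a (c, x) \<in> A" and x': "x' \<in> open_disk n" "q n a (c, x') \<in> A" for x x'
    proof -
      have st: "q n a (c, y) = s (n, a, c)" if y: "y \<in> open_disk n" "q n a (c, y) \<in> A" for y
      proof -
        obtain n' a' c' where S': "(n', a', c') \<in> S" "q n a (c, y) = s (n', a', c')" using y(2) A by auto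
        obtain z where z: "z \<in> open_disk n'" "s (n', a', c') = q n' a' (c', z)" using s[OF S'(1)] by auto
        have "a' \<in> I n'" "c' \<in> C n' a'" using S'(1) by (auto simp: S_def)
        then have "n = n' \<and> a = a' \<and> c = c'" using open_cells_disjoint[OF ac y(1)] z S' by metis
        with S'(2) show ?thesis by simp
      qed
      have "q n a (c, x) = q n a (c, x')" using st[OF x] st[OF x'] by simp
      then show ?thesis using q_interior_inj(3)[OF ac x(1) ac x'(1)] by simp
    qed
    show "finite {x \<in> open_disk n. q n a (c, x) \<in> A}"
    proof (cases "{x \<in> open_disk n. q n a (c, x) \<in> A} = {}")
      case False
      then obtain x0 where "x0 \<in> open_disk n" "q n a (c, x0) \<in> A" by blast
      then have "{x \<in> open_disk n. q n a (c, x) \<in> A} \<subseteq> {x0}" using uniq by blast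
      then show ?thesis by (rule finite_subset) simp
    next
      case True
      then show ?thesis by (simp only: finite.emptyI)
    qed
  qed
  have "finite (s ` S)"
  proof (rule ccontr)
    assume "infinite (s ` S)"
    then obtain y where y: "y \<in> Y derived_set_of (s ` S)"
      using compactin_imp_Bolzano_Weierstrass[OF D] sD by blast
    have "openin Y (topspace Y - (s ` S - {y}))"
      using closed[of "s ` S - {y}"] by blast
    moreover have "y \<in> topspace Y - (s ` S - {y})" using y by (simp add: in_derived_set_of)
    ultimately have "\<exists>z. z \<noteq> y \<and> z \<in> s ` S \<and> z \<in> topspace Y - (s ` S - {y})"
      by (intro y[unfolded in_derived_set_of, THEN conjunct2, rule_format] conjI)
    then show False by blast
  qed
  then have "finite S" using inj by (simp add: finite_image_iff)
  moreover have "S \<subseteq> {(n, a, c). a \<in> I n \<and> c \<in> C n a \<and> (\<exists>x\<in>open_disk n. q n a (c, x) \<in> D)}"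
    by (auto simp: S_def)
  moreover have "D \<subseteq> (\<Union>(n, a, c)\<in>S. (\<lambda>x. q n a (c, x)) ` topspace (disk n))"
  proof
    fix y assume y: "y \<in> D"
    then obtain N where "y \<in> Sk N" using compactin_subset_topspace[OF D] Sk_UN by blast
    then obtain n a c x where h: "a \<in> I n" "c \<in> C n a" "x \<in> open_disk n" "y = q n a (c, x)"
      using in_open_cell by metis
    then have "(n, a, c) \<in> S" using y by (auto simp: S_def)
    moreover have "x \<in> topspace (disk n)" using h(3) by (simp add: open_disk_def)
    ultimately show "y \<in> (\<Union>(n, a, c)\<in>S. (\<lambda>x. q n a (c, x)) ` topspace (disk n))"
      using h(4) by force
  qed
  ultimately show thesis by (rule that)
qed

text \<open>On a compact set only finitely many cells matter, and these are attached by proper maps; a finite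
union of images of closed sets under proper maps is closed.  The product \<open>W \<times> Y\<close> itself need not have
the quotient topology from \<open>W \<times>\<close> cells, which is why the statement is restricted to compact subsets.\<close>

lemma cellwise_continuous_on_compact:
  assumes D: "compactin Y D"
    and F: "\<And>n a c x. \<lbrakk>a \<in> I n; c \<in> C n a; x \<in> open_disk n; q n a (c, x) \<in> D\<rbrakk> \<Longrightarrow>
      continuous_map (prod_topology W (disk n)) X (\<lambda>(w, x). F w (q n a (c, x)))"
  shows "continuous_map (prod_topology W (subtopology Y D)) X (\<lambda>(w, y). F w y)"
proof -
  obtain S where S1: "finite S" and S2: "S \<subseteq> {(n, a, c). a \<in> I n \<and> c \<in> C n a \<and> (\<exists>x\<in>open_disk n. q n a (c, x) \<in> D)}"
    and S3: "D \<subseteq> (\<Union>(n, a, c)\<in>S. (\<lambda>x. q n a (c, x)) ` topspace (disk n))"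
    by (rule compact_in_finitely_many_cells[OF D])
  have ac: "a \<in> I n" "c \<in> C n a" if "(n, a, c) \<in> S" for n a c
    using S2 that by auto
  have F: "continuous_map (prod_topology W (disk n)) X (\<lambda>(w, x). F w (q n a (c, x)))"
    if in_S: "(n, a, c) \<in> S" for n a c
  proof -
    obtain x where "a \<in> I n" "c \<in> C n a" "x \<in> open_disk n" "q n a (c, x) \<in> D"
      using S2 in_S by auto
    then show ?thesis by (rule F)
  qed
  have tD: "topspace (subtopology Y D) = D" using compactin_subset_topspace[OF D] by auto
  have cl: "closed_map (prod_topology W (disk n)) (prod_topology W Y) (\<lambda>(w, x). (id w, q n a (c, x)))"
    if "(n, a, c) \<in> S" for n a c
  proof (rule proper_imp_closed_map)
    have "proper_map (disk n) Y (\<lambda>x. q n a (c, x))"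
      using ac[OF that] q_continuous_Y Hausdorff compact_disk
      by (intro continuous_imp_proper_map Hausdorff_imp_kc_space) auto
    then show "proper_map (prod_topology W (disk n)) (prod_topology W Y) (\<lambda>(w, x). (id w, q n a (c, x)))"
      by (subst proper_map_prod) auto
  qed
  show ?thesis
    unfolding continuous_map_closedin
  proof (intro conjI allI impI)
    show "(\<lambda>(w, y). F w y) \<in> topspace (prod_topology W (subtopology Y D)) \<rightarrow> topspace X"
    proof (intro Pi_I)
      fix p assume "p \<in> topspace (prod_topology W (subtopology Y D))"
      then obtain w y where p: "p = (w, y)" and w: "w \<in> topspace W" and y: "y \<in> D"
        by (cases p) auto
      obtain n a c x where "(n, a, c) \<in> S" "x \<in> topspace (disk n)" "y = q n a (c, x)"
        using S3 y by auto
      then show "(case p of (w, y) \<Rightarrow> F w y) \<in> topspace X"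
        using continuous_map_prod_closed[OF F w, of n a c x] p by auto
    qed
  next
    fix Z assume Z: "closedin X Z"
    let ?A = "\<lambda>(n, a, c). {p \<in> topspace (prod_topology W (disk n)). (case p of (w, x) \<Rightarrow> F w (q n a (c, x))) \<in> Z}"
    let ?B = "\<lambda>(n, a, c). (\<lambda>(w, x). (id w, q n a (c, x))) ` ?A (n, a, c)"
    have "closedin (prod_topology W Y) (?B \<alpha>)" if \<alpha>: "\<alpha> \<in> S" for \<alpha>
    proof -
      obtain n a c where [simp]: "\<alpha> = (n, a, c)" by (cases \<alpha>) auto
      have "closedin (prod_topology W (disk n)) (?A \<alpha>)"
        using closedin_continuous_map_preimage[OF F Z] \<alpha> by simp
      then show ?thesis using cl \<alpha> by (simp add: closed_map_def)
    qed
    then have "closedin (prod_topology W Y) (\<Union>\<alpha>\<in>S. ?B \<alpha>)"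
      using S1 by (intro closedin_Union) auto
    moreover have "{p \<in> topspace (prod_topology W (subtopology Y D)). (case p of (w, y) \<Rightarrow> F w y) \<in> Z}
       = (topspace W \<times> D) \<inter> (\<Union>\<alpha>\<in>S. ?B \<alpha>)"
    proof (rule Set.set_eqI)
      fix p
      show "p \<in> {p \<in> topspace (prod_topology W (subtopology Y D)). (case p of (w, y) \<Rightarrow> F w y) \<in> Z}
        \<longleftrightarrow> p \<in> (topspace W \<times> D) \<inter> (\<Union>\<alpha>\<in>S. ?B \<alpha>)" (is "?l \<longleftrightarrow> ?r")
      proof (cases p)
        case p: (Pair w y)
        show ?thesis
        proof
        assume ?l
        then have w: "w \<in> topspace W" and y: "y \<in> D" and Z: "F w y \<in> Z" using p by auto
        then obtain n a c x where S': "(n, a, c) \<in> S" "x \<in> topspace (disk n)" "y = q n a (c, x)"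
          using S3 by auto
        have "(w, x) \<in> ?A (n, a, c)" using w Z S' by auto
        then have "(w, y) \<in> ?B (n, a, c)" using S'(3) by force
        then show ?r using S'(1) w y p by blast
      next
        assume ?r then show ?l using tD p by auto
      qed
      qed
    qed
    moreover have "prod_topology W (subtopology Y D) = subtopology (prod_topology W Y) (topspace W \<times> D)"
      by (rule prod_topology_subtopology)
    ultimately show "closedin (prod_topology W (subtopology Y D))
        {p \<in> topspace (prod_topology W (subtopology Y D)). (case p of (w, y) \<Rightarrow> F w y) \<in> Z}"
      by (simp only: closedin_subtopology_Int_closed)
  qed
qed

lemma cellwise_continuous_imp_continuous:
  assumes F: "\<And>n a c. \<lbrakk>a \<in> I n; c \<in> C n a\<rbrakk> \<Longrightarrow> continuous_map (disk n) X (\<lambda>x. F (q n a (c, x)))"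
  shows "continuous_map Y X F"
  unfolding continuous_map_def
proof (intro conjI allI impI)
  show "F \<in> topspace Y \<rightarrow> topspace X"
  proof
    fix y assume "y \<in> topspace Y"
    then obtain N where "y \<in> Sk N" using Sk_UN by auto
    then obtain n a c x where "a \<in> I n" "c \<in> C n a" "x \<in> open_disk n" "y = q n a (c, x)"
      using in_open_cell by metis
    then show "F y \<in> topspace X"
      using continuous_map_image_subset_topspace[OF F] by (force simp: open_disk_def)
  qed
  fix U assume U: "openin X U"
  have "openin (subtopology Y (Sk n)) ({y \<in> topspace Y. F y \<in> U} \<inter> Sk n)" for n
  proof (induction n)
    case 0
    then show ?case by (simp add: Sk_0)
  next
    case (Suc n)
    show ?case
    proof (rule openin_Sk_SucI)
      have "({y \<in> topspace Y. F y \<in> U} \<inter> Sk (Suc n)) \<inter> Sk n = {y \<in> topspace Y. F y \<in> U} \<inter> Sk n"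
        using Sk_Suc by auto
      then show "openin (subtopology Y (Sk n)) (({y \<in> topspace Y. F y \<in> U} \<inter> Sk (Suc n)) \<inter> Sk n)"
        using Suc by simp
    next
      fix a c assume ac: "a \<in> I n" "c \<in> C n a"
      have "{x \<in> topspace (disk n). q n a (c, x) \<in> {y \<in> topspace Y. F y \<in> U} \<inter> Sk (Suc n)}
        = {x \<in> topspace (disk n). F (q n a (c, x)) \<in> U}"
        using q_in_Sk[OF ac] Sk_subset by blast
      then show "openin (disk n) {x \<in> topspace (disk n). q n a (c, x) \<in> {y \<in> topspace Y. F y \<in> U} \<inter> Sk (Suc n)}"
        using openin_continuous_map_preimage[OF F[OF ac] U] by simp
    qed simp
  qed
  then show "openin Y {y \<in> topspace Y. F y \<in> U}" by (subst open_iff) auto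
qed

end

section \<open>Equivariant extension over the skeleta\<close>

definition contraction :: "'z topology \<Rightarrow> (real \<times> 'z \<Rightarrow> 'z) \<Rightarrow> 'z \<Rightarrow> bool" where
  "contraction Z \<kappa> z0 \<longleftrightarrow>
     continuous_map (prod_topology (top_of_set {0..1}) Z) Z \<kappa> \<and> z0 \<in> topspace Z \<and>
     (\<forall>z\<in>topspace Z. \<kappa> (0, z) = z \<and> \<kappa> (1, z) = z0)"

lemma contraction_exists:
  assumes "contractible_space Z" "topspace Z \<noteq> {}"
  obtains \<kappa> z0 where "contraction Z \<kappa> z0"
proof -
  obtain z0 where "homotopic_with (\<lambda>x. True) Z Z id (\<lambda>x. z0)"
    using assms(1) unfolding contractible_space_def by auto
  then obtain \<kappa> where \<kappa>: "continuous_map (prod_topology (top_of_set {0..1 :: real}) Z) Z \<kappa>"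
    "\<forall>z. \<kappa> (0, z) = id z" "\<forall>z. \<kappa> (1, z) = z0"
    unfolding homotopic_with_def by blast
  obtain z where "z \<in> topspace Z" using assms(2) by blast
  then have "\<kappa> (1, z) \<in> topspace Z"
    using continuous_map_image_subset_topspace[OF \<kappa>(1)] by (auto simp: image_subset_iff)
  then show thesis using that[of \<kappa> z0] \<kappa> by (simp add: contraction_def)
qed

text \<open>A group \<open>A\<close> acts on the \<open>G\<close>-CW complex \<open>Y\<close> through \<open>\<pi> : A \<rightarrow> G\<close> and on a space \<open>X\<close> whose fixed spaces are
contractible for all subgroups that fix a point of \<open>Y\<close>.  A family of \<open>A\<close>-maps \<open>Y \<rightarrow> X\<close>, parametrised by
\<open>W\<close> and by the \<open>t\<close> with \<open>|t| = 1\<close> in \<open>J = [-\<delta>, \<delta>]\<close>, is to be extended to all \<open>t\<close> in \<open>J\<close>.  For \<open>\<delta> = 0\<close> no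
values are prescribed and the extension is a family of \<open>A\<close>-maps; for \<open>\<delta> = 1\<close> it is a homotopy between
the two given families.\<close>

locale equivariant_extension = G_CW G Y \<theta> Sk I K q + A: group A
  for G :: "('g, 'b) monoid_scheme" (structure) and Y :: "'y topology" and \<theta> Sk I K q
    and A :: "('h, 'c) monoid_scheme" +
  fixes \<pi> :: "'h \<Rightarrow> 'g" and X :: "'x topology" and \<xi> :: "'h \<Rightarrow> 'x \<Rightarrow> 'x"
    and W :: "'w topology" and \<delta> :: real and \<Phi>0 :: "'w \<Rightarrow> real \<Rightarrow> 'y \<Rightarrow> 'x"
  assumes \<pi>_hom: "\<pi> \<in> hom A G"
    and A_space: "G_space A X \<xi>"
    and contractible_fixed_spaces: "\<lbrakk>subgroup \<Lambda> A; y \<in> topspace Y; \<forall>\<gamma>\<in>\<Lambda>. \<theta> (\<pi> \<gamma>) y = y\<rbrakk> \<Longrightarrow>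
      topspace (fixed_space X \<xi> \<Lambda>) \<noteq> {} \<and> contractible_space (fixed_space X \<xi> \<Lambda>)"
    and \<delta>: "\<delta> \<in> {0, 1}"
    and data_equivariant: "\<lbrakk>w \<in> topspace W; \<bar>t\<bar> = 1; \<bar>t\<bar> \<le> \<delta>; \<gamma> \<in> carrier A; y \<in> topspace Y\<rbrakk> \<Longrightarrow>
      \<Phi>0 w t (\<theta> (\<pi> \<gamma>) y) = \<xi> \<gamma> (\<Phi>0 w t y)"
    and data_continuous: "\<lbrakk>\<bar>t\<bar> = 1; \<bar>t\<bar> \<le> \<delta>; a \<in> I n; c \<in> left_cosets G (K n a)\<rbrakk> \<Longrightarrow>
      continuous_map (prod_topology W (disk n)) X (\<lambda>(w, x). \<Phi>0 w t (q n a (c, x)))"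
begin

sublocale X: group_action A "topspace X" \<xi>
  using A_space by (simp add: G_space_def)

text \<open>\<open>A\<close> permutes the cells \<open>G/K \<times> D\<^sup>n\<close> belonging to one index through its action on the cosets.  An extension
is chosen only on one representative coset \<open>rep c\<close> of each orbit; the element \<open>transporter c\<close> carries it
to the coset \<open>c\<close>.  On the representative the values have to lie in the fixed space of the stabiliser
\<open>stab (rep c)\<close>, and \<open>contr\<close> picks a contraction of that space.\<close>

definition translates where "translates c = {\<pi> \<gamma> <#\<^bsub>G\<^esub> c | \<gamma>. \<gamma> \<in> carrier A}"
definition rep where "rep c = (SOME c'. c' \<in> translates c)"
definition transporter where "transporter c = (SOME \<gamma>. \<gamma> \<in> carrier A \<and> \<pi> \<gamma> <#\<^bsub>G\<^esub> rep c = c)"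
definition stab where "stab c = {\<gamma> \<in> carrier A. \<pi> \<gamma> <#\<^bsub>G\<^esub> c = c}"
definition contr where "contr c = (SOME (\<kappa>, z0). contraction (fixed_space X \<xi> (stab c)) \<kappa> z0)"

definition cell_ext where
  "cell_ext f n a c w b = \<xi> (transporter c)
     (cone_ext n (fst (contr (rep c))) (snd (contr (rep c)))
        (\<lambda>b'. f w (fst b') (q n a (rep c, snd b'))) b)"

definition coords where
  "coords n y = (SOME (a, c, x). a \<in> I n \<and> c \<in> C n a \<and> x \<in> open_disk n \<and> y = q n a (c, x))"

text \<open>Prescribed values take precedence over the extension \<open>f\<close> to the lower skeleton, so that the new
function agrees with the data at \<open>|t| = 1\<close> everywhere on \<open>Y\<close>, not only on the skeleton reached so far.\<close>

definition extend_over_cells where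
  "extend_over_cells n f w t y =
     (if \<bar>t\<bar> = 1 then \<Phi>0 w t y else if y \<in> Sk n then f w t y
      else case coords n y of (a, c, x) \<Rightarrow> cell_ext f n a c w (t, x))"

primrec skeletal_extension where
  "skeletal_extension 0 = \<Phi>0"
| "skeletal_extension (Suc n) = extend_over_cells n (skeletal_extension n)"

abbreviation J :: "real topology" where "J \<equiv> top_of_set {-\<delta>..\<delta>}"

text \<open>Continuity is recorded cell by cell, jointly with the parameters: continuity of the adjoint map from
\<open>W \<times> J\<close> to the mapping space follows from it, and it is what the extension over the next cells uses.\<close>

definition partial_extension where
  "partial_extension n f \<longleftrightarrow>
     (\<forall>w t y. \<bar>t\<bar> = 1 \<longrightarrow> f w t y = \<Phi>0 w t y) \<and>
     (\<forall>w t \<gamma> y. w \<in> topspace W \<and> \<bar>t\<bar> \<le> \<delta> \<and> \<gamma> \<in> carrier A \<and> y \<in> Sk n \<longrightarrow> f w t (\<theta> (\<pi> \<gamma>) y) = \<xi> \<gamma> (f w t y)) \<and>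
     (\<forall>m a c. m < n \<and> a \<in> I m \<and> c \<in> C m a \<longrightarrow>
       continuous_map (prod_topology (prod_topology W J) (disk m)) X (\<lambda>(p, x). f (fst p) (snd p) (q m a (c, x))))"

lemma \<pi>_closed: "\<gamma> \<in> carrier A \<Longrightarrow> \<pi> \<gamma> \<in> carrier G"
  using \<pi>_hom by (auto simp: hom_def)

lemma \<pi>_mult: "\<gamma> \<in> carrier A \<Longrightarrow> \<gamma>' \<in> carrier A \<Longrightarrow> \<pi> (\<gamma> \<otimes>\<^bsub>A\<^esub> \<gamma>') = \<pi> \<gamma> \<otimes> \<pi> \<gamma>'"
  using \<pi>_hom by (auto simp: hom_def)

lemma \<pi>_one: "\<pi> \<one>\<^bsub>A\<^esub> = \<one>"
  using \<pi>_hom hom_one A.is_group is_group by blast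

lemma C_subset: "a \<in> I n \<Longrightarrow> c \<in> C n a \<Longrightarrow> c \<subseteq> carrier G"
  unfolding left_cosets_def using K_subgroup l_coset_subset_G subgroup.subset by blast

lemma C_translate:
  assumes "a \<in> I n" "c \<in> C n a" "g \<in> carrier G"
  shows "g <#\<^bsub>G\<^esub> c \<in> C n a"
proof -
  obtain h where h: "h \<in> carrier G" "c = h <#\<^bsub>G\<^esub> K n a" using assms(2) by (auto simp: left_cosets_def)
  then have "g <#\<^bsub>G\<^esub> c = (g \<otimes> h) <#\<^bsub>G\<^esub> K n a"
    using assms K_subgroup lcos_m_assoc subgroup.subset by metis
  then show ?thesis using h assms(3) by (auto simp: left_cosets_def)
qed

lemma translate_mult:
  assumes "a \<in> I n" "c \<in> C n a" "\<gamma> \<in> carrier A" "\<gamma>' \<in> carrier A"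
  shows "\<pi> (\<gamma> \<otimes>\<^bsub>A\<^esub> \<gamma>') <#\<^bsub>G\<^esub> c = \<pi> \<gamma> <#\<^bsub>G\<^esub> (\<pi> \<gamma>' <#\<^bsub>G\<^esub> c)"
  using assms C_subset by (simp add: \<pi>_mult lcos_m_assoc \<pi>_closed)

lemma translate_one:
  assumes "a \<in> I n" "c \<in> C n a"
  shows "\<pi> \<one>\<^bsub>A\<^esub> <#\<^bsub>G\<^esub> c = c"
  using assms C_subset by (simp add: \<pi>_one lcos_mult_one)

lemma translate_inv:
  assumes "a \<in> I n" "c \<in> C n a" "\<gamma> \<in> carrier A"
  shows "\<pi> (inv\<^bsub>A\<^esub> \<gamma>) <#\<^bsub>G\<^esub> (\<pi> \<gamma> <#\<^bsub>G\<^esub> c) = c"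
  using assms translate_mult[of a n c "inv\<^bsub>A\<^esub> \<gamma>" \<gamma>] translate_one by simp

lemma translates_translate:
  assumes ac: "a \<in> I n" "c \<in> C n a" and \<gamma>: "\<gamma> \<in> carrier A"
  shows "translates (\<pi> \<gamma> <#\<^bsub>G\<^esub> c) = translates c"
proof
  show "translates (\<pi> \<gamma> <#\<^bsub>G\<^esub> c) \<subseteq> translates c"
  proof
    fix c' assume "c' \<in> translates (\<pi> \<gamma> <#\<^bsub>G\<^esub> c)"
    then obtain \<gamma>' where "\<gamma>' \<in> carrier A" "c' = \<pi> \<gamma>' <#\<^bsub>G\<^esub> (\<pi> \<gamma> <#\<^bsub>G\<^esub> c)" by (auto simp: translates_def)
    then show "c' \<in> translates c"
      unfolding translates_def using translate_mult[OF ac, of \<gamma>' \<gamma>] \<gamma> A.m_closed by auto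
  qed
  show "translates c \<subseteq> translates (\<pi> \<gamma> <#\<^bsub>G\<^esub> c)"
  proof
    fix c' assume "c' \<in> translates c"
    then obtain \<gamma>' where \<gamma>': "\<gamma>' \<in> carrier A" "c' = \<pi> \<gamma>' <#\<^bsub>G\<^esub> c" by (auto simp: translates_def)
    have "\<pi> (\<gamma>' \<otimes>\<^bsub>A\<^esub> inv\<^bsub>A\<^esub> \<gamma>) <#\<^bsub>G\<^esub> (\<pi> \<gamma> <#\<^bsub>G\<^esub> c) = \<pi> \<gamma>' <#\<^bsub>G\<^esub> (\<pi> (inv\<^bsub>A\<^esub> \<gamma>) <#\<^bsub>G\<^esub> (\<pi> \<gamma> <#\<^bsub>G\<^esub> c))"
      using ac \<gamma> \<gamma>' C_translate \<pi>_closed by (intro translate_mult) auto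
    then have "c' = \<pi> (\<gamma>' \<otimes>\<^bsub>A\<^esub> inv\<^bsub>A\<^esub> \<gamma>) <#\<^bsub>G\<^esub> (\<pi> \<gamma> <#\<^bsub>G\<^esub> c)"
      using translate_inv[OF ac \<gamma>] \<gamma>' by simp
    then show "c' \<in> translates (\<pi> \<gamma> <#\<^bsub>G\<^esub> c)"
      unfolding translates_def using \<gamma> \<gamma>' by blast
  qed
qed

lemma rep_translate:
  assumes "a \<in> I n" "c \<in> C n a" "\<gamma> \<in> carrier A"
  shows "rep (\<pi> \<gamma> <#\<^bsub>G\<^esub> c) = rep c"
  unfolding rep_def translates_translate[OF assms] ..

lemma rep_in_translates:
  assumes "a \<in> I n" "c \<in> C n a"
  shows "rep c \<in> translates c"
proof -
  have "c \<in> translates c" unfolding translates_def using translate_one[OF assms] A.one_closed by force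
  then show ?thesis unfolding rep_def by (rule someI)
qed

lemma rep_in_C:
  assumes "a \<in> I n" "c \<in> C n a"
  shows "rep c \<in> C n a"
  using rep_in_translates[OF assms] C_translate[OF assms] \<pi>_closed unfolding translates_def by auto

lemma transporter:
  assumes "a \<in> I n" "c \<in> C n a"
  shows "transporter c \<in> carrier A" "\<pi> (transporter c) <#\<^bsub>G\<^esub> rep c = c"
proof -
  obtain \<gamma> where \<gamma>: "\<gamma> \<in> carrier A" "rep c = \<pi> \<gamma> <#\<^bsub>G\<^esub> c"
    using rep_in_translates[OF assms] unfolding translates_def by auto
  then have "inv\<^bsub>A\<^esub> \<gamma> \<in> carrier A \<and> \<pi> (inv\<^bsub>A\<^esub> \<gamma>) <#\<^bsub>G\<^esub> rep c = c"
    using translate_inv[OF assms] by simp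
  then have "transporter c \<in> carrier A \<and> \<pi> (transporter c) <#\<^bsub>G\<^esub> rep c = c"
    unfolding transporter_def by (rule someI)
  then show "transporter c \<in> carrier A" "\<pi> (transporter c) <#\<^bsub>G\<^esub> rep c = c" by auto
qed

lemma stab_subgroup:
  assumes "a \<in> I n" "c \<in> C n a"
  shows "subgroup (stab c) A"
proof (rule A.subgroupI)
  show "stab c \<subseteq> carrier A" by (auto simp: stab_def)
  show "stab c \<noteq> {}" using translate_one[OF assms] A.one_closed by (auto simp: stab_def)
  show "inv\<^bsub>A\<^esub> \<gamma> \<in> stab c" if "\<gamma> \<in> stab c" for \<gamma>
    using translate_inv[OF assms, of \<gamma>] that by (auto simp: stab_def)
  show "\<gamma> \<otimes>\<^bsub>A\<^esub> \<gamma>' \<in> stab c" if "\<gamma> \<in> stab c" "\<gamma>' \<in> stab c" for \<gamma> \<gamma>'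
    using translate_mult[OF assms, of \<gamma> \<gamma>'] that by (auto simp: stab_def)
qed

lemma contr:
  assumes ac: "a \<in> I n" "c \<in> C n a"
  shows "contraction (fixed_space X \<xi> (stab c)) (fst (contr c)) (snd (contr c))"
proof -
  let ?y = "q n a (c, \<lambda>i. 0)"
  have y: "?y \<in> topspace Y" using q_in_Sk[OF ac zero_in_disk] Sk_subset by blast
  have "\<theta> (\<pi> \<gamma>) ?y = ?y" if "\<gamma> \<in> stab c" for \<gamma>
    using that q_equivariant[OF ac(1) \<pi>_closed ac(2) zero_in_disk, of \<gamma>] by (auto simp: stab_def)
  then have "topspace (fixed_space X \<xi> (stab c)) \<noteq> {} \<and> contractible_space (fixed_space X \<xi> (stab c))"
    using contractible_fixed_spaces[OF stab_subgroup[OF ac] y] by blast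
  then obtain \<kappa> z0 where "contraction (fixed_space X \<xi> (stab c)) \<kappa> z0"
    using contraction_exists by blast
  then have "case (\<kappa>, z0) of (\<kappa>, z0) \<Rightarrow> contraction (fixed_space X \<xi> (stab c)) \<kappa> z0" by simp
  then have "case contr c of (\<kappa>, z0) \<Rightarrow> contraction (fixed_space X \<xi> (stab c)) \<kappa> z0"
    unfolding contr_def by (rule someI)
  then show ?thesis by (simp add: case_prod_unfold)
qed

lemma topspace_fixed_space:
  "topspace (fixed_space X \<xi> \<Lambda>) = {x \<in> topspace X. \<forall>\<gamma>\<in>\<Lambda>. \<xi> \<gamma> x = x}"
  by (auto simp: fixed_space_def)

lemma coords_q:
  assumes "a \<in> I n" "c \<in> C n a" "x \<in> open_disk n"
  shows "coords n (q n a (c, x)) = (a, c, x)"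
  unfolding coords_def
proof (rule some_equality)
  fix p assume "case p of (a', c', x') \<Rightarrow> a' \<in> I n \<and> c' \<in> C n a' \<and> x' \<in> open_disk n \<and> q n a (c, x) = q n a' (c', x')"
  then show "p = (a, c, x)" using q_interior_inj[OF assms] by (cases p) auto
qed (use assms in simp)

lemma Sk_invariant:
  assumes "g \<in> carrier G" "y \<in> Sk n"
  shows "\<theta> g y \<in> Sk n"
proof -
  obtain m a c x where h: "m < n" "a \<in> I m" "c \<in> C m a" "x \<in> open_disk m" "y = q m a (c, x)"
    using in_open_cell[OF assms(2)] by metis
  then have x: "x \<in> topspace (disk m)" by (simp add: open_disk_def)
  have "\<theta> g y = q m a (g <#\<^bsub>G\<^esub> c, x)" using q_equivariant[OF h(2) assms(1) h(3) x] h(5) by simp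
  then have "\<theta> g y \<in> Sk (Suc m)" using q_in_Sk[OF h(2) C_translate[OF h(2,3) assms(1)] x] by simp
  then show ?thesis using Sk_mono[of "Suc m" n] h(1) by auto
qed

lemma rim_cases:
  assumes "b \<in> rim \<delta> n"
  shows "\<bar>fst b\<bar> \<le> \<delta>" "snd b \<in> topspace (disk n)" "\<bar>fst b\<bar> = 1 \<or> (\<Sum>i<n. (snd b i)\<^sup>2) = 1"
  using assms by (auto simp: rim_def topspace_cylinder cyl_norm_def radius_def max_def split: if_splits)

context
  fixes n f assumes f: "partial_extension n f"
begin

lemma f_data: "\<bar>t\<bar> = 1 \<Longrightarrow> f w t y = \<Phi>0 w t y"
  using f by (simp add: partial_extension_def)

lemma f_equivariant:
  assumes "w \<in> topspace W" "\<bar>t\<bar> \<le> \<delta>" "\<gamma> \<in> carrier A" "y \<in> topspace Y" "\<bar>t\<bar> = 1 \<or> y \<in> Sk n"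
  shows "f w t (\<theta> (\<pi> \<gamma>) y) = \<xi> \<gamma> (f w t y)"
proof (cases "\<bar>t\<bar> = 1")
  case True
  then show ?thesis using data_equivariant assms by (simp add: f_data)
next
  case False
  then show ?thesis using f assms unfolding partial_extension_def by blast
qed

text \<open>The rim consists of three closed pieces.  On the two lids the values are the prescribed ones; the
side is mapped into the compact image of the attaching sphere in the lower skeleton, where
\<open>cellwise_continuous_on_compact\<close> applies.\<close>

lemma rim_values_continuous:
  assumes ac: "a \<in> I n" "c \<in> C n a"
  shows "continuous_map (prod_topology W (subtopology (cylinder \<delta> n) (rim \<delta> n))) X
      (\<lambda>(w, b). f w (fst b) (q n a (c, snd b)))"
proof -
  let ?R = "subtopology (cylinder \<delta> n) (rim \<delta> n)"
  let ?P = "prod_topology W ?R"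
  let ?F = "\<lambda>(w, b). f w (fst b) (q n a (c, snd b))"
  let ?S = "{x \<in> topspace (disk n). (\<Sum>i<n. (x i)\<^sup>2) = 1}"
  \<comment> \<open>The two lids and the side.\<close>
  define T :: "nat \<Rightarrow> ('w \<times> real \<times> (nat \<Rightarrow> real)) set" where
    "T i = (if i = 0 then {p \<in> topspace ?P. fst (snd p) \<in> {1}}
      else if i = 1 then {p \<in> topspace ?P. fst (snd p) \<in> {-1}}
      else {p \<in> topspace ?P. snd (snd p) \<in> ?S})" for i
  have w: "continuous_map ?P W fst" by (rule continuous_map_fst)
  have b: "continuous_map ?P (cylinder \<delta> n) snd"
    by (rule continuous_map_into_fulltopology[OF continuous_map_snd])
  have t: "continuous_map ?P J (\<lambda>p. fst (snd p))"
    using continuous_map_compose[OF b[unfolded cylinder_def] continuous_map_fst]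
    by (simp add: cylinder_def comp_def)
  have x: "continuous_map ?P (disk n) (\<lambda>p. snd (snd p))"
    using continuous_map_compose[OF b[unfolded cylinder_def] continuous_map_snd]
    by (simp add: cylinder_def comp_def)
  have t': "continuous_map ?P euclideanreal (\<lambda>p. fst (snd p))"
    using t by (rule continuous_map_into_fulltopology)
  have rim: "snd p \<in> rim \<delta> n" "fst p \<in> topspace W" if "p \<in> topspace ?P" for p
    using that by (auto simp: rim_def)
  show ?thesis
  proof (rule pasting_lemma_closed[where I = "{0, 1, 2}" and T = T and f = "\<lambda>_. ?F"])
    fix i :: nat assume i: "i \<in> {0, 1, 2}"
    have "closedin ?P (T 0)" "closedin ?P (T 1)"
      unfolding T_def
      using closedin_continuous_map_preimage[OF t', of "{1}"] closedin_continuous_map_preimage[OF t', of "{-1}"]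
      by simp_all
    moreover have "closedin ?P (T 2)"
      unfolding T_def using closedin_continuous_map_preimage[OF x closedin_sphere] by simp
    ultimately show "closedin ?P (T i)" using i by auto
    show "continuous_map (subtopology ?P (T i)) X ?F"
    proof (cases "i = 2")
      case True
      let ?D = "(\<lambda>x. q n a (c, x)) ` ?S"
      have D: "compactin Y ?D" "?D \<subseteq> Sk n"
        using image_compactin[OF sphere_compact q_continuous_Y[OF ac]] q_boundary[OF ac] by auto
      have 1: "continuous_map (prod_topology (prod_topology W J) (subtopology Y ?D)) X (\<lambda>(p, y). f (fst p) (snd p) y)"
      proof (rule cellwise_continuous_on_compact[OF D(1)])
        fix m a' c' x' assume h: "a' \<in> I m" "c' \<in> C m a'" "x' \<in> open_disk m" "q m a' (c', x') \<in> ?D"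
        have "m < n" using q_interior[OF h(1-3)] h(4) D(2) Sk_mono[of n m] by (meson DiffD2 not_le subsetD)
        then show "continuous_map (prod_topology (prod_topology W J) (disk m)) X
            (\<lambda>(p, x). f (fst p) (snd p) (q m a' (c', x)))"
          using f h unfolding partial_extension_def by blast
      qed
      have "continuous_map (subtopology ?P (T i)) Y (\<lambda>p. q n a (c, snd (snd p)))"
        using continuous_map_compose[OF x q_continuous_Y[OF ac]]
        by (simp add: comp_def continuous_map_from_subtopology)
      then have 2: "continuous_map (subtopology ?P (T i)) (subtopology Y ?D) (\<lambda>p. q n a (c, snd (snd p)))"
        using True by (intro continuous_map_into_subtopology) (auto simp: T_def)
      have 3: "continuous_map (subtopology ?P (T i)) (prod_topology W J) (\<lambda>p. (fst p, fst (snd p)))"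
        using w t by (intro continuous_map_from_subtopology continuous_map_pairedI)
      show ?thesis
        using continuous_map_binop[OF 1 3 2] by (simp add: case_prod_unfold)
    next
      case False
      define s :: real where "s = (if i = 0 then 1 else -1)"
      have s: "\<bar>s\<bar> = 1" by (simp add: s_def)
      have Ti: "T i = {p \<in> topspace ?P. fst (snd p) = s}" using False i by (auto simp: T_def s_def)
      show ?thesis
      proof (cases "\<bar>s\<bar> \<le> \<delta>")
        case True
        have "continuous_map ?P X (\<lambda>p. \<Phi>0 (fst p) s (q n a (c, snd (snd p))))"
          by (rule continuous_map_binop[OF data_continuous[OF s True ac] w x])
        then have "continuous_map (subtopology ?P (T i)) X (\<lambda>p. \<Phi>0 (fst p) s (q n a (c, snd (snd p))))"
          by (rule continuous_map_from_subtopology)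
        then show ?thesis
          by (rule continuous_map_eq) (auto simp: Ti f_data[OF s])
      next
        case False
        \<comment> \<open>For \<open>\<delta> = 0\<close> there are no lids.\<close>
        have "T i \<inter> topspace ?P = {}" using rim rim_cases(1) False by (force simp: Ti)
        then have "subtopology ?P (T i) = trivial_topology"
          by (metis inf_commute subtopology_trivial_iff disjnt_def topspace_subtopology null_topspace_iff_trivial)
        then show ?thesis by simp
      qed
    qed
  next
    fix p assume p: "p \<in> topspace ?P"
    have "\<exists>j\<in>{0, 1, 2}. p \<in> T j"
      using rim_cases[OF rim(1)[OF p]] p unfolding T_def by (auto simp: abs_if split: if_splits)
    then show "\<exists>j. j \<in> {0, 1, 2} \<and> p \<in> T j \<and> ?F p = ?F p" by blast
  qed auto
qed

text \<open>The stabiliser of a coset fixes the whole corresponding cell pointwise; equivariance turns this into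
a condition on the values.\<close>

lemma rim_values_fixed:
  assumes ac: "a \<in> I n" "c \<in> C n a"
  shows "continuous_map (prod_topology W (subtopology (cylinder \<delta> n) (rim \<delta> n))) (fixed_space X \<xi> (stab c))
      (\<lambda>(w, b). f w (fst b) (q n a (c, snd b)))"
  unfolding fixed_space_def
proof (rule continuous_map_into_subtopology[OF rim_values_continuous[OF ac]], intro Pi_I)
  fix p assume "p \<in> topspace (prod_topology W (subtopology (cylinder \<delta> n) (rim \<delta> n)))"
  then obtain w b where p: "p = (w, b)" and w: "w \<in> topspace W" and b: "b \<in> rim \<delta> n"
    by (cases p) auto
  note r = rim_cases[OF b]
  have "\<xi> \<gamma> (f w (fst b) (q n a (c, snd b))) = f w (fst b) (q n a (c, snd b))" if \<gamma>: "\<gamma> \<in> stab c" for \<gamma>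
  proof -
    have \<gamma>': "\<gamma> \<in> carrier A" "\<pi> \<gamma> <#\<^bsub>G\<^esub> c = c" using \<gamma> by (auto simp: stab_def)
    have y: "q n a (c, snd b) \<in> topspace Y" using q_in_Sk[OF ac r(2)] Sk_subset by blast
    have "\<xi> \<gamma> (f w (fst b) (q n a (c, snd b))) = f w (fst b) (\<theta> (\<pi> \<gamma>) (q n a (c, snd b)))"
      using f_equivariant[OF w r(1) \<gamma>'(1) y] r(3) q_boundary[OF ac r(2)] by auto
    also have "\<dots> = f w (fst b) (q n a (c, snd b))"
      using q_equivariant[OF ac(1) \<pi>_closed[OF \<gamma>'(1)] ac(2) r(2)] \<gamma>'(2) by simp
    finally show ?thesis .
  qed
  then show "(case p of (w, b) \<Rightarrow> f w (fst b) (q n a (c, snd b))) \<in> {x. \<forall>g\<in>stab c. \<xi> g x = x}"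
    using p by simp
qed

lemma cone_fixed:
  assumes ac: "a \<in> I n" "c \<in> C n a"
  shows "continuous_map (prod_topology W (cylinder \<delta> n)) (fixed_space X \<xi> (stab c))
      (\<lambda>(w, b). cone_ext n (fst (contr c)) (snd (contr c)) (\<lambda>b'. f w (fst b') (q n a (c, snd b'))) b)"
  using contr[OF ac] unfolding contraction_def
  by (intro continuous_cone_ext[OF \<delta>] rim_values_fixed[OF ac]) auto

lemma cell_ext_continuous:
  assumes ac: "a \<in> I n" "c \<in> C n a"
  shows "continuous_map (prod_topology W (cylinder \<delta> n)) X (\<lambda>(w, b). cell_ext f n a c w b)"
proof -
  have "continuous_map X X (\<xi> (transporter c))"
    using A_space transporter(1)[OF ac] by (simp add: G_space_def)
  from continuous_map_compose[OF continuous_map_into_fulltopology[OF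
      cone_fixed[OF ac(1) rep_in_C[OF ac], unfolded fixed_space_def]] this]
  show ?thesis by (simp add: cell_ext_def comp_def case_prod_unfold)
qed

text \<open>On the interior this is the definition.  On the rim both sides are given by values already known,
which agree because these are equivariant.\<close>

lemma extend_over_cells_q:
  assumes ac: "a \<in> I n" "c \<in> C n a" and w: "w \<in> topspace W" and t: "\<bar>t\<bar> \<le> \<delta>" and x: "x \<in> topspace (disk n)"
  shows "extend_over_cells n f w t (q n a (c, x)) = cell_ext f n a c w (t, x)"
proof (cases "(t, x) \<in> rim \<delta> n")
  case True
  note rc = rep_in_C[OF ac]
  let ?\<beta> = "\<lambda>b'. f w (fst b') (q n a (rep c, snd b'))"
  have y: "q n a (rep c, x) \<in> topspace Y" using q_in_Sk[OF ac(1) rc x] Sk_subset by blast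
  have "?\<beta> (t, x) \<in> topspace (fixed_space X \<xi> (stab (rep c)))"
    using continuous_map_prod_closed[OF rim_values_fixed[OF ac(1) rc] w, of "(t, x)"] True
    by (auto simp: rim_def)
  then have "cell_ext f n a c w (t, x) = \<xi> (transporter c) (?\<beta> (t, x))"
    unfolding cell_ext_def using contr[OF ac(1) rc] True
    by (subst cone_ext_rim) (auto simp: contraction_def rim_def)
  also have "\<dots> = f w t (\<theta> (\<pi> (transporter c)) (q n a (rep c, x)))"
    using f_equivariant[OF w t transporter(1)[OF ac] y] rim_cases(3)[OF True] q_boundary[OF ac(1) rc x] by auto
  also have "\<dots> = f w t (q n a (c, x))"
    using q_equivariant[OF ac(1) \<pi>_closed[OF transporter(1)[OF ac]] rc x] transporter(2)[OF ac] by simp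
  finally have eq: "cell_ext f n a c w (t, x) = f w t (q n a (c, x))" .
  have "\<bar>t\<bar> = 1 \<or> q n a (c, x) \<in> Sk n" using rim_cases(3)[OF True] q_boundary[OF ac x] by auto
  then show ?thesis unfolding eq by (auto simp: extend_over_cells_def f_data)
next
  case False
  have "(t, x) \<in> topspace (cylinder \<delta> n)" using t x by (simp add: topspace_cylinder)
  then have "cyl_norm n (t, x) < 1" using cyl_norm_le_1[OF \<delta>, of "(t, x)" n] False by (auto simp: rim_def)
  then have "\<bar>t\<bar> < 1" "radius n x < 1" by (auto simp: cyl_norm_def)
  then have "\<bar>t\<bar> \<noteq> 1" "x \<in> open_disk n" using x by (auto simp: open_disk_def radius_def)
  then show ?thesis using q_interior[OF ac] coords_q[OF ac] by (simp add: extend_over_cells_def)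
qed

text \<open>The two group elements \<open>\<gamma> \<cdot> transporter c\<close> and \<open>transporter (\<gamma> c)\<close> both carry the representative to
\<open>\<gamma> c\<close>; hence they differ by an element of its stabiliser, which fixes the values.\<close>

lemma cell_ext_translate:
  assumes ac: "a \<in> I n" "c \<in> C n a" and w: "w \<in> topspace W" and b: "b \<in> topspace (cylinder \<delta> n)"
    and \<gamma>: "\<gamma> \<in> carrier A"
  shows "cell_ext f n a (\<pi> \<gamma> <#\<^bsub>G\<^esub> c) w b = \<xi> \<gamma> (cell_ext f n a c w b)"
proof -
  let ?c = "\<pi> \<gamma> <#\<^bsub>G\<^esub> c"
  have ac': "?c \<in> C n a" using C_translate[OF ac \<pi>_closed[OF \<gamma>]] .
  have r: "rep ?c = rep c" by (rule rep_translate[OF ac \<gamma>])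
  note rc = rep_in_C[OF ac]
  let ?u = "cone_ext n (fst (contr (rep c))) (snd (contr (rep c))) (\<lambda>b'. f w (fst b') (q n a (rep c, snd b'))) b"
  let ?k = "transporter c" and ?k' = "transporter ?c"
  have k: "?k \<in> carrier A" "?k' \<in> carrier A" "\<pi> ?k <#\<^bsub>G\<^esub> rep c = c" "\<pi> ?k' <#\<^bsub>G\<^esub> rep c = ?c"
    using transporter[OF ac] transporter[OF ac(1) ac'] r by auto
  have u: "?u \<in> topspace (fixed_space X \<xi> (stab (rep c)))"
    using continuous_map_prod_closed[OF cone_fixed[OF ac(1) rc] w b] .
  let ?s = "inv\<^bsub>A\<^esub> ?k' \<otimes>\<^bsub>A\<^esub> (\<gamma> \<otimes>\<^bsub>A\<^esub> ?k)"
  have "\<pi> ?s <#\<^bsub>G\<^esub> rep c = \<pi> (inv\<^bsub>A\<^esub> ?k') <#\<^bsub>G\<^esub> (\<pi> \<gamma> <#\<^bsub>G\<^esub> (\<pi> ?k <#\<^bsub>G\<^esub> rep c))"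
    using translate_mult[OF ac(1) rc] k \<gamma> by simp
  also have "\<dots> = rep c" using translate_inv[OF ac(1) rc k(2)] k by simp
  finally have "?s \<in> stab (rep c)" using k \<gamma> by (simp add: stab_def)
  then have "\<xi> ?s ?u = ?u" and uX: "?u \<in> topspace X" using u by (auto simp: topspace_fixed_space)
  then have "\<xi> ?k' ?u = \<xi> ?k' (\<xi> ?s ?u)" by simp
  also have "\<dots> = \<xi> (?k' \<otimes>\<^bsub>A\<^esub> ?s) ?u" using k \<gamma> uX by (simp add: X.composition_rule)
  also have "?k' \<otimes>\<^bsub>A\<^esub> ?s = \<gamma> \<otimes>\<^bsub>A\<^esub> ?k" using k \<gamma> by (simp flip: A.m_assoc)
  also have "\<xi> (\<gamma> \<otimes>\<^bsub>A\<^esub> ?k) ?u = \<xi> \<gamma> (\<xi> ?k ?u)" using k \<gamma> uX by (simp add: X.composition_rule)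
  finally show ?thesis by (simp add: cell_ext_def r)
qed

lemma extend_over_cells_partial: "partial_extension (Suc n) (extend_over_cells n f)"
  unfolding partial_extension_def
proof (intro conjI allI impI; (elim conjE)?)
  fix w t y assume "\<bar>t\<bar> = (1::real)"
  then show "extend_over_cells n f w t y = \<Phi>0 w t y" by (simp add: extend_over_cells_def)
next
  fix w t \<gamma> y
  assume w: "w \<in> topspace W" and t: "\<bar>t\<bar> \<le> \<delta>" and \<gamma>: "\<gamma> \<in> carrier A" and y: "y \<in> Sk (Suc n)"
  have yY: "y \<in> topspace Y" using y Sk_subset by blast
  show "extend_over_cells n f w t (\<theta> (\<pi> \<gamma>) y) = \<xi> \<gamma> (extend_over_cells n f w t y)"
  proof (cases "\<bar>t\<bar> = 1 \<or> y \<in> Sk n")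
    case True
    then show ?thesis
      using f_equivariant[OF w t \<gamma> yY] Sk_invariant[OF \<pi>_closed[OF \<gamma>], of y n] f_data[of t]
      by (auto simp: extend_over_cells_def)
  next
    case False
    then obtain a c x where ac: "a \<in> I n" "c \<in> C n a" and x: "x \<in> open_disk n" and yq: "y = q n a (c, x)"
      using q_interior_surj y by metis
    have x': "x \<in> topspace (disk n)" using x by (simp add: open_disk_def)
    have b: "(t, x) \<in> topspace (cylinder \<delta> n)" using t x' by (simp add: topspace_cylinder)
    have "\<theta> (\<pi> \<gamma>) y = q n a (\<pi> \<gamma> <#\<^bsub>G\<^esub> c, x)" using q_equivariant[OF ac(1) \<pi>_closed[OF \<gamma>] ac(2) x'] yq by simp
    then show ?thesis
      using extend_over_cells_q[OF ac w t x'] extend_over_cells_q[OF ac(1) C_translate[OF ac \<pi>_closed[OF \<gamma>]] w t x']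
        cell_ext_translate[OF ac w b \<gamma>] yq by simp
  qed
next
  fix m a c assume m: "m < Suc n" and ac: "a \<in> I m" "c \<in> C m a"
  let ?P = "prod_topology (prod_topology W J) (disk m)"
  show "continuous_map ?P X (\<lambda>(p, x). extend_over_cells n f (fst p) (snd p) (q m a (c, x)))"
  proof (cases "m = n")
    case True
    note ac = ac[unfolded True]
    have w: "continuous_map ?P W (\<lambda>p. fst (fst p))"
      by (rule continuous_map_compose[OF continuous_map_fst continuous_map_fst, unfolded comp_def])
    have t: "continuous_map ?P J (\<lambda>p. snd (fst p))"
      by (rule continuous_map_compose[OF continuous_map_fst continuous_map_snd, unfolded comp_def])
    have b: "continuous_map ?P (cylinder \<delta> n) (\<lambda>p. (snd (fst p), snd p))"
      unfolding cylinder_def True[symmetric] by (intro continuous_map_pairedI t continuous_map_snd)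
    have "continuous_map ?P X (\<lambda>p. cell_ext f n a c (fst (fst p)) (snd (fst p), snd p))"
      by (rule continuous_map_binop[OF cell_ext_continuous[OF ac] w b])
    then show ?thesis
    proof (rule continuous_map_eq)
      fix p assume "p \<in> topspace ?P"
      then show "cell_ext f n a c (fst (fst p)) (snd (fst p), snd p) = (case p of (p, x) \<Rightarrow> extend_over_cells n f (fst p) (snd p) (q m a (c, x)))"
        using extend_over_cells_q[OF ac, of "fst (fst p)" "snd (fst p)" "snd p"] True by (cases p) auto
    qed
  next
    case False
    then have "m < n" using m by simp
    then have "continuous_map ?P X (\<lambda>(p, x). f (fst p) (snd p) (q m a (c, x)))"
      using f ac unfolding partial_extension_def by blast
    then show ?thesis
    proof (rule continuous_map_eq)
      fix p assume p: "p \<in> topspace ?P"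
      have "q m a (c, snd p) \<in> Sk n"
        using q_in_Sk[OF ac, of "snd p"] Sk_mono[of "Suc m" n] \<open>m < n\<close> p by auto
      then show "(case p of (p, x) \<Rightarrow> f (fst p) (snd p) (q m a (c, x))) = (case p of (p, x) \<Rightarrow> extend_over_cells n f (fst p) (snd p) (q m a (c, x)))"
        by (cases p) (auto simp: extend_over_cells_def f_data)
    qed
  qed
qed

end

lemma skeletal_extension_partial: "partial_extension n (skeletal_extension n)"
proof (induction n)
  case 0
  then show ?case by (simp add: partial_extension_def Sk_0)
next
  case (Suc n)
  then show ?case by (simp add: extend_over_cells_partial)
qed

lemma skeletal_extension_stable:
  assumes "m \<le> n" "y \<in> Sk m"
  shows "skeletal_extension n w t y = skeletal_extension m w t y"
  using assms
proof (induction n rule: dec_induct)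
  case (step n)
  then have "y \<in> Sk n" using Sk_mono by blast
  then show ?case
    using step.IH step.prems f_data[OF skeletal_extension_partial, of t n w y] by (simp add: extend_over_cells_def)
qed simp

text \<open>The values on \<open>Sk n\<close> are final from stage \<open>n\<close> on; any stage containing the point could be used.\<close>

definition extension where "extension w t y = skeletal_extension (LEAST n. y \<in> Sk n) w t y"

lemma extension_eq_skeletal:
  assumes "y \<in> Sk n"
  shows "extension w t y = skeletal_extension n w t y"
  unfolding extension_def using assms skeletal_extension_stable[of "LEAST n. y \<in> Sk n" n y w t]
  by (metis LeastI Least_le)

lemma extension_data: "\<bar>t\<bar> = 1 \<Longrightarrow> extension w t y = \<Phi>0 w t y"
  unfolding extension_def by (rule f_data[OF skeletal_extension_partial])

lemma extension_equivariant:
  assumes "w \<in> topspace W" "\<bar>t\<bar> \<le> \<delta>" "\<gamma> \<in> carrier A" "y \<in> topspace Y"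
  shows "extension w t (\<theta> (\<pi> \<gamma>) y) = \<xi> \<gamma> (extension w t y)"
proof -
  obtain n where n: "y \<in> Sk n" using assms(4) Sk_UN by auto
  have n': "\<theta> (\<pi> \<gamma>) y \<in> Sk n" by (rule Sk_invariant[OF \<pi>_closed[OF assms(3)] n])
  show ?thesis unfolding extension_eq_skeletal[OF n] extension_eq_skeletal[OF n']
    by (rule f_equivariant[OF skeletal_extension_partial]) (use assms n in auto)
qed

lemma extension_cellwise:
  assumes ac: "a \<in> I n" "c \<in> C n a"
  shows "continuous_map (prod_topology (prod_topology W J) (disk n)) X
    (\<lambda>(p, x). extension (fst p) (snd p) (q n a (c, x)))"
proof -
  have "continuous_map (prod_topology (prod_topology W J) (disk n)) X
    (\<lambda>(p, x). skeletal_extension (Suc n) (fst p) (snd p) (q n a (c, x)))"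
    using skeletal_extension_partial[of "Suc n"] ac unfolding partial_extension_def by blast
  then show ?thesis
  proof (rule continuous_map_eq)
    fix p assume "p \<in> topspace (prod_topology (prod_topology W J) (disk n))"
    then have "q n a (c, snd p) \<in> Sk (Suc n)" using q_in_Sk[OF ac] by auto
    then show "(case p of (p, x) \<Rightarrow> skeletal_extension (Suc n) (fst p) (snd p) (q n a (c, x))) =
        (case p of (p, x) \<Rightarrow> extension (fst p) (snd p) (q n a (c, x)))"
      using extension_eq_skeletal by (simp add: case_prod_unfold)
  qed
qed

lemma extension_continuous_on_compact:
  assumes "compactin Y D"
  shows "continuous_map (prod_topology (prod_topology W J) (subtopology Y D)) X
    (\<lambda>(p, y). extension (fst p) (snd p) y)"
  by (rule cellwise_continuous_on_compact[OF assms extension_cellwise])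

lemma extension_continuous:
  assumes "w \<in> topspace W" "\<bar>t\<bar> \<le> \<delta>"
  shows "continuous_map Y X (extension w t)"
proof (rule cellwise_continuous_imp_continuous)
  fix n a c assume ac: "a \<in> I n" "c \<in> C n a"
  have "continuous_map (disk n) (prod_topology W J) (\<lambda>x. (w, t))" using assms by auto
  from continuous_map_binop[OF extension_cellwise[OF ac] this continuous_map_id[unfolded id_def]]
  show "continuous_map (disk n) X (\<lambda>x. extension w t (q n a (c, x)))" by simp
qed

end

section \<open>Contractibility of spaces of equivariant maps\<close>

definition equivariant_maps ::
  "('h, 'c) monoid_scheme \<Rightarrow> ('h \<Rightarrow> 'g) \<Rightarrow> 'e topology \<Rightarrow> ('g \<Rightarrow> 'e \<Rightarrow> 'e) \<Rightarrow> 'x topology \<Rightarrow> ('h \<Rightarrow> 'x \<Rightarrow> 'x) \<Rightarrow> ('e \<Rightarrow> 'x) topology" where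
  "equivariant_maps A \<pi> E \<phi> X \<xi> = subtopology (map_space E X)
     {f. \<forall>\<gamma>\<in>carrier A. \<forall>e\<in>topspace E. f (\<phi> (\<pi> \<gamma>) e) = \<xi> \<gamma> (f e)}"

lemma homotopic_with_TrueI:
  assumes "continuous_map (prod_topology (top_of_set {0..1 :: real}) X) Y h"
    and "\<And>x. x \<in> topspace X \<Longrightarrow> h (0, x) = p x" "\<And>x. x \<in> topspace X \<Longrightarrow> h (1, x) = p' x"
  shows "homotopic_with (\<lambda>_. True) X Y p p'"
  using assms by (subst homotopic_with) auto

text \<open>Let \<open>u : E \<rightarrow> Y\<close> and \<open>v : Y \<rightarrow> E\<close> be the given equivariant homotopy equivalences.  The extension
theorem without boundary values produces one equivariant map \<open>f0 : Y \<rightarrow> X\<close>.  Applied with the space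
of all equivariant maps \<open>f : E \<rightarrow> X\<close> as the space of parameters, it produces homotopies
from \<open>f0\<close> to \<open>f \<circ> v\<close> depending continuously on \<open>f\<close>.  Composing with \<open>u\<close> and using the homotopy
\<open>v \<circ> u \<simeq> id\<close>, one obtains \<open>f0 \<circ> u \<simeq> f \<circ> v \<circ> u \<simeq> f\<close>, continuously in \<open>f\<close>.\<close>

lemma equivariant_maps_contractible:
  fixes A :: "('h, 'c) monoid_scheme" and G :: "('g, 'b) monoid_scheme"
    and X :: "'x topology" and E :: "'e topology" and Y :: "'y topology"
  assumes G: "group G" and A: "group A" and \<pi>: "\<pi> \<in> hom A G"
    and E: "G_space G E \<phi>" "Hausdorff_space E"
    and Y: "G_CW_complex G Y \<theta>" and EY: "G_homotopy_equivalent G E \<phi> Y \<theta>"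
    and X: "G_space A X \<xi>"
    and fixed: "\<And>\<Lambda> e. \<lbrakk>subgroup \<Lambda> A; e \<in> topspace E; \<forall>\<gamma>\<in>\<Lambda>. \<phi> (\<pi> \<gamma>) e = e\<rbrakk> \<Longrightarrow>
      topspace (fixed_space X \<xi> \<Lambda>) \<noteq> {} \<and> contractible_space (fixed_space X \<xi> \<Lambda>)"
  shows "topspace (equivariant_maps A \<pi> E \<phi> X \<xi>) \<noteq> {}"
    and "contractible_space (equivariant_maps A \<pi> E \<phi> X \<xi>)"
proof -
  let ?M = "equivariant_maps A \<pi> E \<phi> X \<xi>"
  obtain Sk I K q where cw: "G_CW G Y \<theta> Sk I K q"
    using G_CW_complex_imp_G_CW[OF G Y] by blast
  interpret G_CW G Y \<theta> Sk I K q by (rule cw)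
  interpret A: group A by (rule A)
  interpret E: group_action G "topspace E" \<phi> using E(1) by (simp add: G_space_def)
  interpret X: group_action A "topspace X" \<xi> using X by (simp add: G_space_def)
  obtain u v h where u: "continuous_map E Y u" "equivariant G E \<phi> \<theta> u"
    and v: "continuous_map Y E v" "equivariant G Y \<theta> \<phi> v"
    and h: "continuous_map (prod_topology (top_of_set {0..1 :: real}) E) E h"
      "\<forall>e. h (0, e) = v (u e)" "\<forall>e. h (1, e) = e" "\<forall>t\<in>{0..1}. equivariant G E \<phi> \<phi> (\<lambda>e. h (t, e))"
    using EY unfolding G_homotopy_equivalent_def homotopic_with_def by (auto simp: comp_def)
  have \<pi>_closed: "\<pi> \<gamma> \<in> carrier G" if "\<gamma> \<in> carrier A" for \<gamma>
    using \<pi> that by (auto simp: hom_def)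
  have uE: "u e \<in> topspace Y" if "e \<in> topspace E" for e
    using u(1) that by (auto simp: continuous_map_def)
  have vY: "v y \<in> topspace E" if "y \<in> topspace Y" for y
    using v(1) that by (auto simp: continuous_map_def)
  have hE: "h (t, e) \<in> topspace E" if "t \<in> {0..1}" "e \<in> topspace E" for t e
    using continuous_map_image_subset_topspace[OF h(1)] that by auto
  have u_eq: "u (\<phi> (\<pi> \<gamma>) e) = \<theta> (\<pi> \<gamma>) (u e)" if "\<gamma> \<in> carrier A" "e \<in> topspace E" for \<gamma> e
    using u(2) \<pi>_closed that by (simp add: equivariant_def)
  have v_eq: "v (\<theta> (\<pi> \<gamma>) y) = \<phi> (\<pi> \<gamma>) (v y)" if "\<gamma> \<in> carrier A" "y \<in> topspace Y" for \<gamma> y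
    using v(2) \<pi>_closed that by (simp add: equivariant_def)
  have h_eq: "h (t, \<phi> (\<pi> \<gamma>) e) = \<phi> (\<pi> \<gamma>) (h (t, e))"
    if "\<gamma> \<in> carrier A" "e \<in> topspace E" "t \<in> {0..1}" for \<gamma> e t
    using h(4) \<pi>_closed that by (simp add: equivariant_def)
  have fixed_Y: "topspace (fixed_space X \<xi> \<Lambda>) \<noteq> {} \<and> contractible_space (fixed_space X \<xi> \<Lambda>)"
    if "subgroup \<Lambda> A" "y \<in> topspace Y" "\<forall>\<gamma>\<in>\<Lambda>. \<theta> (\<pi> \<gamma>) y = y" for \<Lambda> y
  proof (rule fixed[OF that(1) vY[OF that(2)]], intro ballI)
    fix \<gamma> assume "\<gamma> \<in> \<Lambda>"
    then show "\<phi> (\<pi> \<gamma>) (v y) = v y"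
      using v_eq[of \<gamma> y] that subgroup.mem_carrier by fastforce
  qed
  have M_I: "(\<lambda>e\<in>topspace E. f e) \<in> topspace ?M"
    if "continuous_map E X f" "\<And>\<gamma> e. \<lbrakk>\<gamma> \<in> carrier A; e \<in> topspace E\<rbrakk> \<Longrightarrow> f (\<phi> (\<pi> \<gamma>) e) = \<xi> \<gamma> (f e)" for f
    using continuous_map_restrict[OF that(1)] that(2) E.element_image[OF \<pi>_closed]
    by (simp add: equivariant_maps_def)
  have M_D: "f \<in> extensional (topspace E)" "continuous_map E X f"
    "\<And>\<gamma> e. \<lbrakk>\<gamma> \<in> carrier A; e \<in> topspace E\<rbrakk> \<Longrightarrow> f (\<phi> (\<pi> \<gamma>) e) = \<xi> \<gamma> (f e)" if "f \<in> topspace ?M" for f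
    using that by (auto simp: equivariant_maps_def topspace_map_space)
  have into_M: "continuous_map Z ?M (\<lambda>z. \<lambda>e\<in>topspace E. F z e)"
    if "continuous_map Z (map_space E X) (\<lambda>z. \<lambda>e\<in>topspace E. F z e)"
      "\<And>z \<gamma> e. \<lbrakk>z \<in> topspace Z; \<gamma> \<in> carrier A; e \<in> topspace E\<rbrakk> \<Longrightarrow> F z (\<phi> (\<pi> \<gamma>) e) = \<xi> \<gamma> (F z e)"
    for Z :: "(real \<times> ('e \<Rightarrow> 'x)) topology" and F
    unfolding equivariant_maps_def
    using that E.element_image[OF \<pi>_closed] by (intro continuous_map_into_subtopology) auto

  \<comment> \<open>A one-point parameter space and \<open>\<delta> = 0\<close>: no values are prescribed.\<close>
  interpret base: equivariant_extension G Y \<theta> Sk I K q A \<pi> X \<xi> "discrete_topology {()}" 0 "\<lambda>_ _. undefined"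
    by unfold_locales (use \<pi> X fixed_Y in auto)
  define f0 where "f0 = base.extension () 0"
  have f0: "continuous_map Y X f0" unfolding f0_def by (rule base.extension_continuous) auto
  have f0_eq: "f0 (\<theta> (\<pi> \<gamma>) y) = \<xi> \<gamma> (f0 y)" if "\<gamma> \<in> carrier A" "y \<in> topspace Y" for \<gamma> y
    unfolding f0_def using that by (intro base.extension_equivariant) auto
  define g0 where "g0 = (\<lambda>e\<in>topspace E. f0 (u e))"
  have g0: "g0 \<in> topspace ?M"
    unfolding g0_def using continuous_map_compose[OF u(1) f0] u_eq f0_eq uE
    by (intro M_I) (auto simp: comp_def)
  then show "topspace ?M \<noteq> {}" by blast

  \<comment> \<open>The lid \<open>t = 1\<close> carries \<open>f \<circ> v\<close>, the lid \<open>t = -1\<close> the constant family \<open>f0\<close>.\<close>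
  define \<Phi>0 where "\<Phi>0 = (\<lambda>f (t::real) y. if t = 1 then f (v y) else f0 y)"
  interpret ext: equivariant_extension G Y \<theta> Sk I K q A \<pi> X \<xi> ?M 1 \<Phi>0
  proof unfold_locales
    show "\<pi> \<in> hom A G" "G_space A X \<xi>" "(1::real) \<in> {0, 1}" using \<pi> X by auto
    show "topspace (fixed_space X \<xi> \<Lambda>) \<noteq> {} \<and> contractible_space (fixed_space X \<xi> \<Lambda>)"
      if "subgroup \<Lambda> A" "y \<in> topspace Y" "\<forall>\<gamma>\<in>\<Lambda>. \<theta> (\<pi> \<gamma>) y = y" for \<Lambda> y
      by (rule fixed_Y[OF that])
    show "\<Phi>0 w t (\<theta> (\<pi> \<gamma>) y) = \<xi> \<gamma> (\<Phi>0 w t y)"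
      if "w \<in> topspace ?M" "\<gamma> \<in> carrier A" "y \<in> topspace Y" for w t \<gamma> y
      using that f0_eq v_eq vY M_D(3) by (simp add: \<Phi>0_def)
    fix t :: real and a n c assume ac: "a \<in> I n" "c \<in> left_cosets G (K n a)"
    note q = q_continuous_Y[OF ac]
    show "continuous_map (prod_topology ?M (disk n)) X (\<lambda>(w, x). \<Phi>0 w t (q n a (c, x)))"
    proof (cases "t = 1")
      case True
      have "continuous_map (prod_topology (map_space E X) (disk n)) X (\<lambda>(f, x). f (v (q n a (c, x))))"
        using map_space_eval[OF compact_disk Hausdorff_disk continuous_map_compose[OF q v(1)]]
        by (simp add: comp_def)
      then have "continuous_map (prod_topology ?M (disk n)) X (\<lambda>(f, x). f (v (q n a (c, x))))"
        unfolding equivariant_maps_def prod_topology_subtopology(1) by (rule continuous_map_from_subtopology)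
      then show ?thesis using True by (simp add: \<Phi>0_def)
    next
      case False
      have "continuous_map (prod_topology ?M (disk n)) X (\<lambda>p. f0 (q n a (c, snd p)))"
        using continuous_map_compose[OF continuous_map_snd continuous_map_compose[OF q f0]]
        by (simp add: comp_def)
      then show ?thesis using False by (simp add: \<Phi>0_def case_prod_unfold)
    qed
  qed

  have "\<Phi>0 f 1 y = f (v y)" "\<Phi>0 f (-1) y = f0 y" for f y by (simp_all add: \<Phi>0_def)
  then have ends: "ext.extension f 1 y = f (v y)" "ext.extension f (-1) y = f0 y" for f y
    by (simp_all add: ext.extension_data)
  let ?I = "top_of_set {0..1 :: real}"
  let ?IM = "prod_topology ?I ?M"
  have hom1: "homotopic_with (\<lambda>_. True) ?M ?M (\<lambda>_. g0) (\<lambda>f. \<lambda>e\<in>topspace E. f (v (u e)))"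
  proof (rule homotopic_with_TrueI)
    show "continuous_map ?IM ?M (\<lambda>p. \<lambda>e\<in>topspace E. ext.extension (snd p) (2 * fst p - 1) (u e))"
    proof (rule into_M[OF map_space_restrictI])
      fix p assume "p \<in> topspace ?IM"
      then have "continuous_map Y X (ext.extension (snd p) (2 * fst p - 1))"
        by (intro ext.extension_continuous) auto
      from continuous_map_compose[OF u(1) this]
      show "continuous_map E X (\<lambda>e. ext.extension (snd p) (2 * fst p - 1) (u e))" by (simp add: comp_def)
    next
      fix C assume C: "compactin E C"
      let ?P = "prod_topology ?IM (subtopology E C)"
      have D: "compactin Y (u ` C)" by (rule image_compactin[OF C u(1)])
      have s: "continuous_map ?P ?M (\<lambda>z. snd (fst z))"
        by (rule continuous_map_compose[OF continuous_map_fst continuous_map_snd, unfolded comp_def])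
      have "continuous_map ?P ?I (\<lambda>z. fst (fst z))"
        by (rule continuous_map_compose[OF continuous_map_fst continuous_map_fst, unfolded comp_def])
      then have t: "continuous_map ?P (top_of_set {-1..1}) (\<lambda>z. 2 * fst (fst z) - 1)"
        unfolding continuous_map_in_subtopology by (auto intro!: continuous_map_diff continuous_map_real_mult_left)
      have "continuous_map (subtopology E C) (subtopology Y (u ` C)) u"
        using u(1) compactin_subset_topspace[OF C]
        by (intro continuous_map_into_subtopology continuous_map_from_subtopology) auto
      from continuous_map_compose[OF continuous_map_snd this]
      have e: "continuous_map ?P (subtopology Y (u ` C)) (\<lambda>z. u (snd z))" by (simp add: comp_def)
      have "continuous_map ?P X (\<lambda>z. ext.extension (fst (snd (fst z), 2 * fst (fst z) - 1)) (snd (snd (fst z), 2 * fst (fst z) - 1)) (u (snd z)))"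
        by (rule continuous_map_binop[OF ext.extension_continuous_on_compact[OF D] continuous_map_pairedI[OF s t] e])
      then show "continuous_map ?P X (\<lambda>(p, e). ext.extension (snd p) (2 * fst p - 1) (u e))"
        by (simp add: case_prod_unfold)
    next
      fix p \<gamma> e assume p: "p \<in> topspace ?IM" "\<gamma> \<in> carrier A" "e \<in> topspace E"
      then have "\<bar>2 * fst p - 1\<bar> \<le> 1" by (auto simp: mem_Times_iff)
      with p show "ext.extension (snd p) (2 * fst p - 1) (u (\<phi> (\<pi> \<gamma>) e)) = \<xi> \<gamma> (ext.extension (snd p) (2 * fst p - 1) (u e))"
        using u_eq uE by (simp add: ext.extension_equivariant mem_Times_iff)
    qed
  qed (simp_all add: g0_def ends)
  have hom2: "homotopic_with (\<lambda>_. True) ?M ?M (\<lambda>f. \<lambda>e\<in>topspace E. f (v (u e))) id"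
  proof (rule homotopic_with_TrueI)
    show "continuous_map ?IM ?M (\<lambda>p. \<lambda>e\<in>topspace E. snd p (h (fst p, e)))"
    proof (rule into_M[OF map_space_restrictI])
      fix p assume p: "p \<in> topspace ?IM"
      have "continuous_map E (prod_topology ?I E) (\<lambda>e. (fst p, e))"
        using p by (intro continuous_map_pairedI) auto
      from continuous_map_compose[OF continuous_map_compose[OF this h(1)] M_D(2)[of "snd p"]]
      show "continuous_map E X (\<lambda>e. snd p (h (fst p, e)))" using p by (auto simp: comp_def)
    next
      fix C assume C: "compactin E C"
      let ?P = "prod_topology ?IM (subtopology E C)"
      let ?S = "prod_topology ?I (subtopology E C)"
      have S: "compact_space ?S" "Hausdorff_space ?S"
        unfolding compact_space_prod_topology Hausdorff_space_prod_topology
        using C E(2) by (auto simp: compact_space_subtopology Hausdorff_space_subtopology)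
      have "continuous_map ?S E h"
        using h(1) unfolding prod_topology_subtopology(2)[of ?I E C] by (rule continuous_map_from_subtopology)
      note ev = map_space_eval[OF S this, of X]
      have "continuous_map ?P ?M (\<lambda>z. snd (fst z))"
        by (rule continuous_map_compose[OF continuous_map_fst continuous_map_snd, unfolded comp_def])
      then have s: "continuous_map ?P (map_space E X) (\<lambda>z. snd (fst z))"
        unfolding equivariant_maps_def by (rule continuous_map_into_fulltopology)
      have t: "continuous_map ?P ?I (\<lambda>z. fst (fst z))"
        by (rule continuous_map_compose[OF continuous_map_fst continuous_map_fst, unfolded comp_def])
      have "continuous_map ?P X (\<lambda>z. (snd (fst z)) (h (fst (fst z), snd z)))"
        by (rule continuous_map_binop[OF ev s continuous_map_pairedI[OF t continuous_map_snd]])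
      then show "continuous_map ?P X (\<lambda>(p, e). snd p (h (fst p, e)))" by (simp add: case_prod_unfold)
    next
      fix p \<gamma> e assume "p \<in> topspace ?IM" "\<gamma> \<in> carrier A" "e \<in> topspace E"
      then show "snd p (h (fst p, \<phi> (\<pi> \<gamma>) e)) = \<xi> \<gamma> (snd p (h (fst p, e)))"
        using h_eq hE M_D(3) by (auto simp: mem_Times_iff)
    qed
  next
    fix f assume "f \<in> topspace ?M"
    then show "(\<lambda>e\<in>topspace E. snd (1, f) (h (fst (1, f), e))) = id f"
      using h(3) M_D(1) by (auto simp: extensional_restrict)
  qed (use h(2) in auto)
  show "contractible_space ?M"
    unfolding contractible_space_def
    by (rule exI[of _ g0], rule homotopic_with_symD[OF homotopic_with_trans[OF hom1 hom2]])
qed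

section \<open>The conjugation action on a mapping space\<close>

lemma group_actionI:
  assumes A: "group A"
    and ext: "\<And>a. a \<in> carrier A \<Longrightarrow> f a \<in> extensional E"
    and closed: "\<And>a x. \<lbrakk>a \<in> carrier A; x \<in> E\<rbrakk> \<Longrightarrow> f a x \<in> E"
    and one: "\<And>x. x \<in> E \<Longrightarrow> f \<one>\<^bsub>A\<^esub> x = x"
    and mult: "\<And>a b x. \<lbrakk>a \<in> carrier A; b \<in> carrier A; x \<in> E\<rbrakk> \<Longrightarrow> f (a \<otimes>\<^bsub>A\<^esub> b) x = f a (f b x)"
  shows "group_action A E f"
proof -
  interpret A: group A by (rule A)
  have Bij: "f a \<in> Bij E" if a: "a \<in> carrier A" for a
  proof -
    have "bij_betw (f a) E E"
      by (rule bij_betw_byWitness[where f' = "f (inv\<^bsub>A\<^esub> a)"])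
        (use a closed one mult[of a "inv\<^bsub>A\<^esub> a"] mult[of "inv\<^bsub>A\<^esub> a" a] in auto)
    then show ?thesis using ext[OF a] by (simp add: Bij_def)
  qed
  have "f (a \<otimes>\<^bsub>A\<^esub> b) = f a \<otimes>\<^bsub>BijGroup E\<^esub> f b" if a: "a \<in> carrier A" and b: "b \<in> carrier A" for a b
  proof -
    have "f (a \<otimes>\<^bsub>A\<^esub> b) = compose E (f a) (f b)"
      by (rule extensionalityI[of _ E]) (use a b ext mult in \<open>auto simp: compose_def\<close>)
    then show ?thesis using Bij a b by (simp add: BijGroup_def)
  qed
  then have "f \<in> hom A (BijGroup E)" using Bij by (auto simp: hom_def BijGroup_def)
  then show ?thesis
    by (intro group_action.intro group_hom.intro group_hom_axioms.intro A group_BijGroup)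
qed

text \<open>The usual conjugation action on maps.  For \<open>A = G \<times> \<Sigma>\<^sub>n\<close> and the first projection \<open>\<pi>\<close> this is
the action on the \<open>n\<close>-th level of the mapping operad.\<close>

definition conj_map_action ::
  "('g, 'b) monoid_scheme \<Rightarrow> ('h \<Rightarrow> 'g) \<Rightarrow> 'e topology \<Rightarrow> ('g \<Rightarrow> 'e \<Rightarrow> 'e) \<Rightarrow> 'x topology \<Rightarrow> ('h \<Rightarrow> 'x \<Rightarrow> 'x) \<Rightarrow>
    'h \<Rightarrow> ('e \<Rightarrow> 'x) \<Rightarrow> 'e \<Rightarrow> 'x" where
  "conj_map_action G \<pi> E \<phi> X \<xi> \<gamma> =
     (\<lambda>f\<in>topspace (map_space E X). \<lambda>e\<in>topspace E. \<xi> \<gamma> (f (\<phi> (inv\<^bsub>G\<^esub> (\<pi> \<gamma>)) e)))"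

lemma conj_map_action_G_space:
  assumes G: "group G" and A: "group A" and \<pi>: "\<pi> \<in> hom A G"
    and E: "G_space G E \<phi>" "Hausdorff_space E" and X: "G_space A X \<xi>"
  shows "G_space A (map_space E X) (conj_map_action G \<pi> E \<phi> X \<xi>)"
proof -
  interpret G: group G by (rule G)
  interpret A: group A by (rule A)
  interpret E: group_action G "topspace E" \<phi> using E(1) by (simp add: G_space_def)
  interpret X: group_action A "topspace X" \<xi> using X by (simp add: G_space_def)
  interpret \<pi>: group_hom A G \<pi> using \<pi> by unfold_locales
  let ?\<psi> = "conj_map_action G \<pi> E \<phi> X \<xi>"
  let ?M = "map_space E X"
  have c\<phi>: "continuous_map E E (\<phi> (inv\<^bsub>G\<^esub> (\<pi> \<gamma>)))" and c\<xi>: "continuous_map X X (\<xi> \<gamma>)" if "\<gamma> \<in> carrier A" for \<gamma>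
    using E(1) X that by (auto simp: G_space_def)
  have cont: "continuous_map E X (\<lambda>e. \<xi> \<gamma> (f (\<phi> (inv\<^bsub>G\<^esub> (\<pi> \<gamma>)) e)))"
    if "\<gamma> \<in> carrier A" "f \<in> topspace ?M" for \<gamma> f
    using continuous_map_compose[OF continuous_map_compose[OF c\<phi>[OF that(1)], of X f] c\<xi>[OF that(1)]] that(2)
    by (simp add: comp_def topspace_map_space)
  have \<psi>: "?\<psi> \<gamma> f = (\<lambda>e\<in>topspace E. \<xi> \<gamma> (f (\<phi> (inv\<^bsub>G\<^esub> (\<pi> \<gamma>)) e)))" if "f \<in> topspace ?M" for \<gamma> f
    using that by (simp add: conj_map_action_def)
  have closed: "?\<psi> \<gamma> f \<in> topspace ?M" if "\<gamma> \<in> carrier A" "f \<in> topspace ?M" for \<gamma> f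
    unfolding \<psi>[OF that(2)] by (rule continuous_map_restrict[OF cont[OF that]])
  have val: "f e \<in> topspace X" if "f \<in> topspace ?M" "e \<in> topspace E" for f e
    using that by (auto simp: topspace_map_space continuous_map_def)
  have ext: "f \<in> extensional (topspace E)" if "f \<in> topspace ?M" for f
    using that by (simp add: topspace_map_space)
  have "group_action A (topspace ?M) ?\<psi>"
  proof (rule group_actionI[OF A _ closed])
    show "?\<psi> \<gamma> \<in> extensional (topspace ?M)" for \<gamma> by (simp add: conj_map_action_def)
    show "?\<psi> \<one>\<^bsub>A\<^esub> f = f" if f: "f \<in> topspace ?M" for f
    proof (rule extensionalityI[of _ "topspace E"])
      fix e assume e: "e \<in> topspace E"
      have "\<phi> \<one>\<^bsub>G\<^esub> e = e" by (metis E.id_eq_one e restrict_apply')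
      moreover have "\<xi> \<one>\<^bsub>A\<^esub> (f e) = f e" by (metis X.id_eq_one val[OF f e] restrict_apply')
      ultimately show "?\<psi> \<one>\<^bsub>A\<^esub> f e = f e" using e by (simp add: \<psi>[OF f])
    qed (use ext[OF f] \<psi>[OF f] in simp_all)
    show "?\<psi> (\<gamma> \<otimes>\<^bsub>A\<^esub> \<gamma>') f = ?\<psi> \<gamma> (?\<psi> \<gamma>' f)"
      if \<gamma>: "\<gamma> \<in> carrier A" "\<gamma>' \<in> carrier A" and f: "f \<in> topspace ?M" for \<gamma> \<gamma>' f
    proof (rule extensionalityI[of _ "topspace E"])
      fix e assume e: "e \<in> topspace E"
      have e1: "\<phi> (inv\<^bsub>G\<^esub> (\<pi> \<gamma>)) e \<in> topspace E" using e \<gamma> by (intro E.element_image[OF _ e refl]) simp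
      have e2: "\<phi> (inv\<^bsub>G\<^esub> (\<pi> \<gamma>')) (\<phi> (inv\<^bsub>G\<^esub> (\<pi> \<gamma>)) e) \<in> topspace E"
        using \<gamma> by (intro E.element_image[OF _ e1 refl]) simp
      have "\<phi> (inv\<^bsub>G\<^esub> (\<pi> (\<gamma> \<otimes>\<^bsub>A\<^esub> \<gamma>'))) e = \<phi> (inv\<^bsub>G\<^esub> (\<pi> \<gamma>')) (\<phi> (inv\<^bsub>G\<^esub> (\<pi> \<gamma>)) e)"
        using \<gamma> e by (simp add: G.inv_mult_group E.composition_rule)
      then have "?\<psi> (\<gamma> \<otimes>\<^bsub>A\<^esub> \<gamma>') f e =
          \<xi> \<gamma> (\<xi> \<gamma>' (f (\<phi> (inv\<^bsub>G\<^esub> (\<pi> \<gamma>')) (\<phi> (inv\<^bsub>G\<^esub> (\<pi> \<gamma>)) e))))"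
        using e \<gamma> val[OF f e2] by (simp add: \<psi>[OF f] X.composition_rule)
      also have "\<dots> = \<xi> \<gamma> (?\<psi> \<gamma>' f (\<phi> (inv\<^bsub>G\<^esub> (\<pi> \<gamma>)) e))"
        using e1 by (simp add: \<psi>[OF f])
      also have "\<dots> = ?\<psi> \<gamma> (?\<psi> \<gamma>' f) e"
        unfolding \<psi>[OF closed[OF \<gamma>(2) f]] using e by simp
      finally show "?\<psi> (\<gamma> \<otimes>\<^bsub>A\<^esub> \<gamma>') f e = ?\<psi> \<gamma> (?\<psi> \<gamma>' f) e" .
    qed (use \<psi>[OF f] \<psi>[OF closed[OF \<gamma>(2) f]] in simp_all)
  qed
  moreover have "continuous_map ?M ?M (?\<psi> \<gamma>)" if \<gamma>: "\<gamma> \<in> carrier A" for \<gamma>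
  proof -
    have "continuous_map ?M ?M (\<lambda>f. \<lambda>e\<in>topspace E. \<xi> \<gamma> (f (\<phi> (inv\<^bsub>G\<^esub> (\<pi> \<gamma>)) e)))"
    proof (rule map_space_restrictI[OF cont[OF \<gamma>]])
      fix C assume C: "compactin E C"
      have "continuous_map (prod_topology ?M (subtopology E C)) X (\<lambda>(f, e). f (\<phi> (inv\<^bsub>G\<^esub> (\<pi> \<gamma>)) e))"
        using C E(2) by (intro map_space_eval continuous_map_from_subtopology[OF c\<phi>[OF \<gamma>]])
          (auto simp: compact_space_subtopology Hausdorff_space_subtopology)
      from continuous_map_compose[OF this c\<xi>[OF \<gamma>]]
      show "continuous_map (prod_topology ?M (subtopology E C)) X (\<lambda>(f, e). \<xi> \<gamma> (f (\<phi> (inv\<^bsub>G\<^esub> (\<pi> \<gamma>)) e)))"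
        by (simp add: comp_def case_prod_unfold)
    qed
    then show ?thesis by (rule continuous_map_eq) (simp add: \<psi>)
  qed
  ultimately show ?thesis by (simp add: G_space_def)
qed

text \<open>Substituting \<open>\<gamma>e\<close> for \<open>e\<close> turns \<open>\<gamma>f = f\<close> into equivariance, \<open>f(\<gamma>e) = \<gamma>f(e)\<close>.\<close>

lemma fixed_space_conj_map_action:
  assumes G: "group G" and A: "group A" and \<pi>: "\<pi> \<in> hom A G"
    and E: "G_space G E \<phi>" and X: "G_space A X \<xi>" and \<Lambda>: "subgroup \<Lambda> A"
  shows "fixed_space (map_space E X) (conj_map_action G \<pi> E \<phi> X \<xi>) \<Lambda> =
    equivariant_maps (A\<lparr>carrier := \<Lambda>\<rparr>) \<pi> E \<phi> X \<xi>"
proof -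
  interpret G: group G by (rule G)
  interpret A: group A by (rule A)
  interpret E: group_action G "topspace E" \<phi> using E(1) by (simp add: G_space_def)
  interpret X: group_action A "topspace X" \<xi> using X by (simp add: G_space_def)
  interpret \<pi>: group_hom A G \<pi> using \<pi> by unfold_locales
  interpret \<Lambda>: subgroup \<Lambda> A by (rule \<Lambda>)
  have "(\<forall>\<gamma>\<in>\<Lambda>. conj_map_action G \<pi> E \<phi> X \<xi> \<gamma> f = f) \<longleftrightarrow>
      (\<forall>\<gamma>\<in>\<Lambda>. \<forall>e\<in>topspace E. f (\<phi> (\<pi> \<gamma>) e) = \<xi> \<gamma> (f e))" (is "?l \<longleftrightarrow> ?r")
    if f: "f \<in> topspace (map_space E X)" for f
  proof -
    have \<psi>: "conj_map_action G \<pi> E \<phi> X \<xi> \<gamma> f = (\<lambda>e\<in>topspace E. \<xi> \<gamma> (f (\<phi> (inv\<^bsub>G\<^esub> (\<pi> \<gamma>)) e)))" for \<gamma>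
      using f by (simp add: conj_map_action_def)
    have ext: "f \<in> extensional (topspace E)" using f by (simp add: topspace_map_space)
    have canc: "\<phi> (inv\<^bsub>G\<^esub> g) (\<phi> g e) = e" "\<phi> g (\<phi> (inv\<^bsub>G\<^esub> g) e) = e" if "g \<in> carrier G" "e \<in> topspace E" for g e
    proof -
      have "\<phi> \<one>\<^bsub>G\<^esub> e = e" by (metis E.id_eq_one that(2) restrict_apply')
      then show "\<phi> (inv\<^bsub>G\<^esub> g) (\<phi> g e) = e" "\<phi> g (\<phi> (inv\<^bsub>G\<^esub> g) e) = e"
        using that by (simp_all flip: E.composition_rule)
    qed
    show ?thesis
    proof
      assume l: ?l
      show ?r
      proof (intro ballI)
        fix \<gamma> e assume \<gamma>: "\<gamma> \<in> \<Lambda>" and e: "e \<in> topspace E"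
        have \<phi>e: "\<phi> (\<pi> \<gamma>) e \<in> topspace E" using \<gamma> by (intro E.element_image[OF _ e refl]) simp
        have "f (\<phi> (\<pi> \<gamma>) e) = conj_map_action G \<pi> E \<phi> X \<xi> \<gamma> f (\<phi> (\<pi> \<gamma>) e)" using l \<gamma> by simp
        also have "\<dots> = \<xi> \<gamma> (f e)" using \<phi>e e \<gamma> canc by (simp add: \<psi>)
        finally show "f (\<phi> (\<pi> \<gamma>) e) = \<xi> \<gamma> (f e)" .
      qed
    next
      assume r: ?r
      show ?l
      proof (intro ballI)
        fix \<gamma> assume \<gamma>: "\<gamma> \<in> \<Lambda>"
        show "conj_map_action G \<pi> E \<phi> X \<xi> \<gamma> f = f"
        proof (rule extensionalityI[of _ "topspace E"])
          fix e assume e: "e \<in> topspace E"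
          have e': "\<phi> (inv\<^bsub>G\<^esub> (\<pi> \<gamma>)) e \<in> topspace E" using \<gamma> by (intro E.element_image[OF _ e refl]) simp
          have "\<xi> \<gamma> (f (\<phi> (inv\<^bsub>G\<^esub> (\<pi> \<gamma>)) e)) = f (\<phi> (\<pi> \<gamma>) (\<phi> (inv\<^bsub>G\<^esub> (\<pi> \<gamma>)) e))" using r \<gamma> e' by simp
          then show "conj_map_action G \<pi> E \<phi> X \<xi> \<gamma> f e = f e" using canc e \<gamma> by (simp add: \<psi>)
        qed (use ext \<psi> in simp_all)
      qed
    qed
  qed
  then have "topspace (map_space E X) \<inter> {f. \<forall>\<gamma>\<in>\<Lambda>. conj_map_action G \<pi> E \<phi> X \<xi> \<gamma> f = f} =
    topspace (map_space E X) \<inter> {f. \<forall>\<gamma>\<in>\<Lambda>. \<forall>e\<in>topspace E. f (\<phi> (\<pi> \<gamma>) e) = \<xi> \<gamma> (f e)}" by auto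
  from arg_cong[OF this, of "subtopology (map_space E X)"] show ?thesis
    unfolding fixed_space_def equivariant_maps_def by (simp add: subtopology_restrict)
qed

section \<open>The mapping operad\<close>

lemma (in group) prod_sym_group: "group (G \<times>\<times> sym_group n)"
  using DirProd_group is_group sym_group_is_group by blast

lemma (in group) prod_sym_fst_hom: "fst \<in> hom (G \<times>\<times> sym_group n) G"
  by (auto simp: hom_def)

text \<open>All operations of the mapping operad are pointwise, so each axiom is the corresponding axiom of \<open>P\<close>
evaluated at a point of \<open>E\<close>.  Apart from the action on the levels, only the continuity of composition
needs an argument about the compact-open topology; it uses that compact subsets of \<open>E\<close> are Hausdorff.\<close>

locale mapping_operad = G_operad G P
  for G :: "('g, 'b) monoid_scheme" (structure) and P :: "('g, 'x) operad" +
  fixes E :: "'e topology" and \<phi> :: "'g \<Rightarrow> 'e \<Rightarrow> 'e"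
  assumes E_space: "G_space G E \<phi>" and E_Hausdorff: "Hausdorff_space E"
begin

text \<open>The index sets \<open>{1..k}\<close> have to keep the form in which they occur in the operad axioms.\<close>

declare One_nat_def [simp del]

abbreviation "Q \<equiv> map_operad G E \<phi> P"

sublocale E: group_action G "topspace E" \<phi>
  using E_space by (simp add: G_space_def)

lemma level_Q [simp]: "level Q n = map_space E (level P n)"
  by (simp add: map_operad_def)

lemma opunit_Q [simp]: "opunit Q = (\<lambda>e\<in>topspace E. opunit P)"
  by (simp add: map_operad_def)

lemma opcomp_Q [simp]: "opcomp Q k j c d = (\<lambda>e\<in>topspace E. opcomp P k j (c e) (\<lambda>i\<in>{1..k}. d i e))"
  by (simp add: map_operad_def)

lemma opact_Q: "opact Q n = conj_map_action G fst E \<phi> (level P n) (opact P n)"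
  by (auto simp: map_operad_def conj_map_action_def fun_eq_iff restrict_def split: prod.splits)

lemma opact_Q_apply:
  "\<lbrakk>f \<in> topspace (map_space E (level P n)); e \<in> topspace E\<rbrakk> \<Longrightarrow>
   opact Q n (g, \<sigma>) f e = opact P n (g, \<sigma>) (f (\<phi> (inv g) e))"
  by (simp add: opact_Q conj_map_action_def)

lemma opact_Q_extensional:
  "f \<in> topspace (map_space E (level P n)) \<Longrightarrow> opact Q n \<gamma> f \<in> extensional (topspace E)"
  by (simp add: opact_Q conj_map_action_def)

lemma level_action: "G_space (G \<times>\<times> sym_group n) (level Q n) (opact Q n)"
  unfolding level_Q opact_Q
  by (rule conj_map_action_G_space[OF is_group prod_sym_group prod_sym_fst_hom E_space E_Hausdorff action])

lemma value_in: "\<lbrakk>f \<in> topspace (map_space E (level P n)); e \<in> topspace E\<rbrakk> \<Longrightarrow> f e \<in> topspace (level P n)"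
  by (auto simp: topspace_map_space continuous_map_def)

lemma inputs_value_in:
  assumes "d \<in> topspace (inputs Q k j)" "e \<in> topspace E"
  shows "(\<lambda>i\<in>{1..k}. d i e) \<in> topspace (inputs P k j)"
  using assms value_in by (auto simp: topspace_product_topology PiE_iff)

lemma one_act: "e \<in> topspace E \<Longrightarrow> \<phi> \<one> e = e"
  by (metis E.id_eq_one restrict_apply')

lemma Q_comp_continuous:
  assumes j: "j \<in> extensional {1..k}"
  shows "continuous_map (prod_topology (level Q k) (inputs Q k j)) (level Q (\<Sum>i\<in>{1..k}. j i))
    (\<lambda>(c, d). opcomp Q k j c d)"
proof -
  let ?W = "prod_topology (level Q k) (inputs Q k j)"
  let ?F = "\<lambda>p e. opcomp P k j (fst p e) (\<lambda>i\<in>{1..k}. snd p i e)"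
  have joint: "continuous_map Z (level P (\<Sum>i\<in>{1..k}. j i)) (\<lambda>z. ?F (w z) (g z))"
    if "continuous_map Z (level P k) (\<lambda>z. fst (w z) (g z))"
      "\<And>i. i \<in> {1..k} \<Longrightarrow> continuous_map Z (level P (j i)) (\<lambda>z. snd (w z) i (g z))"
    for Z :: "'z topology" and w :: "'z \<Rightarrow> ('e \<Rightarrow> 'x) \<times> (nat \<Rightarrow> 'e \<Rightarrow> 'x)" and g
  proof -
    have "continuous_map Z (inputs P k j) (\<lambda>z. \<lambda>i\<in>{1..k}. snd (w z) i (g z))"
      unfolding continuous_map_componentwise using that(2) by auto
    from continuous_map_binop[OF comp_continuous[OF j] that(1) this] show ?thesis .
  qed
  have "continuous_map ?W (map_space E (level P (\<Sum>i\<in>{1..k}. j i))) (\<lambda>p. \<lambda>e\<in>topspace E. ?F p e)"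
  proof (rule map_space_restrictI)
    fix p assume "p \<in> topspace ?W"
    then have "fst p \<in> topspace (map_space E (level P k))"
      "\<And>i. i \<in> {1..k} \<Longrightarrow> snd p i \<in> topspace (map_space E (level P (j i)))"
      by (auto simp: topspace_product_topology PiE_iff mem_Times_iff)
    then show "continuous_map E (level P (\<Sum>i\<in>{1..k}. j i)) (?F p)"
      by (intro joint) (auto simp: topspace_map_space)
  next
    fix C assume C: "compactin E C"
    let ?S = "subtopology E C"
    have S: "compact_space ?S" "Hausdorff_space ?S"
      using C E_Hausdorff by (auto simp: compact_space_subtopology Hausdorff_space_subtopology)
    have ev: "continuous_map (prod_topology (map_space E (level P n)) ?S) (level P n) (\<lambda>(f, e). f e)" for n
      by (rule map_space_eval[OF S]) (rule continuous_map_from_subtopology[OF continuous_map_id[unfolded id_def]])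
    let ?P = "prod_topology ?W ?S"
    have 1: "continuous_map ?P (map_space E (level P k)) (\<lambda>z. fst (fst z))"
      using continuous_map_compose[OF continuous_map_fst continuous_map_fst, of "level Q k" "inputs Q k j" ?S]
      by (simp add: comp_def)
    have snd: "continuous_map ?P (inputs Q k j) (\<lambda>z. snd (fst z))"
      using continuous_map_compose[OF continuous_map_fst continuous_map_snd, of "level Q k" "inputs Q k j" ?S]
      by (simp add: comp_def)
    have 2: "continuous_map ?P (map_space E (level P (j i))) (\<lambda>z. snd (fst z) i)" if "i \<in> {1..k}" for i
      using snd that unfolding continuous_map_componentwise by simp
    have "continuous_map ?P (level P (\<Sum>i\<in>{1..k}. j i)) (\<lambda>z. ?F (fst z) (snd z))"
      using continuous_map_binop[OF ev 1 continuous_map_snd] continuous_map_binop[OF ev 2 continuous_map_snd]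
      by (intro joint) auto
    then show "continuous_map ?P (level P (\<Sum>i\<in>{1..k}. j i)) (\<lambda>(p, e). ?F p e)"
      by (simp add: case_prod_unfold)
  qed
  then show ?thesis by (simp add: case_prod_unfold)
qed

lemma Q_comp_in:
  assumes "j \<in> extensional {1..k}" "c \<in> topspace (level Q k)" "d \<in> topspace (inputs Q k j)"
  shows "(\<lambda>e\<in>topspace E. opcomp P k j (c e) (\<lambda>i\<in>{1..k}. d i e)) \<in> topspace (map_space E (level P (\<Sum>i\<in>{1..k}. j i)))"
  using continuous_map_prod_closed[OF Q_comp_continuous[OF assms(1)] assms(2,3)] by simp

lemma G_operad_Q: "G_operad G Q"
proof (intro G_operad.intro G_operad_axioms.intro is_group)
  show "G_space (G \<times>\<times> sym_group n) (level Q n) (opact Q n)" for n by (rule level_action)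
  show "continuous_map (prod_topology (level Q k) (inputs Q k j)) (level Q (\<Sum>i\<in>{1..k}. j i))
    (\<lambda>(c, d). opcomp Q k j c d)" if "j \<in> extensional {1..k}" for j k
    by (rule Q_comp_continuous[OF that])
next
  fix j k g c d
  assume j: "j \<in> extensional {1..k}" and g: "g \<in> carrier G"
    and c: "c \<in> topspace (level Q k)" and d: "d \<in> topspace (inputs Q k j)"
  note in_Q = Q_comp_in[OF j c d]
  show "opcomp Q k j (opact Q k (g, id) c) (\<lambda>i\<in>{1..k}. opact Q (j i) (g, id) (d i)) =
      opact Q (\<Sum>i\<in>{1..k}. j i) (g, id) (opcomp Q k j c d)"
  proof (rule extensionalityI[of _ "topspace E"])
    fix e assume e: "e \<in> topspace E"
    let ?e = "\<phi> (inv g) e"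
    have e': "?e \<in> topspace E" using g by (intro E.element_image[OF _ e refl]) simp
    have d_i: "d i \<in> topspace (map_space E (level P (j i)))" if "i \<in> {1..k}" for i
      using d that by (auto simp: topspace_product_topology PiE_iff)
    have "(\<lambda>i\<in>{1..k}. (\<lambda>i\<in>{1..k}. opact Q (j i) (g, id) (d i)) i e) =
       (\<lambda>i\<in>{1..k}. opact P (j i) (g, id) ((\<lambda>i\<in>{1..k}. d i ?e) i))"
      using d_i e by (intro restrict_ext) (simp add: opact_Q_apply)
    then show "opcomp Q k j (opact Q k (g, id) c) (\<lambda>i\<in>{1..k}. opact Q (j i) (g, id) (d i)) e =
      opact Q (\<Sum>i\<in>{1..k}. j i) (g, id) (opcomp Q k j c d) e"
      using e e' c comp_G_equivariant[OF j g value_in[of c k ?e] inputs_value_in[OF d e']]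
      by (simp add: opact_Q_apply[OF in_Q e] opact_Q_apply)
  qed (use opact_Q_extensional[OF in_Q] in simp_all)
next
  fix j k c d \<sigma> \<rho>
  assume j: "j \<in> extensional {1..k}" and c: "c \<in> topspace (level Q k)" and d: "d \<in> topspace (inputs Q k j)"
    and \<sigma>: "\<sigma> permutes {1..k}" and \<rho>: "\<rho> permutes {1..\<Sum>i\<in>{1..k}. j i}"
    and slots: "\<And>i l. \<lbrakk>i \<in> {1..k}; l \<in> {1..j (\<sigma> i)}\<rbrakk> \<Longrightarrow> \<rho> (slot (j \<circ> \<sigma>) i l) = slot j (\<sigma> i) l"
  have \<sigma>_in: "\<sigma> i \<in> {1..k}" if "i \<in> {1..k}" for i using permutes_in_image[OF \<sigma>] that by blast
  have d': "(\<lambda>i\<in>{1..k}. d (\<sigma> i)) \<in> topspace (inputs Q k (\<lambda>i\<in>{1..k}. j (\<sigma> i)))"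
    using d \<sigma>_in by (auto simp: topspace_product_topology PiE_iff)
  have "(\<Sum>i\<in>{1..k}. (\<lambda>i\<in>{1..k}. j (\<sigma> i)) i) = (\<Sum>i\<in>{1..k}. j i)"
    using sum.permute[OF \<sigma>, of j] by (simp add: comp_def)
  then have in_Q: "opcomp Q k (\<lambda>i\<in>{1..k}. j (\<sigma> i)) c (\<lambda>i\<in>{1..k}. d (\<sigma> i))
      \<in> topspace (map_space E (level P (\<Sum>i\<in>{1..k}. j i)))"
    using Q_comp_in[OF restrict_extensional c d'] by (simp only: opcomp_Q)
  show "opcomp Q k j (opact Q k (\<one>, \<sigma>) c) d =
      opact Q (\<Sum>i\<in>{1..k}. j i) (\<one>, \<rho>) (opcomp Q k (\<lambda>i\<in>{1..k}. j (\<sigma> i)) c (\<lambda>i\<in>{1..k}. d (\<sigma> i)))"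
  proof (rule extensionalityI[of _ "topspace E"])
    fix e assume e: "e \<in> topspace E"
    have "(\<lambda>i\<in>{1..k}. (\<lambda>i\<in>{1..k}. d (\<sigma> i)) i e) = (\<lambda>i\<in>{1..k}. (\<lambda>i\<in>{1..k}. d i e) (\<sigma> i))"
      using \<sigma>_in by (intro restrict_ext) simp
    then show "opcomp Q k j (opact Q k (\<one>, \<sigma>) c) d e =
      opact Q (\<Sum>i\<in>{1..k}. j i) (\<one>, \<rho>) (opcomp Q k (\<lambda>i\<in>{1..k}. j (\<sigma> i)) c (\<lambda>i\<in>{1..k}. d (\<sigma> i))) e"
      using e c comp_block_perm[OF j value_in[of c k e] inputs_value_in[OF d e] \<sigma> \<rho> slots]
      by (subst opact_Q_apply[OF in_Q e]) (simp add: opact_Q_apply one_act)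
  qed (use opact_Q_extensional[OF in_Q] in simp_all)
next
  fix j k c d \<tau> \<rho>
  assume j: "j \<in> extensional {1..k}" and c: "c \<in> topspace (level Q k)" and d: "d \<in> topspace (inputs Q k j)"
    and \<tau>: "\<And>i. i \<in> {1..k} \<Longrightarrow> \<tau> i permutes {1..j i}" and \<rho>: "\<rho> permutes {1..\<Sum>i\<in>{1..k}. j i}"
    and slots: "\<And>i l. \<lbrakk>i \<in> {1..k}; l \<in> {1..j i}\<rbrakk> \<Longrightarrow> \<rho> (slot j i l) = slot j i (\<tau> i l)"
  note in_Q = Q_comp_in[OF j c d]
  show "opcomp Q k j c (\<lambda>i\<in>{1..k}. opact Q (j i) (\<one>, \<tau> i) (d i)) =
      opact Q (\<Sum>i\<in>{1..k}. j i) (\<one>, \<rho>) (opcomp Q k j c d)"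
  proof (rule extensionalityI[of _ "topspace E"])
    fix e assume e: "e \<in> topspace E"
    have d_i: "d i \<in> topspace (map_space E (level P (j i)))" if "i \<in> {1..k}" for i
      using d that by (auto simp: topspace_product_topology PiE_iff)
    have "(\<lambda>i\<in>{1..k}. (\<lambda>i\<in>{1..k}. opact Q (j i) (\<one>, \<tau> i) (d i)) i e) =
       (\<lambda>i\<in>{1..k}. opact P (j i) (\<one>, \<tau> i) ((\<lambda>i\<in>{1..k}. d i e) i))"
      using d_i e by (intro restrict_ext) (simp add: opact_Q_apply one_act)
    then show "opcomp Q k j c (\<lambda>i\<in>{1..k}. opact Q (j i) (\<one>, \<tau> i) (d i)) e =
      opact Q (\<Sum>i\<in>{1..k}. j i) (\<one>, \<rho>) (opcomp Q k j c d) e"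
      using e c comp_block_sum[OF j value_in[of c k e] inputs_value_in[OF d e] \<tau> \<rho> slots]
      by (simp add: opact_Q_apply[OF in_Q e] one_act)
  qed (use opact_Q_extensional[OF in_Q] in simp_all)
next
  show "opunit Q \<in> topspace (level Q 1)"
    using continuous_map_restrict[of E "level P 1" "\<lambda>_. opunit P"] unit_in by simp
  fix g assume g: "g \<in> carrier G"
  have in_Q: "(\<lambda>e\<in>topspace E. opunit P) \<in> topspace (map_space E (level P 1))"
    using continuous_map_restrict[of E "level P 1" "\<lambda>_. opunit P"] unit_in by simp
  show "opact Q 1 (g, id) (opunit Q) = opunit Q"
  proof (rule extensionalityI[of _ "topspace E"])
    fix e assume e: "e \<in> topspace E"
    have "\<phi> (inv g) e \<in> topspace E" using g by (intro E.element_image[OF _ e refl]) simp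
    then show "opact Q 1 (g, id) (opunit Q) e = opunit Q e"
      unfolding opunit_Q by (subst opact_Q_apply[OF in_Q e]) (simp add: e unit_fixed[OF g])
  qed (use opact_Q_extensional[OF in_Q] in simp_all)
next
  fix x n assume x: "x \<in> topspace (level Q n)"
  have x_ext: "x \<in> extensional (topspace E)" using x by (simp add: topspace_map_space)
  show "opcomp Q 1 (\<lambda>i\<in>{1..1}. n) (opunit Q) (\<lambda>i\<in>{1..1}. x) = x"
  proof (rule extensionalityI[OF _ x_ext])
    fix e assume e: "e \<in> topspace E"
    have "(\<lambda>i\<in>{1..1}. (\<lambda>i\<in>{1..1}. x) i e) = (\<lambda>i\<in>{1..1::nat}. x e)" by (intro restrict_ext) simp
    then show "opcomp Q 1 (\<lambda>i\<in>{1..1}. n) (opunit Q) (\<lambda>i\<in>{1..1}. x) e = x e"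
      unfolding opcomp_Q opunit_Q using unit_left[OF value_in[of x n e]] x e by simp
  qed (simp)
  show "opcomp Q n (\<lambda>i\<in>{1..n}. 1) x (\<lambda>i\<in>{1..n}. opunit Q) = x"
  proof (rule extensionalityI[OF _ x_ext])
    fix e assume e: "e \<in> topspace E"
    have "(\<lambda>i\<in>{1..n}. (\<lambda>i\<in>{1..n}. opunit Q) i e) = (\<lambda>i\<in>{1..n}. opunit P)"
      using e by (intro restrict_ext) simp
    then show "opcomp Q n (\<lambda>i\<in>{1..n}. 1) x (\<lambda>i\<in>{1..n}. opunit Q) e = x e"
      unfolding opcomp_Q using unit_right[OF value_in[of x n e]] x e by simp
  qed (simp)
next
  fix j m :: "nat \<Rightarrow> nat" and k c d e'
  let ?s = "\<Sum>i\<in>{1..k}. j i"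
  assume j: "j \<in> extensional {1..k}" and c: "c \<in> topspace (level Q k)" and d: "d \<in> topspace (inputs Q k j)"
    and m: "m \<in> extensional {1..?s}" and e': "e' \<in> topspace (inputs Q ?s m)"
  show "opcomp Q ?s m (opcomp Q k j c d) e' =
      opcomp Q k (\<lambda>i\<in>{1..k}. \<Sum>l\<in>{1..j i}. m (slot j i l)) c
        (\<lambda>i\<in>{1..k}. opcomp Q (j i) (\<lambda>l\<in>{1..j i}. m (slot j i l)) (d i) (\<lambda>l\<in>{1..j i}. e' (slot j i l)))"
  proof (rule extensionalityI[of _ "topspace E"])
    fix e assume e: "e \<in> topspace E"
    let ?d = "\<lambda>i\<in>{1..k}. d i e" and ?e' = "\<lambda>l\<in>{1..?s}. e' l e"
    have slot_in: "slot j i l \<in> {1..?s}" if i: "i \<in> {1..k}" and l: "l \<in> {1..j i}" for i l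
    proof -
      have "(\<Sum>a\<in>{1..<i}. j a) + j i = (\<Sum>a\<in>{1..<Suc i}. j a)" using i by (simp add: sum.atLeastLessThan_Suc)
      also have "\<dots> \<le> ?s" using i by (intro sum_mono2) auto
      finally show ?thesis using l by (auto simp: slot_def)
    qed
    have "(\<lambda>i\<in>{1..k}. (\<lambda>i\<in>{1..k}. opcomp Q (j i) (\<lambda>l\<in>{1..j i}. m (slot j i l)) (d i) (\<lambda>l\<in>{1..j i}. e' (slot j i l))) i e)
      = (\<lambda>i\<in>{1..k}. opcomp P (j i) (\<lambda>l\<in>{1..j i}. m (slot j i l)) (?d i) (\<lambda>l\<in>{1..j i}. ?e' (slot j i l)))"
    proof (rule restrict_ext)
      fix i assume i: "i \<in> {1..k}"
      have "(\<lambda>l\<in>{1..j i}. (\<lambda>l\<in>{1..j i}. e' (slot j i l)) l e) = (\<lambda>l\<in>{1..j i}. ?e' (slot j i l))"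
        using slot_in[OF i] by (intro restrict_ext) simp
      then show "(\<lambda>i\<in>{1..k}. opcomp Q (j i) (\<lambda>l\<in>{1..j i}. m (slot j i l)) (d i) (\<lambda>l\<in>{1..j i}. e' (slot j i l))) i e
        = opcomp P (j i) (\<lambda>l\<in>{1..j i}. m (slot j i l)) (?d i) (\<lambda>l\<in>{1..j i}. ?e' (slot j i l))"
        using i e by simp
    qed
    then show "opcomp Q ?s m (opcomp Q k j c d) e' e =
      opcomp Q k (\<lambda>i\<in>{1..k}. \<Sum>l\<in>{1..j i}. m (slot j i l)) c
        (\<lambda>i\<in>{1..k}. opcomp Q (j i) (\<lambda>l\<in>{1..j i}. m (slot j i l)) (d i) (\<lambda>l\<in>{1..j i}. e' (slot j i l))) e"
      using comp_assoc[OF j value_in[of c k e] inputs_value_in[OF d e] m inputs_value_in[OF e' e]] c e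
      unfolding opcomp_Q[of k] opcomp_Q[of ?s] by simp
  qed simp_all
qed

end

section \<open>Families of subgroups and universal mapping spaces\<close>

lemma conj_set_eq: "a <#\<^bsub>G\<^esub> L #>\<^bsub>G\<^esub> b = (\<lambda>l. a \<otimes>\<^bsub>G\<^esub> l \<otimes>\<^bsub>G\<^esub> b) ` L"
  by (auto simp: l_coset_def r_coset_def)

lemma subgroup_familyD:
  assumes "subgroup_family G F" "L \<in> F"
  shows "subgroup L G" and "a \<in> carrier G \<Longrightarrow> a <#\<^bsub>G\<^esub> L #>\<^bsub>G\<^esub> inv\<^bsub>G\<^esub> a \<in> F"
    and "\<lbrakk>subgroup L' G; L' \<subseteq> L\<rbrakk> \<Longrightarrow> L' \<in> F"
  using assms unfolding subgroup_family_def by blast+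

context group
begin

lemma conj_conj_inv:
  assumes "a \<in> carrier G" "L \<subseteq> carrier G"
  shows "inv a <#\<^bsub>G\<^esub> (a <#\<^bsub>G\<^esub> L #>\<^bsub>G\<^esub> inv a) #>\<^bsub>G\<^esub> inv (inv a) = L"
proof -
  have "inv a \<otimes> (a \<otimes> l \<otimes> inv a) \<otimes> inv (inv a) = l" if "l \<in> L" for l
    using that assms by (simp add: m_assoc subset_iff) (simp flip: m_assoc)
  then show ?thesis unfolding conj_set_eq image_image by (simp cong: image_cong)
qed

lemma conj_hom: "a \<in> carrier G \<Longrightarrow> (\<lambda>l. a \<otimes> l \<otimes> inv a) \<in> hom G G"
  by (rule homI) (simp_all add: m_assoc inv_solve_left)

lemma conj_subgroup:
  assumes "a \<in> carrier G" "subgroup L G"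
  shows "subgroup (a <#\<^bsub>G\<^esub> L #>\<^bsub>G\<^esub> inv a) G"
proof -
  interpret h: group_hom G G "\<lambda>l. a \<otimes> l \<otimes> inv a"
    using conj_hom[OF assms(1)] by unfold_locales
  show ?thesis unfolding conj_set_eq by (rule h.subgroup_img_is_subgroup[OF assms(2)])
qed

text \<open>Conjugation is invertible, so closure of a family under conjugation is an equivalence.\<close>

lemma family_conj_iff:
  assumes "subgroup_family G F" "a \<in> carrier G" "L \<subseteq> carrier G"
  shows "a <#\<^bsub>G\<^esub> L #>\<^bsub>G\<^esub> inv a \<in> F \<longleftrightarrow> L \<in> F"
proof
  assume "a <#\<^bsub>G\<^esub> L #>\<^bsub>G\<^esub> inv a \<in> F"
  then have "inv a <#\<^bsub>G\<^esub> (a <#\<^bsub>G\<^esub> L #>\<^bsub>G\<^esub> inv a) #>\<^bsub>G\<^esub> inv (inv a) \<in> F"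
    by (rule subgroup_familyD(2)[OF assms(1) _ inv_closed[OF assms(2)]])
  then show "L \<in> F" by (simp only: conj_conj_inv[OF assms(2,3)])
qed (rule subgroup_familyD(2)[OF assms(1) _ assms(2)])

end

text \<open>A universal space determines its family.\<close>

lemma universal_family_iff:
  assumes "universal_space G X \<xi> F" "subgroup L G"
  shows "L \<in> F \<longleftrightarrow> topspace (fixed_space X \<xi> L) \<noteq> {}"
  using assms unfolding universal_space_def by metis

lemma universal_family_unique:
  assumes "universal_space G X \<xi> F" "universal_space G X \<xi> F'"
  shows "F = F'"
proof -
  have "subgroup L G" if "L \<in> F \<union> F'" for L
    using assms that subgroup_familyD(1) unfolding universal_space_def by blast
  then show ?thesis using universal_family_iff assms by blast
qed

text \<open>The family of a mapping space: \<open>\<Gamma>\<close> belongs to it when every subgroup of \<open>\<Gamma>\<close> that fixes a point of the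
source (that is, whose image in \<open>G\<close> lies in \<open>\<E>\<close>) fixes a point of the target.\<close>

definition coinduced_family ::
  "('h, 'c) monoid_scheme \<Rightarrow> ('h \<Rightarrow> 'g) \<Rightarrow> 'g set set \<Rightarrow> 'h set set \<Rightarrow> 'h set set" where
  "coinduced_family A \<pi> \<E> F =
     {\<Gamma>. subgroup \<Gamma> A \<and> (\<forall>\<Lambda>. subgroup \<Lambda> A \<and> \<Lambda> \<subseteq> \<Gamma> \<and> \<pi> ` \<Lambda> \<in> \<E> \<longrightarrow> \<Lambda> \<in> F)}"

lemma coinduced_family_is_family:
  assumes G: "group G" and A: "group A" and \<pi>: "\<pi> \<in> hom A G"
    and \<E>: "subgroup_family G \<E>" and F: "subgroup_family A F"
  shows "subgroup_family A (coinduced_family A \<pi> \<E> F)"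
proof -
  interpret G: group G by (rule G)
  interpret A: group A by (rule A)
  interpret \<pi>: group_hom A G \<pi> using \<pi> by unfold_locales
  have "a <#\<^bsub>A\<^esub> \<Gamma> #>\<^bsub>A\<^esub> inv\<^bsub>A\<^esub> a \<in> coinduced_family A \<pi> \<E> F"
    if \<Gamma>: "\<Gamma> \<in> coinduced_family A \<pi> \<E> F" and a: "a \<in> carrier A" for \<Gamma> a
  proof -
    have \<Gamma>_sub: "subgroup \<Gamma> A" using \<Gamma> by (simp add: coinduced_family_def)
    have "\<Lambda> \<in> F" if \<Lambda>: "subgroup \<Lambda> A" "\<Lambda> \<subseteq> a <#\<^bsub>A\<^esub> \<Gamma> #>\<^bsub>A\<^esub> inv\<^bsub>A\<^esub> a" "\<pi> ` \<Lambda> \<in> \<E>" for \<Lambda>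
    proof -
      let ?\<Lambda>' = "inv\<^bsub>A\<^esub> a <#\<^bsub>A\<^esub> \<Lambda> #>\<^bsub>A\<^esub> inv\<^bsub>A\<^esub> (inv\<^bsub>A\<^esub> a)"
      have \<Lambda>_carrier: "\<Lambda> \<subseteq> carrier A" using \<Lambda>(1) by (rule subgroup.subset)
      have "?\<Lambda>' \<subseteq> inv\<^bsub>A\<^esub> a <#\<^bsub>A\<^esub> (a <#\<^bsub>A\<^esub> \<Gamma> #>\<^bsub>A\<^esub> inv\<^bsub>A\<^esub> a) #>\<^bsub>A\<^esub> inv\<^bsub>A\<^esub> (inv\<^bsub>A\<^esub> a)"
        using \<Lambda>(2) unfolding conj_set_eq by (rule image_mono)
      then have "?\<Lambda>' \<subseteq> \<Gamma>" using A.conj_conj_inv[OF a subgroup.subset[OF \<Gamma>_sub]] by simp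
      moreover have "subgroup ?\<Lambda>' A" by (rule A.conj_subgroup[OF A.inv_closed[OF a] \<Lambda>(1)])
      moreover have "\<pi> ` ?\<Lambda>' = inv\<^bsub>G\<^esub> (\<pi> a) <#\<^bsub>G\<^esub> (\<pi> ` \<Lambda>) #>\<^bsub>G\<^esub> inv\<^bsub>G\<^esub> (inv\<^bsub>G\<^esub> (\<pi> a))"
        unfolding conj_set_eq image_image using a \<Lambda>_carrier by (intro image_cong) auto
      then have "\<pi> ` ?\<Lambda>' \<in> \<E>" using subgroup_familyD(2)[OF \<E> \<Lambda>(3) G.inv_closed[OF \<pi>.hom_closed[OF a]]] by (simp only:)
      ultimately have "?\<Lambda>' \<in> F" using \<Gamma> by (simp add: coinduced_family_def)
      then show ?thesis using A.family_conj_iff[OF F A.inv_closed[OF a] \<Lambda>_carrier] by simp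
    qed
    then show ?thesis
      using A.conj_subgroup[OF a \<Gamma>_sub] by (simp add: coinduced_family_def)
  qed
  moreover have "\<Gamma>' \<in> coinduced_family A \<pi> \<E> F"
    if "\<Gamma> \<in> coinduced_family A \<pi> \<E> F" "subgroup \<Gamma>' A" "\<Gamma>' \<subseteq> \<Gamma>" for \<Gamma> \<Gamma>'
    using that unfolding coinduced_family_def by blast
  moreover have "subgroup \<Gamma> A" if "\<Gamma> \<in> coinduced_family A \<pi> \<E> F" for \<Gamma>
    using that by (simp add: coinduced_family_def)
  ultimately show ?thesis unfolding subgroup_family_def by blast
qed

lemma hom_subgroup:
  assumes "h \<in> hom A G" "\<Gamma> \<subseteq> carrier A"
  shows "h \<in> hom (A\<lparr>carrier := \<Gamma>\<rparr>) G"
  using assms by (auto simp: hom_def Pi_iff subset_iff)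

lemma G_space_subgroup:
  assumes "group A" "G_space A X \<xi>" "subgroup \<Gamma> A"
  shows "G_space (A\<lparr>carrier := \<Gamma>\<rparr>) X \<xi>"
proof -
  interpret A: group A by fact
  interpret X: group_action A "topspace X" \<xi> using assms(2) by (simp add: G_space_def)
  interpret X: group_hom A "BijGroup (topspace X)" \<xi> by (rule X.group_hom)
  have "\<xi> \<in> hom (A\<lparr>carrier := \<Gamma>\<rparr>) (BijGroup (topspace X))"
    by (rule hom_subgroup[OF X.homh subgroup.subset[OF assms(3)]])
  then have "group_action (A\<lparr>carrier := \<Gamma>\<rparr>) (topspace X) \<xi>"
    by (intro group_action.intro group_hom.intro group_hom_axioms.intro group_BijGroup
        A.subgroup_imp_group[OF assms(3)])
  then show ?thesis using assms(2) subgroup.subset[OF assms(3)] by (auto simp: G_space_def)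
qed

text \<open>If \<open>\<Gamma>\<close> is in the coinduced family, its fixed points are the equivariant maps into a space with
contractible fixed spaces for all isotropy groups of \<open>E\<close>.  Otherwise some subgroup \<open>\<Lambda>\<close> of \<open>\<Gamma>\<close> fixes a point
of \<open>E\<close> but no point of \<open>X\<close>, and an equivariant map would send the former to a fixed point.\<close>

theorem map_space_universal:
  assumes G: "group G" and A: "group A" and \<pi>: "\<pi> \<in> hom A G"
    and E: "universal_space G E \<phi> \<E>" and haus: "Hausdorff_space E"
    and Y: "G_CW_complex G Y \<theta>" and EY: "G_homotopy_equivalent G E \<phi> Y \<theta>"
    and X: "universal_space A X \<xi> F"
  shows "universal_space A (map_space E X) (conj_map_action G \<pi> E \<phi> X \<xi>) (coinduced_family A \<pi> \<E> F)"
proof -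
  interpret G: group G by (rule G)
  interpret A: group A by (rule A)
  interpret \<pi>: group_hom A G \<pi> using \<pi> by unfold_locales
  let ?M = "map_space E X" and ?\<psi> = "conj_map_action G \<pi> E \<phi> X \<xi>"
  have Es: "G_space G E \<phi>" and \<E>: "subgroup_family G \<E>" using E by (auto simp: universal_space_def)
  have Xs: "G_space A X \<xi>" and F: "subgroup_family A F" using X by (auto simp: universal_space_def)
  have fixed_E: "topspace (fixed_space E \<phi> (\<pi> ` \<Lambda>)) = {e \<in> topspace E. \<forall>\<gamma>\<in>\<Lambda>. \<phi> (\<pi> \<gamma>) e = e}" for \<Lambda>
    by (auto simp: fixed_space_def)
  have "if \<Gamma> \<in> coinduced_family A \<pi> \<E> F
      then topspace (fixed_space ?M ?\<psi> \<Gamma>) \<noteq> {} \<and> contractible_space (fixed_space ?M ?\<psi> \<Gamma>)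
      else topspace (fixed_space ?M ?\<psi> \<Gamma>) = {}" if \<Gamma>: "subgroup \<Gamma> A" for \<Gamma>
  proof (cases "\<Gamma> \<in> coinduced_family A \<pi> \<E> F")
    case True
    let ?A = "A\<lparr>carrier := \<Gamma>\<rparr>"
    have "topspace (fixed_space X \<xi> \<Lambda>) \<noteq> {} \<and> contractible_space (fixed_space X \<xi> \<Lambda>)"
      if \<Lambda>: "subgroup \<Lambda> ?A" and e: "e \<in> topspace E" "\<forall>\<gamma>\<in>\<Lambda>. \<phi> (\<pi> \<gamma>) e = e" for \<Lambda> e
    proof -
      have sub: "subgroup \<Lambda> A" by (rule A.incl_subgroup[OF \<Gamma> \<Lambda>])
      have "\<Lambda> \<subseteq> \<Gamma>" using subgroup.subset[OF \<Lambda>] by simp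
      moreover have "\<pi> ` \<Lambda> \<in> \<E>"
        using universal_family_iff[OF E \<pi>.subgroup_img_is_subgroup[OF sub]] e fixed_E by blast
      ultimately have "\<Lambda> \<in> F" using True sub by (simp add: coinduced_family_def)
      then show ?thesis using X sub unfolding universal_space_def by metis
    qed
    moreover have "\<pi> \<in> hom ?A G" by (rule hom_subgroup[OF \<pi> subgroup.subset[OF \<Gamma>]])
    ultimately have "topspace (equivariant_maps ?A \<pi> E \<phi> X \<xi>) \<noteq> {} \<and>
        contractible_space (equivariant_maps ?A \<pi> E \<phi> X \<xi>)"
      using equivariant_maps_contractible[OF G A.subgroup_imp_group[OF \<Gamma>] _ Es haus Y EY
          G_space_subgroup[OF A Xs \<Gamma>]] by blast
    then show ?thesis using True fixed_space_conj_map_action[OF G A \<pi> Es Xs \<Gamma>] by simp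
  next
    case False
    then obtain \<Lambda> where \<Lambda>: "subgroup \<Lambda> A" "\<Lambda> \<subseteq> \<Gamma>" "\<pi> ` \<Lambda> \<in> \<E>" "\<Lambda> \<notin> F"
      using \<Gamma> by (auto simp: coinduced_family_def)
    obtain e where e: "e \<in> topspace E" "\<forall>\<gamma>\<in>\<Lambda>. \<phi> (\<pi> \<gamma>) e = e"
      using universal_family_iff[OF E \<pi>.subgroup_img_is_subgroup[OF \<Lambda>(1)]] \<Lambda>(3) fixed_E by blast
    have "f \<notin> topspace (equivariant_maps (A\<lparr>carrier := \<Gamma>\<rparr>) \<pi> E \<phi> X \<xi>)" for f
    proof
      assume "f \<in> topspace (equivariant_maps (A\<lparr>carrier := \<Gamma>\<rparr>) \<pi> E \<phi> X \<xi>)"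
      then have f: "continuous_map E X f" "\<forall>\<gamma>\<in>\<Gamma>. \<forall>e\<in>topspace E. f (\<phi> (\<pi> \<gamma>) e) = \<xi> \<gamma> (f e)"
        by (auto simp: equivariant_maps_def topspace_map_space)
      have "\<xi> \<gamma> (f e) = f e" if \<gamma>: "\<gamma> \<in> \<Lambda>" for \<gamma>
      proof -
        have "f (\<phi> (\<pi> \<gamma>) e) = \<xi> \<gamma> (f e)" using f(2) \<Lambda>(2) e(1) \<gamma> by blast
        moreover have "\<phi> (\<pi> \<gamma>) e = e" using e(2) \<gamma> by blast
        ultimately show ?thesis by simp
      qed
      moreover have "f e \<in> topspace X" using f(1) e(1) by (auto simp: continuous_map_def)
      ultimately have "f e \<in> topspace (fixed_space X \<xi> \<Lambda>)" by (simp add: fixed_space_def)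
      then show False using universal_family_iff[OF X \<Lambda>(1)] \<Lambda>(4) by blast
    qed
    then have "topspace (equivariant_maps (A\<lparr>carrier := \<Gamma>\<rparr>) \<pi> E \<phi> X \<xi>) = {}" by blast
    then show ?thesis
      unfolding fixed_space_conj_map_action[OF G A \<pi> Es Xs \<Gamma>] using False by (simp only: if_False)
  qed
  then show ?thesis
    using conj_map_action_G_space[OF G A \<pi> Es haus Xs] coinduced_family_is_family[OF G A \<pi> \<E> F]
    unfolding universal_space_def by blast
qed

context group
begin

lemma sym_group_id: "\<one>\<^bsub>sym_group n\<^esub> = id"
  by (simp add: sym_group_def)

lemma prod_sym_conj:
  assumes "g \<in> carrier G" "\<sigma> permutes {1..n}" 
  shows "(g, \<sigma>) \<otimes>\<^bsub>G \<times>\<times> sym_group n\<^esub> (k, s) \<otimes>\<^bsub>G \<times>\<times> sym_group n\<^esub> inv\<^bsub>G \<times>\<times> sym_group n\<^esub> (g, \<sigma>) =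
    (g \<otimes> k \<otimes> inv g, \<sigma> \<circ> s \<circ> Hilbert_Choice.inv \<sigma>)"
  using assms by (simp add: inv_DirProd[OF is_group sym_group_is_group] sym_group_carrier sym_group_mult)

text \<open>This is what forces the members of the coinduced family to be graph subgroups.\<close>

lemma trivial_in_subconj_family:
  assumes "subgroup H G"
  shows "{\<one>} \<in> subconj_family G H"
  unfolding subconj_family_def conj_set_eq
  using subgroup.one_closed[OF assms] triv_subgroup by (auto intro!: bexI[of _ \<one>])

lemma coinduced_graph_subgroup_family:
  assumes H: "subgroup H G" and F: "graph_subgroup_family G n F"
    and \<E>: "subgroup_family G (subconj_family G H)"
  shows "graph_subgroup_family G n (coinduced_family (G \<times>\<times> sym_group n) fst (subconj_family G H) F)"
    (is "graph_subgroup_family G n ?F'")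
  unfolding graph_subgroup_family_def
proof (intro conjI ballI allI impI)
  let ?D = "G \<times>\<times> sym_group n"
  interpret D: group ?D by (rule prod_sym_group)
  interpret S: group "sym_group n" by (rule sym_group_is_group)
  have F_fam: "subgroup_family ?D F" using F by (simp add: graph_subgroup_family_def)
  show "subgroup_family ?D ?F'"
    by (rule coinduced_family_is_family[OF is_group prod_sym_group prod_sym_fst_hom \<E> F_fam])
  fix \<Gamma> assume \<Gamma>: "\<Gamma> \<in> ?F'"
  \<comment> \<open>\<open>\<Gamma> \<inter> (1 \<times> \<Sigma>\<^sub>n)\<close> projects to the trivial group, so it lies in \<open>F\<close>, whose members are graph subgroups.\<close>
  let ?V = "{\<one>} \<times> carrier (sym_group n)"
  let ?\<Lambda> = "\<Gamma> \<inter> ?V"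
  have "subgroup ?V ?D"
    by (intro DirProd_subgroups is_group triv_subgroup sym_group_is_group S.subgroup_self)
  moreover have "subgroup \<Gamma> ?D" using \<Gamma> by (simp add: coinduced_family_def)
  ultimately have sub: "subgroup ?\<Lambda> ?D" by (intro D.subgroups_Inter_pair)
  have "\<one>\<^bsub>?D\<^esub> \<in> ?\<Lambda>" by (rule subgroup.one_closed[OF sub])
  then have "fst ` ?\<Lambda> = {\<one>}" by force
  then have "?\<Lambda> \<in> F" using \<Gamma> sub trivial_in_subconj_family[OF H] by (simp add: coinduced_family_def)
  moreover have "\<forall>\<Gamma>\<in>F. \<Gamma> \<inter> ?V = {(\<one>, id)}"
    using F unfolding graph_subgroup_family_def by (elim conjE)
  ultimately have "?\<Lambda> \<inter> ?V = {(\<one>, id)}" by (rule bspec[rotated])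
  moreover have "?\<Lambda> \<inter> ?V = ?\<Lambda>" by (simp only: Int_assoc Int_absorb)
  ultimately show "?\<Lambda> = {(\<one>, id)}" by (simp only:)
next
  let ?D = "G \<times>\<times> sym_group n"
  fix K assume K: "subgroup K G"
  interpret S: group "sym_group n" by (rule sym_group_is_group)
  have "subgroup {id} (sym_group n)" using S.triv_subgroup by (simp add: sym_group_id)
  then have "subgroup (K \<times> {id}) ?D"
    by (intro DirProd_subgroups is_group K sym_group_is_group)
  moreover have KF: "K \<times> {id} \<in> F" using F K by (simp add: graph_subgroup_family_def)
  have "\<Lambda> \<in> F" if "subgroup \<Lambda> ?D" "\<Lambda> \<subseteq> K \<times> {id}" for \<Lambda>
    by (rule subgroup_familyD(3)[OF F[unfolded graph_subgroup_family_def, THEN conjunct1] KF that])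
  ultimately show "K \<times> {id} \<in> ?F'" by (simp add: coinduced_family_def)
qed

end

section \<open>Graphs of actions on finite sets\<close>

definition graph :: "'g set \<Rightarrow> ('g \<Rightarrow> 's) \<Rightarrow> ('g \<times> 's) set" where
  "graph K s = (\<lambda>k. (k, s k)) ` K"

lemma set_hom_graph: "{(k, set_hom T \<psi> b k) | k. k \<in> K} = graph K (set_hom T \<psi> b)"
  by (auto simp: graph_def)

lemma set_hom_apply: "bij_betw b T {1..card T} \<Longrightarrow> t \<in> T \<Longrightarrow> set_hom T \<psi> b k (b t) = b (\<psi> k t)"
  unfolding set_hom_def using bij_betw_inv_into_left bij_betwE by (metis (no_types, lifting))

lemma set_hom_outside: "i \<notin> {1..card T} \<Longrightarrow> set_hom T \<psi> b k i = i"
  unfolding set_hom_def by (rule if_not_P)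

lemma set_hom_eqI:
  assumes b: "bij_betw b T {1..card T}"
    and "\<And>t. t \<in> T \<Longrightarrow> f (b t) = f' (b t)" and "\<And>i. i \<notin> {1..card T} \<Longrightarrow> f i = f' i"
  shows "f = f'"
proof
  fix i
  show "f i = f' i"
  proof (cases "i \<in> {1..card T}")
    case True
    then obtain t where "t \<in> T" "i = b t" using bij_betw_imp_surj_on[OF b] by blast
    then show ?thesis using assms(2) by simp
  qed (rule assms(3))
qed

lemma set_hom_permutes:
  assumes b: "bij_betw b T {1..card T}" and \<psi>: "bij_betw (\<psi> k) T T"
  shows "set_hom T \<psi> b k permutes {1..card T}"
proof (rule bij_imp_permutes)
  have "bij_betw (b \<circ> \<psi> k \<circ> inv_into T b) {1..card T} {1..card T}"
    using b \<psi> bij_betw_inv_into[OF b] by (intro bij_betw_trans)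
  then show "bij_betw (set_hom T \<psi> b k) {1..card T} {1..card T}"
    by (rule bij_betw_cong[THEN iffD1, rotated]) (simp add: set_hom_def)
qed (rule set_hom_outside)

context group
begin

lemma graph_carrier:
  assumes "bij_betw b T {1..card T}" "\<And>k. k \<in> K \<Longrightarrow> bij_betw (\<psi> k) T T" "K \<subseteq> carrier G"
  shows "graph K (set_hom T \<psi> b) \<subseteq> carrier (G \<times>\<times> sym_group (card T))"
  using set_hom_permutes[OF assms(1,2)] assms(3) by (auto simp: graph_def sym_group_carrier)

lemma graph_subgroup:
  assumes K: "subgroup K G" and \<psi>: "group_action (G\<lparr>carrier := K\<rparr>) T \<psi>"
    and b: "bij_betw b T {1..card T}"
  shows "subgroup (graph K (set_hom T \<psi> b)) (G \<times>\<times> sym_group (card T))"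
proof -
  interpret \<psi>: group_action "G\<lparr>carrier := K\<rparr>" T \<psi> by (rule \<psi>)
  interpret K: group "G\<lparr>carrier := K\<rparr>" by (rule subgroup_imp_group[OF K])
  let ?s = "set_hom T \<psi> b" and ?D = "G \<times>\<times> sym_group (card T)"
  have bij: "bij_betw (\<psi> k) T T" if "k \<in> K" for k
    using \<psi>.bij_prop0[of k] that by (simp add: Bij_def)
  have "?s (k \<otimes> k') = ?s k \<circ> ?s k'" if k: "k \<in> K" "k' \<in> K" for k k'
  proof (rule set_hom_eqI[OF b])
    fix t assume t: "t \<in> T"
    have "\<psi> k' t \<in> T" using bij[OF k(2)] t by (auto dest: bij_betwE)
    then show "?s (k \<otimes> k') (b t) = (?s k \<circ> ?s k') (b t)"
      using \<psi>.composition_rule[OF t, of k k'] k t by (simp add: set_hom_apply[OF b])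
  next
    fix i assume "i \<notin> {1..card T}"
    then show "?s (k \<otimes> k') i = (?s k \<circ> ?s k') i"
      using set_hom_outside[of i T] unfolding comp_def by metis
  qed
  moreover have "(k, ?s k) \<in> carrier ?D" if "k \<in> K" for k
    using graph_carrier[of b T K \<psi>, OF b bij subgroup.subset[OF K]] that unfolding graph_def by blast
  ultimately have "(\<lambda>k. (k, ?s k)) \<in> hom (G\<lparr>carrier := K\<rparr>) ?D"
    by (intro homI) (simp_all add: sym_group_mult)
  then interpret h: group_hom "G\<lparr>carrier := K\<rparr>" ?D "\<lambda>k. (k, ?s k)"
    by (intro group_hom.intro group_hom_axioms.intro K.is_group prod_sym_group)
  show ?thesis using h.img_is_subgroup by (simp add: graph_def)
qed

text \<open>Two orderings of \<open>T\<close> differ by a permutation \<open>\<sigma>\<close>, and the graphs are conjugate by \<open>(\<one>, \<sigma>)\<close>.\<close>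

lemma graph_reindex:
  assumes F: "subgroup_family (G \<times>\<times> sym_group (card T)) F" and K: "K \<subseteq> carrier G"
    and \<psi>: "\<And>k. k \<in> K \<Longrightarrow> bij_betw (\<psi> k) T T"
    and b: "bij_betw b T {1..card T}" and b': "bij_betw b' T {1..card T}"
    and in_F: "graph K (set_hom T \<psi> b) \<in> F"
  shows "graph K (set_hom T \<psi> b') \<in> F"
proof -
  let ?D = "G \<times>\<times> sym_group (card T)"
  interpret D: group ?D by (rule prod_sym_group)
  define \<sigma> where "\<sigma> i = (if i \<in> {1..card T} then b' (inv_into T b i) else i)" for i
  have \<sigma>b: "\<sigma> (b t) = b' t" if "t \<in> T" for t
    using b that bij_betwE[OF b] by (simp add: \<sigma>_def bij_betw_inv_into_left)
  have \<sigma>: "\<sigma> permutes {1..card T}"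
  proof (rule bij_imp_permutes)
    have "bij_betw (b' \<circ> inv_into T b) {1..card T} {1..card T}"
      using b' bij_betw_inv_into[OF b] by (intro bij_betw_trans)
    then show "bij_betw \<sigma> {1..card T} {1..card T}"
      by (rule bij_betw_cong[THEN iffD1, rotated]) (simp add: \<sigma>_def)
  qed (unfold \<sigma>_def, rule if_not_P)
  have conj: "\<sigma> \<circ> set_hom T \<psi> b k \<circ> Hilbert_Choice.inv \<sigma> = set_hom T \<psi> b' k" if k: "k \<in> K" for k
  proof -
    have "\<sigma> \<circ> set_hom T \<psi> b k = set_hom T \<psi> b' k \<circ> \<sigma>"
    proof (rule set_hom_eqI[OF b])
      fix t assume t: "t \<in> T"
      have "\<psi> k t \<in> T" using \<psi>[OF k] t by (auto dest: bij_betwE)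
      then show "(\<sigma> \<circ> set_hom T \<psi> b k) (b t) = (set_hom T \<psi> b' k \<circ> \<sigma>) (b t)"
        using t by (simp add: set_hom_apply[OF b] set_hom_apply[OF b'] \<sigma>b)
    next
      fix i assume "i \<notin> {1..card T}"
      then show "(\<sigma> \<circ> set_hom T \<psi> b k) i = (set_hom T \<psi> b' k \<circ> \<sigma>) i"
        using set_hom_outside[of i T] permutes_not_in[OF \<sigma>] unfolding comp_def by metis
    qed
    then show ?thesis using permutes_inv_o(1)[OF \<sigma>] by (simp add: comp_assoc)
  qed
  have "(\<one>, \<sigma>) <#\<^bsub>?D\<^esub> graph K (set_hom T \<psi> b) #>\<^bsub>?D\<^esub> inv\<^bsub>?D\<^esub> (\<one>, \<sigma>) = graph K (set_hom T \<psi> b')"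
    unfolding conj_set_eq graph_def image_image
    by (intro image_cong refl, subst prod_sym_conj[OF one_closed \<sigma>]) (use K conj in auto)
  moreover have "(\<one>, \<sigma>) \<in> carrier ?D" using \<sigma> by (simp add: sym_group_carrier)
  ultimately show ?thesis using subgroup_familyD(2)[OF F in_F] by metis
qed

lemma conj_graph:
  assumes g: "g \<in> carrier G" and K: "K \<subseteq> carrier G" and H: "H \<subseteq> carrier G"
  shows "(g, id) <#\<^bsub>G \<times>\<times> sym_group n\<^esub> graph {k \<in> K. g \<otimes> k \<otimes> inv g \<in> H} s #>\<^bsub>G \<times>\<times> sym_group n\<^esub>
      inv\<^bsub>G \<times>\<times> sym_group n\<^esub> (g, id) =
    graph (H \<inter> (g <#\<^bsub>G\<^esub> K #>\<^bsub>G\<^esub> inv g)) (\<lambda>x. s (inv g \<otimes> x \<otimes> g))"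
proof -
  have canc: "inv g \<otimes> (g \<otimes> k \<otimes> inv g) \<otimes> g = k" if "k \<in> K" for k
    using that g K by (simp add: m_assoc subset_iff) (simp flip: m_assoc)
  have "H \<inter> (g <#\<^bsub>G\<^esub> K #>\<^bsub>G\<^esub> inv g) = (\<lambda>k. g \<otimes> k \<otimes> inv g) ` {k \<in> K. g \<otimes> k \<otimes> inv g \<in> H}"
    by (auto simp: conj_set_eq)
  then show ?thesis
    unfolding conj_set_eq[where a = "(g, id)"] graph_def
    by (auto simp: image_image prod_sym_conj[OF g permutes_id, simplified] canc intro!: image_cong)
qed

text \<open>The graph \<open>\<Gamma>\<close> lies in the coinduced family iff \<open>F\<close> contains all its subgroups whose projection to \<open>G\<close> is
conjugated into \<open>H\<close> by some \<open>g\<close>.  For a fixed \<open>g\<close> there is a largest such subgroup, the graph \<open>\<Lambda> g\<close> over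
\<open>K \<inter> g\<inverse>Hg\<close>, and its conjugate by \<open>(g, id)\<close> is the graph of the restriction of the conjugated action
to \<open>H \<inter> gKg\<inverse>\<close>.\<close>

lemma graph_in_coinduced_family_iff:
  assumes H: "subgroup H G" and K: "subgroup K G" and \<psi>: "group_action (G\<lparr>carrier := K\<rparr>) T \<psi>"
    and b: "bij_betw b T {1..card T}"
    and F: "subgroup_family (G \<times>\<times> sym_group (card T)) F"
  shows "graph K (set_hom T \<psi> b) \<in> coinduced_family (G \<times>\<times> sym_group (card T)) fst (subconj_family G H) F \<longleftrightarrow>
    (\<forall>g\<in>carrier G. graph (H \<inter> (g <#\<^bsub>G\<^esub> K #>\<^bsub>G\<^esub> inv g)) (set_hom T (conj_action G g \<psi>) b) \<in> F)"
proof -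
  let ?D = "G \<times>\<times> sym_group (card T)" and ?s = "set_hom T \<psi> b"
  let ?\<Gamma> = "graph K ?s"
  interpret D: group ?D by (rule prod_sym_group)
  interpret S: group "sym_group (card T)" by (rule sym_group_is_group)
  interpret fst: group_hom ?D G fst
    by (intro group_hom.intro group_hom_axioms.intro prod_sym_group is_group prod_sym_fst_hom)
  note KG = subgroup.subset[OF K] and HG = subgroup.subset[OF H]
  have \<Gamma>: "subgroup ?\<Gamma> ?D" by (rule graph_subgroup[OF K \<psi> b])
  define \<Lambda> where "\<Lambda> g = graph {k \<in> K. g \<otimes> k \<otimes> inv g \<in> H} ?s" for g
  have \<Lambda>_sub: "\<Lambda> g \<subseteq> ?\<Gamma>" for g by (auto simp: \<Lambda>_def graph_def)
  have \<Lambda>_carrier: "\<Lambda> g \<subseteq> carrier ?D" for g using \<Lambda>_sub subgroup.subset[OF \<Gamma>] by blast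
  have \<Lambda>_conj: "(g, id) <#\<^bsub>?D\<^esub> \<Lambda> g #>\<^bsub>?D\<^esub> inv\<^bsub>?D\<^esub> (g, id) =
      graph (H \<inter> (g <#\<^bsub>G\<^esub> K #>\<^bsub>G\<^esub> inv g)) (set_hom T (conj_action G g \<psi>) b)" if "g \<in> carrier G" for g
  proof -
    have "(\<lambda>x. ?s (inv g \<otimes> x \<otimes> g)) = set_hom T (conj_action G g \<psi>) b"
      by (simp add: fun_eq_iff set_hom_def conj_action_def)
    then show ?thesis using conj_graph[OF that KG HG, of "card T" ?s] by (simp only: \<Lambda>_def)
  qed
  have \<Lambda>_F: "graph (H \<inter> (g <#\<^bsub>G\<^esub> K #>\<^bsub>G\<^esub> inv g)) (set_hom T (conj_action G g \<psi>) b) \<in> F \<longleftrightarrow> \<Lambda> g \<in> F"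
    if g: "g \<in> carrier G" for g
    using D.family_conj_iff[OF F _ \<Lambda>_carrier, of "(g, id)" g] g \<Lambda>_conj[OF g]
    by (simp add: sym_group_carrier permutes_id)
  have \<Lambda>_subgroup: "subgroup (\<Lambda> g) ?D" if g: "g \<in> carrier G" for g
  proof -
    let ?H = "inv g <#\<^bsub>G\<^esub> H #>\<^bsub>G\<^esub> inv (inv g)"
    have mem: "k \<in> ?H \<longleftrightarrow> g \<otimes> k \<otimes> inv g \<in> H" if "k \<in> K" for k
    proof
      assume "k \<in> ?H"
      then obtain h where h: "h \<in> H" "k = inv g \<otimes> h \<otimes> inv (inv g)" by (auto simp: conj_set_eq)
      then have "g \<otimes> k \<otimes> inv g = h" using g HG by (simp add: m_assoc subset_iff) (simp flip: m_assoc)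
      then show "g \<otimes> k \<otimes> inv g \<in> H" using h by simp
    next
      assume h: "g \<otimes> k \<otimes> inv g \<in> H"
      have "inv g \<otimes> (g \<otimes> k \<otimes> inv g) \<otimes> inv (inv g) = k"
        using g KG that by (simp add: m_assoc subset_iff) (simp flip: m_assoc)
      then show "k \<in> ?H" unfolding conj_set_eq using h by (metis image_eqI)
    qed
    have "\<Lambda> g = ?\<Gamma> \<inter> (?H \<times> carrier (sym_group (card T)))"
      using subgroup.subset[OF \<Gamma>] mem by (auto simp: \<Lambda>_def graph_def)
    moreover have "subgroup (?H \<times> carrier (sym_group (card T))) ?D"
      by (intro DirProd_subgroups is_group sym_group_is_group S.subgroup_self conj_subgroup inv_closed g H)
    ultimately show ?thesis using \<Gamma> by (simp add: D.subgroups_Inter_pair)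
  qed
  have \<Lambda>_fst: "fst ` \<Lambda> g = {k \<in> K. g \<otimes> k \<otimes> inv g \<in> H}" for g
    by (force simp: \<Lambda>_def graph_def)
  show ?thesis
  proof
    assume l: "?\<Gamma> \<in> coinduced_family ?D fst (subconj_family G H) F"
    show "\<forall>g\<in>carrier G. graph (H \<inter> (g <#\<^bsub>G\<^esub> K #>\<^bsub>G\<^esub> inv g)) (set_hom T (conj_action G g \<psi>) b) \<in> F"
    proof
      fix g assume g: "g \<in> carrier G"
      have "g <#\<^bsub>G\<^esub> (fst ` \<Lambda> g) #>\<^bsub>G\<^esub> inv g \<subseteq> H" unfolding \<Lambda>_fst conj_set_eq by auto
      then have "fst ` \<Lambda> g \<in> subconj_family G H"
        using fst.subgroup_img_is_subgroup[OF \<Lambda>_subgroup[OF g]] g by (auto simp: subconj_family_def)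
      then have "\<Lambda> g \<in> F" using l \<Lambda>_subgroup[OF g] \<Lambda>_sub by (simp add: coinduced_family_def)
      then show "graph (H \<inter> (g <#\<^bsub>G\<^esub> K #>\<^bsub>G\<^esub> inv g)) (set_hom T (conj_action G g \<psi>) b) \<in> F"
        using \<Lambda>_F[OF g] by simp
    qed
  next
    assume r: "\<forall>g\<in>carrier G. graph (H \<inter> (g <#\<^bsub>G\<^esub> K #>\<^bsub>G\<^esub> inv g)) (set_hom T (conj_action G g \<psi>) b) \<in> F"
    have "\<Delta> \<in> F" if \<Delta>: "subgroup \<Delta> ?D" "\<Delta> \<subseteq> ?\<Gamma>" "fst ` \<Delta> \<in> subconj_family G H" for \<Delta>
    proof -
      obtain g where g: "g \<in> carrier G" "g <#\<^bsub>G\<^esub> (fst ` \<Delta>) #>\<^bsub>G\<^esub> inv g \<subseteq> H"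
        using \<Delta>(3) by (auto simp: subconj_family_def)
      have "\<Delta> \<subseteq> \<Lambda> g"
      proof
        fix p assume p: "p \<in> \<Delta>"
        then obtain k where k: "k \<in> K" "p = (k, ?s k)" using \<Delta>(2) by (auto simp: graph_def)
        have "g \<otimes> fst p \<otimes> inv g \<in> H" using g(2) p by (auto simp: conj_set_eq)
        then show "p \<in> \<Lambda> g" using k by (simp add: \<Lambda>_def graph_def)
      qed
      moreover have "\<Lambda> g \<in> F" using r g(1) \<Lambda>_F[OF g(1)] by simp
      ultimately show ?thesis using subgroup_familyD(3)[OF F _ \<Delta>(1)] by blast
    qed
    then show "?\<Gamma> \<in> coinduced_family ?D fst (subconj_family G H) F"
      using \<Gamma> by (simp add: coinduced_family_def)
  qed
qed

lemma conj_action_bij: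
  assumes \<psi>: "group_action (G\<lparr>carrier := K\<rparr>) T \<psi>" and g: "g \<in> carrier G" and K: "K \<subseteq> carrier G"
    and x: "x \<in> g <#\<^bsub>G\<^esub> K #>\<^bsub>G\<^esub> inv g"
  shows "inv g \<otimes> x \<otimes> g \<in> K" "conj_action G g \<psi> x \<in> Bij T"
proof -
  obtain k where k: "k \<in> K" "x = g \<otimes> k \<otimes> inv g" using x by (auto simp: conj_set_eq)
  have "inv g \<otimes> x \<otimes> g = k"
    using k g K by (simp add: m_assoc subset_iff) (simp flip: m_assoc)
  then show 1: "inv g \<otimes> x \<otimes> g \<in> K" using k by simp
  interpret \<psi>: group_action "G\<lparr>carrier := K\<rparr>" T \<psi> by (rule \<psi>)
  show "conj_action G g \<psi> x \<in> Bij T" unfolding conj_action_def using \<psi>.bij_prop0 1 by simp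
qed

lemma conj_action_group_action:
  assumes K: "subgroup K G" and \<psi>: "group_action (G\<lparr>carrier := K\<rparr>) T \<psi>" and g: "g \<in> carrier G"
    and L: "subgroup L G" "L \<subseteq> g <#\<^bsub>G\<^esub> K #>\<^bsub>G\<^esub> inv g"
  shows "group_action (G\<lparr>carrier := L\<rparr>) T (conj_action G g \<psi>)"
proof -
  interpret \<psi>: group_action "G\<lparr>carrier := K\<rparr>" T \<psi> by (rule \<psi>)
  note LG = subgroup.subset[OF L(1)]
  have Bij: "conj_action G g \<psi> x \<in> Bij T" and inK: "inv g \<otimes> x \<otimes> g \<in> K" if "x \<in> L" for x
    using conj_action_bij[OF \<psi> g subgroup.subset[OF K]] L(2) that by auto
  show ?thesis
  proof (rule group_actionI)
    show "group (G\<lparr>carrier := L\<rparr>)" by (rule subgroup_imp_group[OF L(1)])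
    show "conj_action G g \<psi> x \<in> extensional T" if "x \<in> carrier (G\<lparr>carrier := L\<rparr>)" for x
      using Bij that by (simp add: Bij_def)
    show "conj_action G g \<psi> x t \<in> T" if "x \<in> carrier (G\<lparr>carrier := L\<rparr>)" "t \<in> T" for x t
      using Bij that by (auto simp: Bij_def dest: bij_betwE)
    show "conj_action G g \<psi> \<one>\<^bsub>G\<lparr>carrier := L\<rparr>\<^esub> t = t" if "t \<in> T" for t
      using g \<psi>.id_eq_one[symmetric] that by (simp add: conj_action_def)
    fix x y t assume xy: "x \<in> carrier (G\<lparr>carrier := L\<rparr>)" "y \<in> carrier (G\<lparr>carrier := L\<rparr>)" and t: "t \<in> T"
    have "inv g \<otimes> (x \<otimes> y) \<otimes> g = (inv g \<otimes> x \<otimes> g) \<otimes> (inv g \<otimes> y \<otimes> g)"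
      using xy g LG by (simp add: m_assoc subset_iff) (simp flip: m_assoc)
    then show "conj_action G g \<psi> (x \<otimes>\<^bsub>G\<lparr>carrier := L\<rparr>\<^esub> y) t = conj_action G g \<psi> x (conj_action G g \<psi> y t)"
      using \<psi>.composition_rule[OF t, of "inv g \<otimes> x \<otimes> g" "inv g \<otimes> y \<otimes> g"] inK xy
      by (simp add: conj_action_def)
  qed
qed

text \<open>The family of a level is unique; hence one may be fixed in advance.\<close>

lemma admissible_iff:
  assumes F: "graph_subgroup_family G (card T) F"
    "universal_space (G \<times>\<times> sym_group (card T)) (level P (card T)) (opact P (card T)) F"
  shows "admissible G P K T \<psi> \<longleftrightarrow> (\<exists>b. bij_betw b T {1..card T} \<and> graph K (set_hom T \<psi> b) \<in> F)"
  unfolding admissible_def set_hom_graph using F universal_family_unique[OF F(2)] by blast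

end

section \<open>Admissible sets of the mapping operad\<close>

locale universal_mapping_operad = G: group G
  for G :: "('g, 'b) monoid_scheme" +
  fixes H :: "'g set" and P :: "('g, 'x) operad"
    and E :: "'e topology" and \<phi> :: "'g \<Rightarrow> 'e \<Rightarrow> 'e"
    and Y :: "'y topology" and \<theta> :: "'g \<Rightarrow> 'y \<Rightarrow> 'y"
  assumes H: "subgroup H G"
    and P: "N_infty_operad G P"
    and E: "universal_space G E \<phi> (subconj_family G H)"
    and E_Hausdorff: "Hausdorff_space E"
    and Y: "G_CW_complex G Y \<theta>" and EY: "G_homotopy_equivalent G E \<phi> Y \<theta>"
begin

sublocale mapping_operad G P E \<phi>
  using P E E_Hausdorff
  by (intro mapping_operad.intro mapping_operad_axioms.intro) (auto simp: N_infty_operad_def universal_space_def)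

abbreviation coind where
  "coind n F \<equiv> coinduced_family (G \<times>\<times> sym_group n) fst (subconj_family G H) F"

lemma coind:
  assumes "graph_subgroup_family G n F"
    and "universal_space (G \<times>\<times> sym_group n) (level P n) (opact P n) F"
  shows "graph_subgroup_family G n (coind n F)"
    and "universal_space (G \<times>\<times> sym_group n) (level Q n) (opact Q n) (coind n F)"
proof -
  show "graph_subgroup_family G n (coind n F)"
    using E by (intro G.coinduced_graph_subgroup_family H assms(1)) (simp add: universal_space_def)
  show "universal_space (G \<times>\<times> sym_group n) (level Q n) (opact Q n) (coind n F)"
    unfolding level_Q opact_Q
    by (rule map_space_universal[OF G.is_group G.prod_sym_group G.prod_sym_fst_hom E E_Hausdorff Y EY assms(2)])
qed

lemma obtain_family:
  obtains F where "graph_subgroup_family G n F"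
    "universal_space (G \<times>\<times> sym_group n) (level P n) (opact P n) F"
  using P unfolding N_infty_operad_def by blast

lemma N_infty_Q: "N_infty_operad G Q"
  unfolding N_infty_operad_def
proof (intro conjI allI)
  show "G_operad G Q" by (rule G_operad_Q)
  fix n
  obtain F where "graph_subgroup_family G n F"
    "universal_space (G \<times>\<times> sym_group n) (level P n) (opact P n) F" by (rule obtain_family)
  from coind[OF this]
  show "\<exists>F. graph_subgroup_family G n F \<and> universal_space (G \<times>\<times> sym_group n) (level Q n) (opact Q n) F"
    by blast
qed

lemma admissible_Q_iff:
  assumes K: "subgroup K G" and T: "finite T" and \<psi>: "group_action (G\<lparr>carrier := K\<rparr>) T \<psi>"
  shows "admissible G Q K T \<psi> \<longleftrightarrow>
    (\<forall>g\<in>carrier G. admissible G P (H \<inter> (g <#\<^bsub>G\<^esub> K #>\<^bsub>G\<^esub> inv\<^bsub>G\<^esub> g)) T (conj_action G g \<psi>))"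
proof -
  let ?n = "card T" and ?K = "\<lambda>g. H \<inter> (g <#\<^bsub>G\<^esub> K #>\<^bsub>G\<^esub> inv\<^bsub>G\<^esub> g)"
  obtain F where F: "graph_subgroup_family G ?n F"
    "universal_space (G \<times>\<times> sym_group ?n) (level P ?n) (opact P ?n) F" by (rule obtain_family)
  have F_fam: "subgroup_family (G \<times>\<times> sym_group ?n) F" using F(1) by (simp add: graph_subgroup_family_def)
  note iff_Q = G.admissible_iff[OF coind[OF F], of K \<psi>]
  note iff_P = G.admissible_iff[OF F]
  note graph_iff = G.graph_in_coinduced_family_iff[OF H K \<psi> _ F_fam]
  show ?thesis
  proof
    assume "admissible G Q K T \<psi>"
    then obtain b where b: "bij_betw b T {1..?n}" "graph K (set_hom T \<psi> b) \<in> coind ?n F"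
      using iff_Q by blast
    then have "\<forall>g\<in>carrier G. graph (?K g) (set_hom T (conj_action G g \<psi>) b) \<in> F"
      using graph_iff by blast
    then show "\<forall>g\<in>carrier G. admissible G P (?K g) T (conj_action G g \<psi>)"
      using iff_P b(1) by blast
  next
    assume r: "\<forall>g\<in>carrier G. admissible G P (?K g) T (conj_action G g \<psi>)"
    obtain b where b: "bij_betw b T {1..?n}"
      using ex_bij_betw_nat_finite_1[OF T] bij_betw_inv_into by blast
    have "graph (?K g) (set_hom T (conj_action G g \<psi>) b) \<in> F" if g: "g \<in> carrier G" for g
    proof -
      obtain b' where b': "bij_betw b' T {1..?n}" "graph (?K g) (set_hom T (conj_action G g \<psi>) b') \<in> F"
        using r g iff_P by blast
      show ?thesis
      proof (rule G.graph_reindex[OF F_fam _ _ b'(1) b b'(2)])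
        show "?K g \<subseteq> carrier G" using subgroup.subset[OF H] by blast
        show "bij_betw (conj_action G g \<psi> x) T T" if "x \<in> ?K g" for x
          using G.conj_action_bij(2)[OF \<psi> g subgroup.subset[OF K]] that by (simp add: Bij_def)
      qed
    qed
    then have "graph K (set_hom T \<psi> b) \<in> coind ?n F" using graph_iff[OF b] by blast
    then show "admissible G Q K T \<psi>" using iff_Q b by blast
  qed
qed

text \<open>Membership in the family of a level is detected by fixed points, which do not depend on the ambient
group.\<close>

lemma admissible_restrict:
  assumes L: "L \<subseteq> H" and adm: "admissible (G\<lparr>carrier := H\<rparr>) P L T \<psi>"
  shows "admissible G P L T \<psi>"
proof -
  let ?n = "card T" and ?D = "G \<times>\<times> sym_group (card T)" and ?DH = "G\<lparr>carrier := H\<rparr> \<times>\<times> sym_group (card T)"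
  obtain F' b where F': "universal_space ?DH (level P ?n) (opact P ?n) F'" "subgroup_family ?DH F'"
    and b: "bij_betw b T {1..?n}" "graph L (set_hom T \<psi> b) \<in> F'"
    using adm unfolding admissible_def set_hom_graph graph_subgroup_family_def by blast
  obtain F where F: "graph_subgroup_family G ?n F"
    "universal_space ?D (level P ?n) (opact P ?n) F" by (rule obtain_family)
  let ?\<Gamma> = "graph L (set_hom T \<psi> b)"
  interpret S: group "sym_group ?n" by (rule sym_group_is_group)
  interpret D: group ?D by (rule G.prod_sym_group)
  have "?DH = ?D\<lparr>carrier := H \<times> carrier (sym_group ?n)\<rparr>" by (simp add: DirProd_def)
  moreover have sub': "subgroup ?\<Gamma> ?DH" by (rule subgroup_familyD(1)[OF F'(2) b(2)])
  moreover have "subgroup (H \<times> carrier (sym_group ?n)) ?D"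
    by (intro DirProd_subgroups G.is_group H sym_group_is_group S.subgroup_self)
  ultimately have sub: "subgroup ?\<Gamma> ?D" using D.incl_subgroup by metis
  have "topspace (fixed_space (level P ?n) (opact P ?n) ?\<Gamma>) \<noteq> {}"
    using universal_family_iff[OF F'(1) sub'] b(2) by blast
  then have "?\<Gamma> \<in> F" using universal_family_iff[OF F(2) sub] by blast
  then show ?thesis using G.admissible_iff[OF F] b(1) by blast
qed

lemma genuine_Q:
  assumes gen: "genuine_E_infty (G\<lparr>carrier := H\<rparr>) P"
  shows "genuine_E_infty G Q"
  unfolding genuine_E_infty_def
proof (intro conjI allI impI N_infty_Q)
  fix K and T :: "nat set" and \<psi>
  assume "subgroup K G \<and> finite T \<and> group_action (G\<lparr>carrier := K\<rparr>) T \<psi>"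
  then have K: "subgroup K G" and T: "finite T" and \<psi>: "group_action (G\<lparr>carrier := K\<rparr>) T \<psi>" by auto
  show "admissible G Q K T \<psi>"
    unfolding admissible_Q_iff[OF K T \<psi>]
  proof
    fix g assume g: "g \<in> carrier G"
    let ?K = "H \<inter> (g <#\<^bsub>G\<^esub> K #>\<^bsub>G\<^esub> inv\<^bsub>G\<^esub> g)"
    have sub: "subgroup ?K G" by (intro G.subgroups_Inter_pair H G.conj_subgroup g K)
    have "subgroup ?K (G\<lparr>carrier := H\<rparr>)" by (rule G.subgroup_incl[OF sub H]) simp
    moreover have "group_action (G\<lparr>carrier := H, carrier := ?K\<rparr>) T (conj_action G g \<psi>)"
      using G.conj_action_group_action[OF K \<psi> g sub] by simp
    ultimately have "admissible (G\<lparr>carrier := H\<rparr>) P ?K T (conj_action G g \<psi>)"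
      using gen T unfolding genuine_E_infty_def by blast
    then show "admissible G P ?K T (conj_action G g \<psi>)" by (intro admissible_restrict) auto
  qed
qed

end

theorem corollary5p7:
  fixes G :: "('g, 'b) monoid_scheme" and H :: "'g set"
    and P :: "('g, 'x) operad"
    and E :: "'e topology" and \<phi> :: "'g \<Rightarrow> 'e \<Rightarrow> 'e"
    and Y :: "'y topology" and \<theta> :: "'g \<Rightarrow> 'y \<Rightarrow> 'y"
  assumes "group G" and "finite (carrier G)"
    and "subgroup H G"
    and "N_infty_operad G P"
    and "universal_space G E \<phi> (subconj_family G H)"
    and "Hausdorff_space E"
    and "G_CW_complex G Y \<theta>" and "G_homotopy_equivalent G E \<phi> Y \<theta>"
  shows "(\<forall>K (T :: 't set) \<psi>.
            subgroup K G \<and> finite T \<and> group_action (G\<lparr>carrier := K\<rparr>) T \<psi> \<longrightarrow>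
            (admissible G (map_operad G E \<phi> P) K T \<psi> \<longleftrightarrow>
             (\<forall>g\<in>carrier G.
                admissible G P (H \<inter> (g <#\<^bsub>G\<^esub> K #>\<^bsub>G\<^esub> inv\<^bsub>G\<^esub> g)) T (conj_action G g \<psi>))))
       \<and> (genuine_E_infty (G\<lparr>carrier := H\<rparr>) P \<longrightarrow> genuine_E_infty G (map_operad G E \<phi> P))"
proof -
  interpret universal_mapping_operad G H P E \<phi> Y \<theta>
    using assms by (intro universal_mapping_operad.intro universal_mapping_operad_axioms.intro)
  show ?thesis using admissible_Q_iff genuine_Q by blast
qed

end
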